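(* Consider inviscid compressible fluid flow in a Riemannian manifold $(M,g)$ of any dimension $n>1$, with fluid velocity vector $u$, mass density $\rho$, entropy $S$ and pressure $P$, $$u_t+(u\rfloor\nabla)u=-\rho^{-1}\,\mathrm{grad}\,P,\qquad \rho_t+\mathrm{div}(\rho u)=0,\qquad S_t+u\rfloor\nabla S=0,\qquad P=P(\rho,S),$$ and let $1\le p\le n-1$. (i) No non-trivial kinematic conserved $p$-form densities $\boldsymbol\alpha(t,x,u,\rho,S)$ are admitted for a general equation of state $P(\rho,S)$. (ii) The only special equations of state for which a non-trivial kinematic conserved $p$-form density $\boldsymbol\alpha(t,x,u,\rho,S)$ arises is the barotropic case $P=P(\rho)$. The admitted conserved $p$-form density consists of the circulation $$\boldsymbol\alpha=\boldsymbol u\qquad(p=1),$$ where $\boldsymbol u$ is the fluid velocity $1$-form defined by the dual of $u$ with respect to $g$, namely $\zeta\rfloor\boldsymbol u=g(\zeta,u)$ for an arbitrary vector field $\zeta$.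
   Context: $\nabla$ is the covariant derivative determined by $\nabla g=0$; $\mathrm{grad}$ and $\mathrm{div}$ are the Riemannian gradient and divergence; $\rfloor$ denotes contraction (interior product). The pressure satisfies $P_\rho\neq0$ or $P_S\neq0$. A kinematic $p$-form density is a $p$-form function $\boldsymbol\alpha(t,x,u,\rho,S)$ of time and space coordinates and the fluid variables. It is conserved (on $p$-dimensional surfaces moving with the fluid) if there is a $(p-1)$-form function $\boldsymbol\beta$ of $t,x,u,\rho,S$ and spatial derivatives of $u,\rho,S$ such that $$D_t\boldsymbol\alpha+\mathcal L_u\boldsymbol\alpha=-\mathbf d\boldsymbol\beta$$ holds for all formal solutions of the fluid equations. Here $D_t$ is the total time derivative, $\mathbf d$ is the exterior derivative acting as a total spatial derivative, and $\mathcal L_u\boldsymbol\alpha=u\rfloor\mathbf d\boldsymbol\alpha+\mathbf d(u\rfloor\boldsymbol\alpha)$. Equivalently, $\frac{d}{dt}\int_{\mathcal S(t)}\boldsymbol\alpha=-\int_{\partial\mathcal S(t)}\boldsymbol\beta$ for every orientable $p$-dimensional submanifold $\mathcal S(t)$ transported along the fluid streamlines. If $\boldsymbol\alpha=\mathbf d\boldsymbol\Theta$ for all formal solutions, for some $(p-1)$-form function $\boldsymbol\Theta$ of the same variables, then the conserved integral reduces to a boundary integral with flux $\boldsymbol\beta=-(D_t\boldsymbol\Theta+\mathcal L_u\boldsymbol\Theta)$; when this flux is non-zero the conservation law is called trivial (when it vanishes, $\int_{\partial\mathcal S(t)}\boldsymbol\Theta$ is itself regarded as a non-trivial constant of motion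 on the $(p-1)$-dimensional moving surface $\partial\mathcal S(t)$). Densities depending only on $(t,x)$ are counted as trivial. *)

theory Defs
  imports "HOL-Analysis.Analysis"
begin

section \<open>Smooth functions and partial derivatives\<close>

primrec Ck_on :: "nat \<Rightarrow> 'a::euclidean_space set \<Rightarrow> ('a \<Rightarrow> 'b::real_normed_vector) \<Rightarrow> bool" where
  "Ck_on 0 U f \<longleftrightarrow> continuous_on U f"
| "Ck_on (Suc k) U f \<longleftrightarrow> (\<forall>x\<in>U. f differentiable (at x)) \<and>
     (\<forall>v. Ck_on k U (\<lambda>x. frechet_derivative f (at x) v))"

text \<open>Only used for open sets \<open>U\<close>.\<close>

definition smooth_on :: "'a::euclidean_space set \<Rightarrow> ('a \<Rightarrow> 'b::real_normed_vector) \<Rightarrow> bool" where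
  "smooth_on U f \<longleftrightarrow> (\<forall>k. Ck_on k U f)"

definition pd :: "'n::finite \<Rightarrow> (real^'n \<Rightarrow> real) \<Rightarrow> real^'n \<Rightarrow> real" where
  "pd i f y = frechet_derivative f (at y) (axis i 1)"


section \<open>Smooth manifolds\<close>

text \<open>A chart is a pair of its domain and its coordinate map. The manifold is the whole
  type \<open>'m\<close>, and its dimension is \<open>CARD('n)\<close>.\<close>

type_synonym ('m, 'n) chart = "'m set \<times> ('m \<Rightarrow> real^'n)"

definition chart_image :: "('m, 'n::finite) chart \<Rightarrow> (real^'n) set" where
  "chart_image c = snd c ` fst c"

definition transition :: "('m, 'n::finite) chart \<Rightarrow> ('m, 'n) chart \<Rightarrow> real^'n \<Rightarrow> real^'n" where
  "transition c c' = snd c' \<circ> inv_into (fst c) (snd c)"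

definition jacobian ::
  "('m, 'n::finite) chart \<Rightarrow> ('m, 'n) chart \<Rightarrow> real^'n \<Rightarrow> real^'n \<Rightarrow> real^'n" where
  "jacobian c c' y = frechet_derivative (transition c c') (at y)"

definition smooth_atlas ::
  "('m::{t2_space, second_countable_topology}, 'n::finite) chart set \<Rightarrow> bool" where
  "smooth_atlas A \<longleftrightarrow>
     (\<forall>c\<in>A. open (fst c) \<and> open (chart_image c) \<and>
        homeomorphism (fst c) (chart_image c) (snd c) (inv_into (fst c) (snd c))) \<and>
     (\<Union>c\<in>A. fst c) = UNIV \<and>
     (\<forall>c\<in>A. \<forall>c'\<in>A. smooth_on (snd c ` (fst c \<inter> fst c')) (transition c c'))"


section \<open>Riemannian metrics\<close>

text \<open>Tensor fields are given by their components in every chart, subject to the tensorial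
  transformation law on overlaps. A metric is a family of Gram matrices.\<close>

definition riemannian_manifold ::
  "('m::{t2_space, second_countable_topology}, 'n::finite) chart set \<Rightarrow>
   (('m, 'n) chart \<Rightarrow> real^'n \<Rightarrow> real^'n^'n) \<Rightarrow> bool" where
  "riemannian_manifold A g \<longleftrightarrow> smooth_atlas A \<and>
     (\<forall>c\<in>A. smooth_on (chart_image c) (g c) \<and>
        (\<forall>y\<in>chart_image c. transpose (g c y) = g c y \<and>
           (\<forall>v. v \<noteq> 0 \<longrightarrow> v \<bullet> (g c y *v v) > 0))) \<and>
     (\<forall>c\<in>A. \<forall>c'\<in>A. \<forall>x\<in>fst c \<inter> fst c'. \<forall>v w.
        v \<bullet> (g c (snd c x) *v w) =
          jacobian c c' (snd c x) v \<bullet> (g c' (snd c' x) *v jacobian c c' (snd c x) w))"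

text \<open>Below, \<open>G\<close> is the matrix of the metric in one fixed chart.
  \<open>christoffel G i j k\<close> is the symbol with upper index \<open>i\<close> and lower indices \<open>j\<close>, \<open>k\<close>
  of the Levi-Civita connection.\<close>

definition christoffel ::
  "(real^'n \<Rightarrow> real^'n^'n) \<Rightarrow> 'n::finite \<Rightarrow> 'n \<Rightarrow> 'n \<Rightarrow> real^'n \<Rightarrow> real" where
  "christoffel G i j k y = (1/2) * (\<Sum>l\<in>UNIV. matrix_inv (G y) $ i $ l *
     (pd j (\<lambda>x. G x $ l $ k) y + pd k (\<lambda>x. G x $ l $ j) y - pd l (\<lambda>x. G x $ j $ k) y))"

text \<open>The component \<open>(\<nabla>\<^sub>j w)\<^sup>i\<close>.\<close>

definition cov_pd ::
  "(real^'n \<Rightarrow> real^'n^'n) \<Rightarrow> 'n::finite \<Rightarrow> (real^'n \<Rightarrow> real^'n) \<Rightarrow> 'n \<Rightarrow> real^'n \<Rightarrow> real" where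
  "cov_pd G j w i y = pd j (\<lambda>x. w x $ i) y + (\<Sum>k\<in>UNIV. christoffel G i j k y * w y $ k)"

definition cov_deriv ::
  "(real^'n \<Rightarrow> real^'n^'n) \<Rightarrow> (real^'n \<Rightarrow> real^'n) \<Rightarrow> (real^'n \<Rightarrow> real^'n) \<Rightarrow> real^'n \<Rightarrow> real^'n::finite" where
  "cov_deriv G u w y = (\<chi> i. \<Sum>j\<in>UNIV. u y $ j * cov_pd G j w i y)"

definition divergence ::
  "(real^'n \<Rightarrow> real^'n^'n) \<Rightarrow> (real^'n::finite \<Rightarrow> real^'n) \<Rightarrow> real^'n \<Rightarrow> real" where
  "divergence G w y = (\<Sum>i\<in>UNIV. cov_pd G i w i y)"

definition grad ::
  "(real^'n \<Rightarrow> real^'n^'n) \<Rightarrow> (real^'n::finite \<Rightarrow> real) \<Rightarrow> real^'n \<Rightarrow> real^'n" where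
  "grad G f y = matrix_inv (G y) *v (\<chi> j. pd j f y)"


section \<open>Exterior calculus in a chart\<close>

text \<open>An alternating \<open>p\<close>-form at a point is a multilinear function of lists of \<open>p\<close> vectors,
  extended by zero to lists of any other length.\<close>

type_synonym 'n form = "(real^'n) list \<Rightarrow> real"

definition alt_form :: "nat \<Rightarrow> 'n::finite form \<Rightarrow> bool" where
  "alt_form p \<omega> \<longleftrightarrow>
     (\<forall>vs. length vs \<noteq> p \<longrightarrow> \<omega> vs = 0) \<and>
     (\<forall>vs i. length vs = p \<and> i < p \<longrightarrow> linear (\<lambda>w. \<omega> (vs[i := w]))) \<and>
     (\<forall>vs i j. length vs = p \<and> i < j \<and> j < p \<and> vs ! i = vs ! j \<longrightarrow> \<omega> vs = 0)"

definition interior_prod :: "real^'n \<Rightarrow> 'n::finite form \<Rightarrow> 'n form" where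
  "interior_prod v \<omega> vs = \<omega> (v # vs)"

text \<open>The invariant formula for the exterior derivative, evaluated on constant vector fields.\<close>

definition ext_deriv :: "(real^'n \<Rightarrow> 'n::finite form) \<Rightarrow> real^'n \<Rightarrow> 'n form" where
  "ext_deriv \<omega> y vs = (\<Sum>i<length vs. (-1)^i *
     frechet_derivative (\<lambda>x. \<omega> x (take i vs @ drop (Suc i) vs)) (at y) (vs ! i))"

definition lie_deriv ::
  "(real^'n \<Rightarrow> real^'n) \<Rightarrow> (real^'n \<Rightarrow> 'n::finite form) \<Rightarrow> real^'n \<Rightarrow> 'n form" where
  "lie_deriv u \<omega> y vs = interior_prod (u y) (ext_deriv \<omega> y) vs
     + ext_deriv (\<lambda>x. interior_prod (u x) (\<omega> x)) y vs"


section \<open>The fluid equations\<close>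

text \<open>The condition \<open>P\<^sub>\<rho> \<noteq> 0\<close> or \<open>P\<^sub>S \<noteq> 0\<close> is meant as a condition on functions: the pressure is not
  constant.\<close>

definition equation_of_state :: "(real \<Rightarrow> real \<Rightarrow> real) \<Rightarrow> bool" where
  "equation_of_state P \<longleftrightarrow> smooth_on ({0<..} \<times> UNIV) (\<lambda>(\<rho>, S). P \<rho> S) \<and>
     (\<exists>\<rho> S. \<rho> > 0 \<and> (deriv (\<lambda>r. P r S) \<rho> \<noteq> 0 \<or> deriv (\<lambda>s. P \<rho> s) S \<noteq> 0))"

definition barotropic :: "(real \<Rightarrow> real \<Rightarrow> real) \<Rightarrow> bool" where
  "barotropic P \<longleftrightarrow> (\<exists>f. \<forall>\<rho> S. \<rho> > 0 \<longrightarrow> P \<rho> S = f \<rho>)"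

text \<open>Fields are functions of time and of the coordinates of the chart \<open>c\<close>, the latter ranging
  over an open set \<open>W\<close>. The system is in evolution form: on a formal solution the spatial jets
  at time \<open>t\<close> are arbitrary, except for \<open>\<rho> > 0\<close>, and the fluid equations give all time
  derivatives. The identities below involve only first time derivatives of the fields, at time
  \<open>t\<close>. So a formal solution is rendered by arbitrary smooth fields on the time slice \<open>t\<close>, whose time
  derivatives there are given by the fluid equations; every finite spatial jet is attained by such
  fields.\<close>

definition formal_solution ::
  "(('m, 'n) chart \<Rightarrow> real^'n \<Rightarrow> real^'n^'n) \<Rightarrow> (real \<Rightarrow> real \<Rightarrow> real) \<Rightarrow>
   ('m, 'n::finite) chart \<Rightarrow> real \<Rightarrow> (real^'n) set \<Rightarrow>
   (real \<Rightarrow> real^'n \<Rightarrow> real^'n) \<Rightarrow> (real \<Rightarrow> real^'n \<Rightarrow> real) \<Rightarrow> (real \<Rightarrow> real^'n \<Rightarrow> real) \<Rightarrow> bool" where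
  "formal_solution g P c t W u \<rho> S \<longleftrightarrow>
     open W \<and> W \<subseteq> chart_image c \<and>
     smooth_on W (u t) \<and> smooth_on W (\<rho> t) \<and> smooth_on W (S t) \<and>
     (\<forall>y\<in>W. \<rho> t y > 0 \<and>
        ((\<lambda>s. u s y) has_vector_derivative
           - cov_deriv (g c) (u t) (u t) y
           - (1 / \<rho> t y) *\<^sub>R grad (g c) (\<lambda>x. P (\<rho> t x) (S t x)) y) (at t) \<and>
        ((\<lambda>s. \<rho> s y) has_real_derivative
           - divergence (g c) (\<lambda>x. \<rho> t x *\<^sub>R u t x) y) (at t) \<and>
        ((\<lambda>s. S s y) has_real_derivative
           - frechet_derivative (S t) (at y) (u t y)) (at t))"


section \<open>Kinematic form densities\<close>

text \<open>A kinematic density \<open>\<alpha> c t y u \<rho> S\<close> is given in each chart \<open>c\<close> as a form-valued function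
  of time, the coordinates \<open>y\<close>, and the values of the fluid variables, with \<open>u\<close> expressed by its
  components in the chart.\<close>

type_synonym ('m, 'n) kinematic =
  "('m, 'n) chart \<Rightarrow> real \<Rightarrow> real^'n \<Rightarrow> real^'n \<Rightarrow> real \<Rightarrow> real \<Rightarrow> 'n form"

definition kinematic_form :: "('m, 'n::finite) chart set \<Rightarrow> nat \<Rightarrow> ('m, 'n) kinematic \<Rightarrow> bool" where
  "kinematic_form A p \<alpha> \<longleftrightarrow>
     (\<forall>c\<in>A. \<forall>t u \<rho> S. \<forall>y\<in>chart_image c. \<rho> > 0 \<longrightarrow> alt_form p (\<alpha> c t y u \<rho> S)) \<and>
     (\<forall>c\<in>A. \<forall>vs. smooth_on (UNIV \<times> chart_image c \<times> UNIV \<times> {0<..} \<times> UNIV)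
        (\<lambda>(t, y, u, \<rho>, S). \<alpha> c t y u \<rho> S vs)) \<and>
     (\<forall>c\<in>A. \<forall>c'\<in>A. \<forall>x\<in>fst c \<inter> fst c'. \<forall>t u \<rho> S vs. \<rho> > 0 \<longrightarrow>
        \<alpha> c t (snd c x) u \<rho> S vs =
          \<alpha> c' t (snd c' x) (jacobian c c' (snd c x) u) \<rho> S (map (jacobian c c' (snd c x)) vs))"

definition on_fields ::
  "('m, 'n) kinematic \<Rightarrow> ('m, 'n::finite) chart \<Rightarrow> real \<Rightarrow> (real \<Rightarrow> real^'n \<Rightarrow> real^'n) \<Rightarrow>
   (real \<Rightarrow> real^'n \<Rightarrow> real) \<Rightarrow> (real \<Rightarrow> real^'n \<Rightarrow> real) \<Rightarrow> real^'n \<Rightarrow> 'n form" where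
  "on_fields \<alpha> c t u \<rho> S y = \<alpha> c t y (u t y) (\<rho> t y) (S t y)"

text \<open>The total derivatives of a function of the fluid variables, evaluated on given fields, are
  the ordinary derivatives of the function composed with these fields.
  So this is \<open>D\<^sub>t \<alpha> + \<L>\<^sub>u \<alpha>\<close>.\<close>

definition advective_deriv ::
  "('m, 'n) kinematic \<Rightarrow> ('m, 'n::finite) chart \<Rightarrow> real \<Rightarrow> (real \<Rightarrow> real^'n \<Rightarrow> real^'n) \<Rightarrow>
   (real \<Rightarrow> real^'n \<Rightarrow> real) \<Rightarrow> (real \<Rightarrow> real^'n \<Rightarrow> real) \<Rightarrow> real^'n \<Rightarrow> 'n form" where
  "advective_deriv \<alpha> c t u \<rho> S y vs =
     deriv (\<lambda>s. on_fields \<alpha> c s u \<rho> S y vs) t + lie_deriv (u t) (on_fields \<alpha> c t u \<rho> S) y vs"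


section \<open>Differential form functions on jet space\<close>

text \<open>Coordinates on the jet space of a chart: \<open>Vel i l\<close> stands for the iterated partial derivative
  of the component \<open>u\<^sup>i\<close> along the list \<open>l\<close> of coordinate directions. Lists that are permutations of
  each other give redundant coordinates, which agree on the jets of smooth fields.\<close>

datatype 'n jet_coord = Time | Pos 'n | Vel 'n "'n list" | Dens "'n list" | Entr "'n list"

type_synonym 'n jet = "'n jet_coord \<Rightarrow> real"

primrec jet_order :: "'n jet_coord \<Rightarrow> nat" where
  "jet_order Time = 0"
| "jet_order (Pos i) = 0"
| "jet_order (Vel i l) = length l"
| "jet_order (Dens l) = length l"
| "jet_order (Entr l) = length l"

primrec jet_of ::
  "real \<Rightarrow> real^'n \<Rightarrow> (real^'n::finite \<Rightarrow> real^'n) \<Rightarrow> (real^'n \<Rightarrow> real) \<Rightarrow> (real^'n \<Rightarrow> real) \<Rightarrow> 'n jet_coord \<Rightarrow> real"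
where
  "jet_of t y u \<rho> S Time = t"
| "jet_of t y u \<rho> S (Pos i) = y $ i"
| "jet_of t y u \<rho> S (Vel i l) = foldr pd l (\<lambda>x. u x $ i) y"
| "jet_of t y u \<rho> S (Dens l) = foldr pd l \<rho> y"
| "jet_of t y u \<rho> S (Entr l) = foldr pd l S y"

definition jet_domain :: "('m, 'n::finite) chart \<Rightarrow> 'n jet set" where
  "jet_domain c = {z. (\<chi> i. z (Pos i)) \<in> chart_image c \<and> z (Dens []) > 0}"

text \<open>Smoothness of functions of jets is existence and continuity of all iterated partial
  derivatives; it is only used for functions depending on finitely many jet coordinates.\<close>

definition jet_pd :: "'n jet_coord \<Rightarrow> ('n jet \<Rightarrow> real) \<Rightarrow> 'n jet \<Rightarrow> real" where
  "jet_pd a f z = deriv (\<lambda>s. f (z(a := s))) (z a)"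

primrec jet_Ck :: "nat \<Rightarrow> 'n jet set \<Rightarrow> ('n jet \<Rightarrow> real) \<Rightarrow> bool" where
  "jet_Ck 0 U f \<longleftrightarrow> continuous_on U f"
| "jet_Ck (Suc k) U f \<longleftrightarrow> continuous_on U f \<and>
     (\<forall>a. (\<forall>z\<in>U. (\<lambda>s. f (z(a := s))) differentiable (at (z a))) \<and> jet_Ck k U (jet_pd a f))"

text \<open>The last clause is the transformation law on overlaps. Fields \<open>u\<close>, \<open>\<rho>\<close>, \<open>S\<close> in the chart \<open>c\<close>
  and \<open>u'\<close>, \<open>\<rho>'\<close>, \<open>S'\<close> in the chart \<open>c'\<close> represent the same fluid fields on the manifold.\<close>

definition jet_form ::
  "('m, 'n::finite) chart set \<Rightarrow> nat \<Rightarrow> (('m, 'n) chart \<Rightarrow> 'n jet \<Rightarrow> 'n form) \<Rightarrow> bool" where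
  "jet_form A q \<beta> \<longleftrightarrow>
     (\<forall>c\<in>A. \<forall>z\<in>jet_domain c. alt_form q (\<beta> c z)) \<and>
     (\<exists>k. \<forall>c\<in>A. \<forall>z\<in>jet_domain c. \<forall>z'\<in>jet_domain c.
        (\<forall>a. jet_order a \<le> k \<longrightarrow> z a = z' a) \<longrightarrow> \<beta> c z = \<beta> c z') \<and>
     (\<forall>c\<in>A. \<forall>vs k. jet_Ck k (jet_domain c) (\<lambda>z. \<beta> c z vs)) \<and>
     (\<forall>c\<in>A. \<forall>c'\<in>A. \<forall>W u \<rho> S u' \<rho>' S'.
        open W \<and> W \<subseteq> snd c ` (fst c \<inter> fst c') \<and>
        smooth_on W u \<and> smooth_on W \<rho> \<and> smooth_on W S \<and>
        smooth_on (transition c c' ` W) u' \<and> smooth_on (transition c c' ` W) \<rho>' \<and>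
        smooth_on (transition c c' ` W) S' \<and>
        (\<forall>y\<in>W. \<rho> y > 0 \<and> u' (transition c c' y) = jacobian c c' y (u y) \<and>
           \<rho>' (transition c c' y) = \<rho> y \<and> S' (transition c c' y) = S y) \<longrightarrow>
        (\<forall>y\<in>W. \<forall>t vs. \<beta> c (jet_of t y u \<rho> S) vs =
           \<beta> c' (jet_of t (transition c c' y) u' \<rho>' S') (map (jacobian c c' y) vs)))"


section \<open>Conservation and triviality\<close>

definition conserved ::
  "('m, 'n::finite) chart set \<Rightarrow> (('m, 'n) chart \<Rightarrow> real^'n \<Rightarrow> real^'n^'n) \<Rightarrow>
   (real \<Rightarrow> real \<Rightarrow> real) \<Rightarrow> nat \<Rightarrow> ('m, 'n) kinematic \<Rightarrow> bool" where
  "conserved A g P p \<alpha> \<longleftrightarrow> kinematic_form A p \<alpha> \<and>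
     (\<exists>\<beta>. jet_form A (p - 1) \<beta> \<and>
        (\<forall>c\<in>A. \<forall>t W u \<rho> S. formal_solution g P c t W u \<rho> S \<longrightarrow>
           (\<forall>y\<in>W. \<forall>vs. advective_deriv \<alpha> c t u \<rho> S y vs =
              - ext_deriv (\<lambda>x. \<beta> c (jet_of t x (u t) (\<rho> t) (S t))) y vs)))"

definition depends_only_on_tx :: "('m, 'n::finite) chart set \<Rightarrow> ('m, 'n) kinematic \<Rightarrow> bool" where
  "depends_only_on_tx A \<alpha> \<longleftrightarrow>
     (\<forall>c\<in>A. \<forall>t. \<forall>y\<in>chart_image c. \<forall>u \<rho> S u' \<rho>' S'. \<rho> > 0 \<and> \<rho>' > 0 \<longrightarrow>
        \<alpha> c t y u \<rho> S = \<alpha> c t y u' \<rho>' S')"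

text \<open>The second alternative: \<open>\<alpha> = d\<Theta>\<close> on formal solutions, where the resulting flux
  \<open>-(D\<^sub>t \<Theta> + \<L>\<^sub>u \<Theta>)\<close> is not identically zero.\<close>

definition trivial_density ::
  "('m, 'n::finite) chart set \<Rightarrow> (('m, 'n) chart \<Rightarrow> real^'n \<Rightarrow> real^'n^'n) \<Rightarrow>
   (real \<Rightarrow> real \<Rightarrow> real) \<Rightarrow> nat \<Rightarrow> ('m, 'n) kinematic \<Rightarrow> bool" where
  "trivial_density A g P p \<alpha> \<longleftrightarrow> depends_only_on_tx A \<alpha> \<or>
     (\<exists>\<Theta>. kinematic_form A (p - 1) \<Theta> \<and>
        (\<forall>c\<in>A. \<forall>t W u \<rho> S. formal_solution g P c t W u \<rho> S \<longrightarrow>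
           (\<forall>y\<in>W. on_fields \<alpha> c t u \<rho> S y = ext_deriv (on_fields \<Theta> c t u \<rho> S) y)) \<and>
        (\<exists>c\<in>A. \<exists>t W u \<rho> S. formal_solution g P c t W u \<rho> S \<and>
           (\<exists>y\<in>W. \<exists>vs. advective_deriv \<Theta> c t u \<rho> S y vs \<noteq> 0)))"

definition nontrivial_conserved ::
  "('m, 'n::finite) chart set \<Rightarrow> (('m, 'n) chart \<Rightarrow> real^'n \<Rightarrow> real^'n^'n) \<Rightarrow>
   (real \<Rightarrow> real \<Rightarrow> real) \<Rightarrow> nat \<Rightarrow> ('m, 'n) kinematic \<Rightarrow> bool" where
  "nontrivial_conserved A g P p \<alpha> \<longleftrightarrow> conserved A g P p \<alpha> \<and> \<not> trivial_density A g P p \<alpha>"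

text \<open>The fluid velocity 1-form, \<open>\<zeta> \<mapsto> g(\<zeta>, u)\<close>.\<close>

definition velocity_form ::
  "(('m, 'n) chart \<Rightarrow> real^'n \<Rightarrow> real^'n^'n) \<Rightarrow> ('m, 'n::finite) kinematic" where
  "velocity_form g c t y u \<rho> S vs = (case vs of [\<zeta>] \<Rightarrow> \<zeta> \<bullet> (g c y *v u) | _ \<Rightarrow> 0)"

end

theory Submission
  imports Defs
begin

text \<open>On formal solutions the time derivatives can be eliminated, so that \<open>E = D\<^sub>t \<alpha> + \<L>\<^sub>u \<alpha>\<close> is a form on the
  fields of one time slice, and this form is affine in their first derivatives. Conservation makes \<open>E\<close>
  exact for arbitrary fields, hence \<open>d E = 0\<close>. We evaluate this identity at one point on two kinds of
  fields: quadratic plane waves isolate the second derivatives in \<open>d E\<close>, and pairs of linear plane waves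
  isolate the terms bilinear in first derivatives. Quadratic waves give \<open>\<alpha>\<^sub>\<rho> = 0\<close>, and, wherever the
  pressure is not stationary, that \<open>\<alpha>\<^sub>u[w]\<close> vanishes on vectors orthogonal to \<open>w\<close> (for \<open>p = 1\<close>). Linear waves
  show that \<open>\<alpha>\<^sub>u[w](v, \<dots>)\<close> is symmetric in \<open>w\<close> and \<open>v\<close>, which for \<open>p \<ge> 2\<close> forces \<open>\<alpha>\<^sub>u = 0\<close> because
  \<open>\<alpha>\<close> is alternating, and they show \<open>\<alpha>\<^sub>S = 0\<close>. For \<open>p = 1\<close> there remains \<open>\<alpha>\<^sub>u[w](v) = K g(w, v)\<close> with
  \<open>K = K(t, x)\<close>; further terms of \<open>d E = 0\<close> read \<open>K P\<^sub>S = 0\<close>, \<open>P\<^sub>\<rho> dK = 0\<close> and \<open>K\<^sub>t = 0\<close>. Conversely, for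
  \<open>P = P(\<rho>)\<close> the circulation has the flux \<open>h(\<rho>) - g(u, u)/2\<close> with \<open>h' = P'/\<rho>\<close>.\<close>

section \<open>Smooth functions\<close>

text \<open>The flux \<beta> is an unknown of arbitrary finite jet order, so the necessity part uses
  only that E is closed. The price is that d(d \<beta>) = 0 must hold for honest derivatives, while
  \<beta> is a function on the infinite product of all jet coordinates; hence the chain rule on jet
  space. What remains is algebra. On wave fields, d E = 0 at one point is a polynomial identity in
  the amplitudes \<open>w\<close>, \<open>w'\<close>, \<open>b\<close>, \<open>c\<close>; setting
  some of them to zero and subtracting isolates one coefficient at a time, and most of the
  lower-order part of E cancels without being computed. The wave covectors are Euclidean unit
  vectors of the chart, orthogonal to the remaining arguments of the form, and p < n makes room for
  them. The pressure may be stationary at many states. This does no harm: once \<alpha> is known to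
  be independent of \<rho> and S, what is learnt at a single state holds at all of them.\<close>

lemma Ck_on_cong:
  assumes "open U" "\<And>x. x \<in> U \<Longrightarrow> f x = g x"
  shows "Ck_on k U f \<longleftrightarrow> Ck_on k U g"
  using assms(2)
proof (induction k arbitrary: f g)
  case 0
  then show ?case by (simp cong: continuous_on_cong)
next
  case (Suc k)
  have d: "(f has_derivative D) (at x) \<longleftrightarrow> (g has_derivative D) (at x)" if "x \<in> U" for x D
    using Suc.prems assms(1) that
    by (metis has_derivative_transform_within_open)
  have "frechet_derivative f (at x) = frechet_derivative g (at x)" if "x \<in> U" for x
    unfolding frechet_derivative_def using d[OF that] by simp
  moreover have "f differentiable (at x) \<longleftrightarrow> g differentiable (at x)" if "x \<in> U" for x
    unfolding differentiable_def using d[OF that] by simp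
  ultimately show ?case
    using Suc.IH[of "\<lambda>x. frechet_derivative f (at x) v" "\<lambda>x. frechet_derivative g (at x) v" for v]
    by simp
qed

lemma smooth_on_cong:
  assumes "open U" "\<And>x. x \<in> U \<Longrightarrow> f x = g x"
  shows "smooth_on U f \<longleftrightarrow> smooth_on U g"
  unfolding smooth_on_def using Ck_on_cong[of U f g, OF assms] by simp

lemma Ck_on_eqI:
  "Ck_on k U g \<Longrightarrow> open U \<Longrightarrow> (\<And>x. x \<in> U \<Longrightarrow> f x = g x) \<Longrightarrow> Ck_on k U f"
  using Ck_on_cong[of U f g] by simp

lemma smooth_on_eqI:
  "smooth_on U g \<Longrightarrow> open U \<Longrightarrow> (\<And>x. x \<in> U \<Longrightarrow> f x = g x) \<Longrightarrow> smooth_on U f"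
  using smooth_on_cong[of U f g] by simp

lemma Ck_on_continuous: "Ck_on k U f \<Longrightarrow> continuous_on U f"
  by (cases k) (auto intro!: continuous_at_imp_continuous_on differentiable_imp_continuous_within)

lemma Ck_on_SucD: "Ck_on (Suc k) U f \<Longrightarrow> Ck_on k U f"
proof (induction k arbitrary: f)
  case 0
  then show ?case using Ck_on_continuous[of "Suc 0"] by simp
qed (metis Ck_on.simps(2))

text \<open>The closure properties below go through this rule: an explicit derivative
  \<open>D\<close> is supplied and, derivatives being unique, replaces the choice operator
  \<open>frechet_derivative\<close>.\<close>

lemma Ck_on_SucI:
  assumes "open U" "\<And>x. x \<in> U \<Longrightarrow> (f has_derivative D x) (at x)" "\<And>v. Ck_on k U (\<lambda>x. D x v)"
  shows "Ck_on (Suc k) U f"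
proof -
  have "frechet_derivative f (at x) = D x" if "x \<in> U" for x
    using frechet_derivative_at assms(2) that by metis
  then have "Ck_on k U (\<lambda>x. frechet_derivative f (at x) v)" for v
    by (intro Ck_on_eqI[OF assms(3)[of v] assms(1)]) auto
  then show ?thesis using assms(2) by (auto simp: differentiable_def)
qed

lemma Ck_on_const: "open U \<Longrightarrow> Ck_on k U (\<lambda>x. c)"
proof (induction k arbitrary: c)
  case (Suc k)
  then show ?case by (intro Ck_on_SucI[where D="\<lambda>x v. 0"]) auto
qed auto

lemma Ck_on_bounded_linear:
  assumes "bounded_linear L" "open U"
  shows "Ck_on k U f \<Longrightarrow> Ck_on k U (\<lambda>x. L (f x))"
proof (induction k arbitrary: f)
  case 0
  then show ?case
    using assms by (simp add: bounded_linear.continuous_on)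
next
  case (Suc k)
  have "((\<lambda>x. L (f x)) has_derivative (\<lambda>v. L (frechet_derivative f (at x) v))) (at x)" if "x \<in> U" for x
    using Suc.prems that bounded_linear.has_derivative[OF assms(1)] frechet_derivative_works
    by (metis Ck_on.simps(2))
  then show ?case using Suc assms(2) by (intro Ck_on_SucI) auto
qed

lemma Ck_on_add:
  assumes "open U"
  shows "Ck_on k U f \<Longrightarrow> Ck_on k U g \<Longrightarrow> Ck_on k U (\<lambda>x. f x + g x)"
proof (induction k arbitrary: f g)
  case (Suc k)
  show ?case
  proof (rule Ck_on_SucI[OF assms])
    fix x assume "x \<in> U"
    then show "((\<lambda>x. f x + g x) has_derivative
        (\<lambda>v. frechet_derivative f (at x) v + frechet_derivative g (at x) v)) (at x)"
      using Suc.prems by (auto intro!: has_derivative_add simp: frechet_derivative_works[symmetric])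
  qed (use Suc in auto)
qed (auto intro: continuous_intros)

lemma Ck_on_bounded_bilinear:
  assumes "bounded_bilinear B" "open U"
  shows "Ck_on k U f \<Longrightarrow> Ck_on k U g \<Longrightarrow> Ck_on k U (\<lambda>x. B (f x) (g x))"
proof (induction k arbitrary: f g)
  case 0
  then show ?case using bounded_bilinear.continuous_on[OF assms(1)] by auto
next
  case (Suc k)
  show ?case
  proof (rule Ck_on_SucI[OF assms(2)])
    fix x assume "x \<in> U"
    then show "((\<lambda>x. B (f x) (g x)) has_derivative
        (\<lambda>v. B (f x) (frechet_derivative g (at x) v) + B (frechet_derivative f (at x) v) (g x))) (at x)"
      using Suc.prems by (auto intro!: bounded_bilinear.FDERIV[OF assms(1)] simp: frechet_derivative_works[symmetric])
  next
    fix v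
    have "Ck_on k U f" "Ck_on k U g" using Suc.prems Ck_on_SucD by auto
    then show "Ck_on k U (\<lambda>x. B (f x) (frechet_derivative g (at x) v) + B (frechet_derivative f (at x) v) (g x))"
      using Suc by (intro Ck_on_add assms Suc.IH) auto
  qed
qed

text \<open>The inner map is linear, so the derivative of the composite is a composite with the same
  \<open>T\<close>, and the induction on \<open>k\<close> closes without a product rule.\<close>

lemma Ck_on_compose_bounded_linear:
  assumes "bounded_linear T" "open U" "open V" "T ` U \<subseteq> V"
  shows "Ck_on k V f \<Longrightarrow> Ck_on k U (\<lambda>x. f (T x))"
proof (induction k arbitrary: f)
  case 0
  then show ?case using assms
    by (simp add: continuous_on_compose2 linear_continuous_on)
next
  case (Suc k)
  have "((\<lambda>x. f (T x)) has_derivative (\<lambda>v. frechet_derivative f (at (T x)) (T v))) (at x)"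
    if "x \<in> U" for x
  proof -
    have "(f has_derivative frechet_derivative f (at (T x))) (at (T x))"
      using Suc.prems that assms(4) by (auto simp: frechet_derivative_works[symmetric])
    from has_derivative_compose[OF bounded_linear_imp_has_derivative[OF assms(1)] this]
    show ?thesis .
  qed
  then show ?case using Suc assms(2)
    by (intro Ck_on_SucI[OF assms(2)]) auto
qed

lemma smooth_on_const: "open U \<Longrightarrow> smooth_on U (\<lambda>x. c)"
  unfolding smooth_on_def using Ck_on_const by blast

lemma smooth_on_differentiable: "smooth_on U f \<Longrightarrow> x \<in> U \<Longrightarrow> f differentiable (at x)"
  unfolding smooth_on_def by (metis Ck_on.simps(2))

lemma smooth_on_has_derivative:
  "smooth_on U f \<Longrightarrow> x \<in> U \<Longrightarrow> (f has_derivative frechet_derivative f (at x)) (at x)"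
  using smooth_on_differentiable frechet_derivative_works by blast

lemma smooth_on_continuous: "smooth_on U f \<Longrightarrow> continuous_on U f"
  unfolding smooth_on_def using Ck_on_continuous by blast

lemma smooth_on_frechet: "smooth_on U f \<Longrightarrow> smooth_on U (\<lambda>x. frechet_derivative f (at x) v)"
  unfolding smooth_on_def by (metis Ck_on.simps(2))

lemma smooth_on_SucI:
  assumes "open U" "\<And>x. x \<in> U \<Longrightarrow> (f has_derivative D x) (at x)" "\<And>v. smooth_on U (\<lambda>x. D x v)"
  shows "smooth_on U f"
  unfolding smooth_on_def
proof
  fix k
  show "Ck_on k U f"
    using Ck_on_SucI[OF assms(1,2), of k] assms(3) unfolding smooth_on_def
    by (metis Ck_on_SucD)
qed

lemma smooth_on_bounded_linear:
  "bounded_linear L \<Longrightarrow> open U \<Longrightarrow> smooth_on U f \<Longrightarrow> smooth_on U (\<lambda>x. L (f x))"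
  unfolding smooth_on_def using Ck_on_bounded_linear by blast

lemma smooth_on_add: "open U \<Longrightarrow> smooth_on U f \<Longrightarrow> smooth_on U g \<Longrightarrow> smooth_on U (\<lambda>x. f x + g x)"
  unfolding smooth_on_def using Ck_on_add by blast

lemma smooth_on_bounded_bilinear:
  "bounded_bilinear B \<Longrightarrow> open U \<Longrightarrow> smooth_on U f \<Longrightarrow> smooth_on U g \<Longrightarrow> smooth_on U (\<lambda>x. B (f x) (g x))"
  unfolding smooth_on_def using Ck_on_bounded_bilinear by blast

lemmas smooth_on_scaleR = smooth_on_bounded_bilinear[OF bounded_bilinear_scaleR]
lemmas smooth_on_inner = smooth_on_bounded_bilinear[OF bounded_bilinear_inner]
lemmas smooth_on_mult = smooth_on_bounded_bilinear[OF bounded_bilinear_mult]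
lemmas smooth_on_minus = smooth_on_bounded_linear[OF bounded_linear_minus[OF bounded_linear_ident]]
lemmas smooth_on_nth = smooth_on_bounded_linear[OF bounded_linear_vec_nth]

lemma smooth_on_diff:
  "open U \<Longrightarrow> smooth_on U f \<Longrightarrow> smooth_on U g \<Longrightarrow> smooth_on U (\<lambda>x. f x - g x)"
  using smooth_on_add[of U f "\<lambda>x. - g x"] smooth_on_minus by auto

lemma smooth_on_compose_bounded_linear:
  "smooth_on V f \<Longrightarrow> bounded_linear T \<Longrightarrow> open U \<Longrightarrow> open V \<Longrightarrow> T ` U \<subseteq> V \<Longrightarrow> smooth_on U (\<lambda>x. f (T x))"
  unfolding smooth_on_def using Ck_on_compose_bounded_linear by blast

lemma smooth_on_linear: "bounded_linear T \<Longrightarrow> open U \<Longrightarrow> smooth_on U T"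
  by (rule smooth_on_SucI[where D="\<lambda>x v. T v"])
     (auto intro: bounded_linear_imp_has_derivative smooth_on_const)

lemma smooth_on_ident: "open U \<Longrightarrow> smooth_on U (\<lambda>x. x)"
  using smooth_on_linear bounded_linear_ident by blast

lemma smooth_on_sum:
  "open U \<Longrightarrow> (\<And>i. i \<in> I \<Longrightarrow> smooth_on U (f i)) \<Longrightarrow> smooth_on U (\<lambda>x. \<Sum>i\<in>I. f i x)"
  by (induction I rule: infinite_finite_induct) (auto intro: smooth_on_const smooth_on_add)

lemma smooth_on_prod:
  fixes f :: "'i \<Rightarrow> 'a::euclidean_space \<Rightarrow> real"
  shows "open U \<Longrightarrow> (\<And>i. i \<in> I \<Longrightarrow> smooth_on U (f i)) \<Longrightarrow> smooth_on U (\<lambda>x. \<Prod>i\<in>I. f i x)"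
  by (induction I rule: infinite_finite_induct) (auto intro: smooth_on_const smooth_on_mult)

text \<open>The derivative of 1/f contains 1/f again, so the proof climbs order by order: order
  \<open>k\<close> of the inverse gives order \<open>Suc k\<close>.\<close>

lemma smooth_on_inverse:
  fixes f :: "'a::euclidean_space \<Rightarrow> real"
  assumes "open U" "smooth_on U f" "\<And>x. x \<in> U \<Longrightarrow> f x \<noteq> 0"
  shows "smooth_on U (\<lambda>x. inverse (f x))"
proof -
  have "Ck_on k U (\<lambda>x. inverse (f x))" for k
  proof (induction k)
    case 0
    show ?case using smooth_on_continuous[OF assms(2)] assms(3) by (auto intro!: continuous_intros)
  next
    case (Suc k)
    show ?case
    proof (rule Ck_on_SucI[OF assms(1)])
      fix x assume x: "x \<in> U"
      show "((\<lambda>x. inverse (f x)) has_derivative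
          (\<lambda>v. - (inverse (f x) * frechet_derivative f (at x) v * inverse (f x)))) (at x)"
        using Deriv.has_derivative_inverse[OF assms(3)[OF x] smooth_on_has_derivative[OF assms(2) x]] by simp
    next
      fix v
      have "Ck_on k U (\<lambda>x. frechet_derivative f (at x) v)"
        using smooth_on_frechet[OF assms(2)] unfolding smooth_on_def by blast
      then show "Ck_on k U (\<lambda>x. - (inverse (f x) * frechet_derivative f (at x) v * inverse (f x)))"
        using Suc assms(1)
        by (intro Ck_on_bounded_linear[OF bounded_linear_minus[OF bounded_linear_ident]]
            Ck_on_bounded_bilinear[OF bounded_bilinear_mult])
    qed
  qed
  then show ?thesis unfolding smooth_on_def by blast
qed

text \<open>\<open>smooth_on_frechet\<close> covers fixed directions; expanding the variable
  direction in the standard basis reduces the general case to it.\<close>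

lemma smooth_on_frechet_along:
  assumes "open U" "smooth_on U f" "smooth_on U \<zeta>"
  shows "smooth_on U (\<lambda>x. frechet_derivative f (at x) (\<zeta> x))"
proof -
  have eq: "frechet_derivative f (at x) (\<zeta> x)
      = (\<Sum>b\<in>Basis. (\<zeta> x \<bullet> b) *\<^sub>R frechet_derivative f (at x) b)" if "x \<in> U" for x
  proof -
    interpret linear "frechet_derivative f (at x)"
      using linear_frechet_derivative smooth_on_differentiable assms(2) that by blast
    have "frechet_derivative f (at x) (\<zeta> x) = frechet_derivative f (at x) (\<Sum>b\<in>Basis. (\<zeta> x \<bullet> b) *\<^sub>R b)"
      by (simp add: euclidean_representation)
    also have "\<dots> = (\<Sum>b\<in>Basis. (\<zeta> x \<bullet> b) *\<^sub>R frechet_derivative f (at x) b)"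
      by (simp add: sum scale)
    finally show ?thesis .
  qed
  have smooth: "smooth_on U (\<lambda>x. \<Sum>b\<in>Basis. (\<zeta> x \<bullet> b) *\<^sub>R frechet_derivative f (at x) b)"
    using assms by (intro smooth_on_sum smooth_on_scaleR smooth_on_inner smooth_on_frechet smooth_on_const)
  show ?thesis by (rule smooth_on_eqI[OF smooth assms(1) eq])
qed

lemma smooth_on_vec_lambda:
  fixes f :: "'a::euclidean_space \<Rightarrow> 'i::finite \<Rightarrow> real"
  assumes "open U" "\<And>i. smooth_on U (\<lambda>x. f x i)"
  shows "smooth_on U (\<lambda>x. \<chi> i. f x i)"
proof -
  have "(\<chi> i. f x i) = (\<Sum>i\<in>UNIV. f x i *\<^sub>R axis i 1)" for x
    by (simp add: vec_eq_iff axis_def if_distrib sum.delta cong: if_cong)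
  then show ?thesis using assms by (auto intro!: smooth_on_sum smooth_on_scaleR smooth_on_const)
qed

lemma smooth_on_det:
  fixes M :: "'a::euclidean_space \<Rightarrow> real^'n^'n"
  assumes "open U" "\<And>i j. smooth_on U (\<lambda>x. M x $ i $ j)"
  shows "smooth_on U (\<lambda>x. det (M x))"
  unfolding det_def using assms
  by (intro smooth_on_sum smooth_on_mult smooth_on_const smooth_on_prod) auto

lemma matrix_inv_right_left:
  fixes A :: "real^'n^'n"
  assumes "invertible A"
  shows "A ** matrix_inv A = mat 1" "matrix_inv A ** A = mat 1"
  using assms unfolding invertible_def matrix_inv_def
  by (metis (mono_tags, lifting) someI_ex)+

text \<open>Cramer's rule makes each entry of the inverse a quotient of determinants, which are
  polynomials in the entries of \<open>M\<close>. The Christoffel symbols and all raised indices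
  depend on this.\<close>

lemma smooth_on_matrix_inv:
  fixes M :: "'a::euclidean_space \<Rightarrow> real^'n^'n"
  assumes "open U" "smooth_on U M" "\<And>x. x \<in> U \<Longrightarrow> invertible (M x)"
  shows "smooth_on U (\<lambda>x. matrix_inv (M x) $ i $ j)"
proof -
  let ?b = "axis j 1 :: real^'n"
  \<comment> \<open>\<open>?C x\<close> is \<open>M x\<close> with column \<open>i\<close> replaced
    by the basis vector \<open>?b\<close>.\<close>
  let ?C = "\<lambda>x. (\<chi> k l. if l = i then ?b $ k else M x $ k $ l) :: real^'n^'n"
  have eq: "matrix_inv (M x) $ i $ j = inverse (det (M x)) * det (?C x)" if "x \<in> U" for x
  proof -
    have inv: "invertible (M x)" and d: "det (M x) \<noteq> 0"
      using assms(3) that invertible_det_nz by auto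
    have "M x *v (matrix_inv (M x) *v ?b) = ?b"
      by (simp add: matrix_vector_mul_assoc matrix_inv_right_left[OF inv])
    then have e: "matrix_inv (M x) *v ?b =
        (\<chi> k. det (\<chi> i' l. if l = k then ?b $ i' else M x $ i' $ l) / det (M x))"
      using cramer[OF d] by blast
    have "matrix_inv (M x) $ i $ j = (matrix_inv (M x) *v ?b) $ i"
      by (simp add: matrix_vector_mult_basis column_def)
    then show ?thesis unfolding e by (simp add: field_simps)
  qed
  have smooth: "smooth_on U (\<lambda>x. inverse (det (M x)) * det (?C x))"
  proof (intro smooth_on_mult smooth_on_inverse smooth_on_det assms(1))
    show "smooth_on U (\<lambda>x. M x $ i $ j)" for i j by (intro smooth_on_nth assms)
    show "smooth_on U (\<lambda>x. ?C x $ a $ b)" for a b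
      using assms by (cases "b = i") (auto intro: smooth_on_nth smooth_on_const)
    show "det (M x) \<noteq> 0" if "x \<in> U" for x using assms(3) that invertible_det_nz by auto
  qed
  show ?thesis by (rule smooth_on_eqI[OF smooth assms(1) eq])
qed

section \<open>Second derivatives\<close>

text \<open>Two applications of the mean value theorem: in direction \<open>v\<close> to the
  difference of f on two parallel edges, then in direction \<open>w\<close> to the resulting
  difference of derivatives. The bound on \<open>h\<close> keeps the whole parallelogram in the
  ball.\<close>

lemma second_difference_mvt:
  fixes f :: "'a::euclidean_space \<Rightarrow> real"
  assumes f: "smooth_on W f" and W: "ball x d \<subseteq> W" and h: "h > 0" "h * (norm v + norm w) < d"
  shows "\<exists>s t. 0 < s \<and> s < 1 \<and> 0 < t \<and> t < 1 \<and>
    f (x + h *\<^sub>R v + h *\<^sub>R w) - f (x + h *\<^sub>R v) - f (x + h *\<^sub>R w) + f x =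
     h\<^sup>2 * frechet_derivative (\<lambda>y. frechet_derivative f (at y) v) (at (x + (h * s) *\<^sub>R v + (h * t) *\<^sub>R w)) w"
proof -
  have inW: "x + (h * s) *\<^sub>R v + (h * t) *\<^sub>R w \<in> W" if "0 \<le> s" "s \<le> 1" "0 \<le> t" "t \<le> 1" for s t
  proof -
    have "norm ((h * s) *\<^sub>R v + (h * t) *\<^sub>R w) \<le> h * s * norm v + h * t * norm w"
      using h that by (intro order_trans[OF norm_triangle_ineq]) (auto simp: abs_mult)
    also have "\<dots> \<le> h * 1 * norm v + h * 1 * norm w"
      using h that by (intro add_mono mult_right_mono mult_left_mono) auto
    also have "\<dots> < d" using h(2) by (simp add: algebra_simps)
    finally show ?thesis using W by (auto simp: subset_iff dist_norm norm_minus_commute add.assoc)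
  qed
  have line: "((\<lambda>s. F (z + (h * s) *\<^sub>R u)) has_real_derivative h * frechet_derivative F (at (z + (h * s) *\<^sub>R u)) u) (at s)"
    if F: "smooth_on W F" and z: "z + (h * s) *\<^sub>R u \<in> W" for F :: "'a \<Rightarrow> real" and z s u
  proof -
    have *: "(F has_derivative frechet_derivative F (at (z + (h * s) *\<^sub>R u))) (at (z + (h * s) *\<^sub>R u))"
      using smooth_on_has_derivative[OF F z] .
    have "((\<lambda>s. z + (h * s) *\<^sub>R u) has_derivative (\<lambda>r. (h * r) *\<^sub>R u)) (at s)"
      by (auto intro!: derivative_eq_intros)
    from has_derivative_compose[OF this *]
    have "((\<lambda>s. F (z + (h * s) *\<^sub>R u)) has_derivative
        (\<lambda>r. frechet_derivative F (at (z + (h * s) *\<^sub>R u)) ((h * r) *\<^sub>R u))) (at s)" .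
    moreover have "frechet_derivative F (at (z + (h * s) *\<^sub>R u)) ((h * r) *\<^sub>R u)
        = h * frechet_derivative F (at (z + (h * s) *\<^sub>R u)) u * r" for r
      using linear_frechet_derivative[OF smooth_on_differentiable[OF F z]] by (simp add: linear_scale)
    ultimately show ?thesis by (simp add: has_field_derivative_def)
  qed
  let ?g = "\<lambda>s. f (x + h *\<^sub>R w + (h * s) *\<^sub>R v) - f (x + (h * s) *\<^sub>R v)"
  let ?g' = "\<lambda>s. h * frechet_derivative f (at (x + h *\<^sub>R w + (h * s) *\<^sub>R v)) v - h * frechet_derivative f (at (x + (h * s) *\<^sub>R v)) v"
  have "DERIV ?g s :> ?g' s" if "0 \<le> s" "s \<le> 1" for s
    using inW[OF that, of 1] inW[OF that, of 0] by (intro DERIV_diff line f) (auto simp: algebra_simps)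
  from MVT2[of 0 1 ?g ?g', OF _ this] obtain s where s: "0 < s" "s < 1" "?g 1 - ?g 0 = ?g' s" by auto
  let ?F = "\<lambda>y. frechet_derivative f (at y) v"
  let ?k = "\<lambda>t. ?F ((x + (h * s) *\<^sub>R v) + (h * t) *\<^sub>R w)"
  have "DERIV ?k t :> h * frechet_derivative ?F (at ((x + (h * s) *\<^sub>R v) + (h * t) *\<^sub>R w)) w" if "0 \<le> t" "t \<le> 1" for t
    using inW[of s t] s that by (intro line smooth_on_frechet f) auto
  from MVT2[of 0 1 ?k, OF _ this] obtain t where t: "0 < t" "t < 1"
    "?k 1 - ?k 0 = h * frechet_derivative ?F (at ((x + (h * s) *\<^sub>R v) + (h * t) *\<^sub>R w)) w" by auto
  have "?g' s = h * (?k 1 - ?k 0)" by (simp add: algebra_simps)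
  then have "?g 1 - ?g 0 = h\<^sup>2 * frechet_derivative ?F (at (x + (h * s) *\<^sub>R v + (h * t) *\<^sub>R w)) w"
    using s(3) t(3) by (simp add: power2_eq_square)
  moreover have "?g 1 - ?g 0 = f (x + h *\<^sub>R v + h *\<^sub>R w) - f (x + h *\<^sub>R v) - f (x + h *\<^sub>R w) + f x"
    by (simp add: algebra_simps)
  ultimately show ?thesis using s t by metis
qed

text \<open>The intermediate point of the mean value theorem tends to \<open>x\<close> with
  \<open>h\<close>, and the iterated derivative is continuous there.\<close>

lemma second_difference_tendsto:
  fixes f :: "'a::euclidean_space \<Rightarrow> real"
  assumes "open W" "x \<in> W" "smooth_on W f"
  shows "((\<lambda>h. (f (x + h *\<^sub>R v + h *\<^sub>R w) - f (x + h *\<^sub>R v) - f (x + h *\<^sub>R w) + f x) / h\<^sup>2) \<longlongrightarrow>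
     frechet_derivative (\<lambda>y. frechet_derivative f (at y) v) (at x) w) (at_right 0)"
proof (rule tendstoI)
  let ?F = "\<lambda>y. frechet_derivative (\<lambda>y. frechet_derivative f (at y) v) (at y) w"
  fix e :: real assume e: "e > 0"
  obtain d1 where d1: "d1 > 0" "ball x d1 \<subseteq> W" using assms by (meson openE)
  have "continuous_on W ?F" using assms smooth_on_frechet smooth_on_continuous by blast
  then have "isCont ?F x" using assms continuous_on_eq_continuous_at by blast
  then obtain d2 where d2: "d2 > 0" "\<And>y. dist y x < d2 \<Longrightarrow> dist (?F y) (?F x) < e"
    using e unfolding continuous_at_eps_delta by (auto simp: dist_commute)
  define d where "d = min d1 d2"
  have d: "d > 0" "ball x d \<subseteq> W" using d1 d2 by (auto simp: d_def subset_iff)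
  \<comment> \<open>The added 1 keeps the denominator positive when \<open>v\<close> and
    \<open>w\<close> both vanish.\<close>
  let ?r = "d / (norm v + norm w + 1)"
  have N: "norm v + norm w + 1 > 0" by (smt (verit) norm_ge_zero)
  then have r: "?r > 0" using d by simp
  show "\<forall>\<^sub>F h in at_right 0. dist ((f (x + h *\<^sub>R v + h *\<^sub>R w) - f (x + h *\<^sub>R v) - f (x + h *\<^sub>R w) + f x) / h\<^sup>2) (?F x) < e"
    unfolding eventually_at_right_field
  proof (intro exI conjI allI impI)
    show "0 < ?r" by (rule r)
    fix h :: real assume h: "0 < h" "h < ?r"
    have "h * (norm v + norm w + 1) < d" using h N by (simp add: pos_less_divide_eq)
    then have hd: "h * (norm v + norm w) < d" using h by (simp add: algebra_simps)
    obtain s t where st: "0 < s" "s < 1" "0 < t" "t < 1"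
      "f (x + h *\<^sub>R v + h *\<^sub>R w) - f (x + h *\<^sub>R v) - f (x + h *\<^sub>R w) + f x = h\<^sup>2 * ?F (x + (h * s) *\<^sub>R v + (h * t) *\<^sub>R w)"
      using second_difference_mvt[OF assms(3) d(2) h(1) hd] by blast
    have "norm ((h * s) *\<^sub>R v + (h * t) *\<^sub>R w) \<le> h * s * norm v + h * t * norm w"
      using h st by (intro order_trans[OF norm_triangle_ineq]) (auto simp: abs_mult)
    also have "\<dots> \<le> h * 1 * norm v + h * 1 * norm w"
      using h st by (intro add_mono mult_right_mono mult_left_mono) auto
    also have "\<dots> < d2" using hd by (simp add: algebra_simps d_def)
    finally have "dist (x + (h * s) *\<^sub>R v + (h * t) *\<^sub>R w) x < d2" by (simp add: dist_norm add.assoc)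
    from d2(2)[OF this] show "dist ((f (x + h *\<^sub>R v + h *\<^sub>R w) - f (x + h *\<^sub>R v) - f (x + h *\<^sub>R w) + f x) / h\<^sup>2) (?F x) < e"
      unfolding st(5) using h by simp
  qed
qed

text \<open>The second difference is symmetric in \<open>v\<close> and \<open>w\<close>, and limits
  are unique.\<close>

lemma frechet_derivative_commute:
  fixes f :: "'a::euclidean_space \<Rightarrow> real"
  assumes "open W" "x \<in> W" "smooth_on W f"
  shows "frechet_derivative (\<lambda>y. frechet_derivative f (at y) v) (at x) w
       = frechet_derivative (\<lambda>y. frechet_derivative f (at y) w) (at x) v"
proof (rule tendsto_unique[OF _ second_difference_tendsto[OF assms]])
  have "f (x + h *\<^sub>R v + h *\<^sub>R w) - f (x + h *\<^sub>R v) - f (x + h *\<^sub>R w) + f x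
      = f (x + h *\<^sub>R w + h *\<^sub>R v) - f (x + h *\<^sub>R w) - f (x + h *\<^sub>R v) + f x" for h
    by (simp add: algebra_simps)
  then show "((\<lambda>h. (f (x + h *\<^sub>R v + h *\<^sub>R w) - f (x + h *\<^sub>R v) - f (x + h *\<^sub>R w) + f x) / h\<^sup>2) \<longlongrightarrow>
     frechet_derivative (\<lambda>y. frechet_derivative f (at y) w) (at x) v) (at_right 0)"
    using second_difference_tendsto[OF assms, of w v] by (simp only:)
qed simp

lemma frechet_derivative_sum:
  assumes "\<And>i. i \<in> I \<Longrightarrow> f i differentiable (at x)"
  shows "frechet_derivative (\<lambda>x. \<Sum>i\<in>I. f i x) (at x) v = (\<Sum>i\<in>I. frechet_derivative (f i) (at x) v)"
proof -
  have "((\<lambda>x. \<Sum>i\<in>I. f i x) has_derivative (\<lambda>v. \<Sum>i\<in>I. frechet_derivative (f i) (at x) v)) (at x)"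
    using assms by (intro has_derivative_sum) (auto simp: frechet_derivative_works[symmetric])
  from frechet_derivative_at[OF this] show ?thesis by metis
qed

lemma frechet_derivative_cmult:
  fixes f :: "'a::real_normed_vector \<Rightarrow> real"
  assumes "f differentiable (at x)"
  shows "frechet_derivative (\<lambda>x. c * f x) (at x) v = c * frechet_derivative f (at x) v"
proof -
  have "((\<lambda>x. c * f x) has_derivative (\<lambda>v. c * frechet_derivative f (at x) v)) (at x)"
    using assms by (intro has_derivative_mult_right) (auto simp: frechet_derivative_works[symmetric])
  from frechet_derivative_at[OF this] show ?thesis by metis
qed

section \<open>The exterior derivative squares to zero\<close>

abbreviation drop_nth :: "nat \<Rightarrow> 'a list \<Rightarrow> 'a list" where
  "drop_nth i vs \<equiv> take i vs @ drop (Suc i) vs"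

text \<open>The simplicial identity for omitting two entries: once entry \<open>j\<close> is gone,
  the former entry \<open>Suc i\<close> sits at position \<open>i\<close>.\<close>

lemma drop_nth_drop_nth:
  assumes "j \<le> i" "Suc i < length vs"
  shows "drop_nth i (drop_nth j vs) = drop_nth j (drop_nth (Suc i) vs)"
  using assms by (intro nth_equalityI) (auto simp: nth_append min_def)

lemma nth_drop_nth:
  "i < length vs - 1 \<Longrightarrow> drop_nth j vs ! i = (if i < j then vs ! i else vs ! Suc i)" if "j < length vs"
  using that by (auto simp: nth_append min_def)

text \<open>The double sum runs over ordered pairs of omitted entries. Each unordered pair occurs
  twice, with equal second derivatives and opposite signs.\<close>

lemma ext_deriv_ext_deriv:
  fixes \<omega> :: "real^'n \<Rightarrow> 'n::finite form"
  assumes W: "open W" "y \<in> W" and \<omega>: "\<And>ws. smooth_on W (\<lambda>x. \<omega> x ws)"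
  shows "ext_deriv (ext_deriv \<omega>) y vs = 0"
proof (cases "length vs")
  case 0
  then show ?thesis by (simp add: ext_deriv_def)
next
  case (Suc m)
  define D where "D i j ws = frechet_derivative (\<lambda>x. frechet_derivative (\<lambda>x. \<omega> x ws) (at x) (vs ! j)) (at y) (vs ! i)" for i j ws
  have D_sym: "D i j ws = D j i ws" for i j ws
    unfolding D_def using frechet_derivative_commute[OF W \<omega>] .
  \<comment> \<open>Position \<open>j\<close> of the list without entry \<open>i\<close> is position
    \<open>j\<close> or \<open>Suc j\<close> of \<open>vs\<close>; the conditional records this
    shift.\<close>
  define T where "T = (\<lambda>(i, j). (-1) ^ (i + j) *
     D i (if j < i then j else Suc j) (drop_nth j (drop_nth i vs)))"
  have diff: "(\<lambda>x. frechet_derivative (\<lambda>x. \<omega> x ws) (at x) v) differentiable (at y)" for ws v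
    using smooth_on_differentiable[OF smooth_on_frechet[OF \<omega>] W(2)] .
  have "ext_deriv (ext_deriv \<omega>) y vs = (\<Sum>i<Suc m. \<Sum>j<m. T (i, j))"
  proof -
    have "frechet_derivative (\<lambda>x. ext_deriv \<omega> x (drop_nth i vs)) (at y) (vs ! i)
        = (\<Sum>j<m. (-1) ^ j * D i (if j < i then j else Suc j) (drop_nth j (drop_nth i vs)))" if "i < Suc m" for i
    proof -
      have len: "length (drop_nth i vs) = m" using that Suc by simp
      have "frechet_derivative (\<lambda>x. ext_deriv \<omega> x (drop_nth i vs)) (at y) (vs ! i)
        = (\<Sum>j<m. frechet_derivative (\<lambda>x. (-1) ^ j * frechet_derivative (\<lambda>x. \<omega> x (drop_nth j (drop_nth i vs))) (at x)
             (drop_nth i vs ! j)) (at y) (vs ! i))"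
        unfolding ext_deriv_def len
        by (rule frechet_derivative_sum) (intro differentiable_mult differentiable_const diff)
      also have "\<dots> = (\<Sum>j<m. (-1) ^ j * D i (if j < i then j else Suc j) (drop_nth j (drop_nth i vs)))"
      proof (intro sum.cong refl)
        fix j assume "j \<in> {..<m}"
        then have n: "drop_nth i vs ! j = vs ! (if j < i then j else Suc j)"
          using nth_drop_nth[of i vs j] that Suc by auto
        show "frechet_derivative (\<lambda>x. (-1) ^ j * frechet_derivative (\<lambda>x. \<omega> x (drop_nth j (drop_nth i vs))) (at x)
             (drop_nth i vs ! j)) (at y) (vs ! i) = (-1) ^ j * D i (if j < i then j else Suc j) (drop_nth j (drop_nth i vs))"
          unfolding n D_def by (rule frechet_derivative_cmult[OF diff])
      qed
      finally show ?thesis .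
    qed
    then show ?thesis
      unfolding ext_deriv_def[of "ext_deriv \<omega>"] Suc T_def
      by (auto intro!: sum.cong simp: sum_distrib_left power_add mult.assoc)
  qed
  also have "\<dots> = sum T ({..<Suc m} \<times> {..<m})" by (simp add: sum.cartesian_product)
  also have "{..<Suc m} \<times> {..<m} = {(i, j). j < i \<and> i < Suc m} \<union> {(i, j). i \<le> j \<and> j < m}" by auto
  also have "sum T \<dots> = sum T {(i, j). j < i \<and> i < Suc m} + sum T {(i, j). i \<le> j \<and> j < m}"
  proof (intro sum.union_disjoint)
    show "finite {(i, j). j < i \<and> i < Suc m}" by (rule finite_subset[of _ "{..<Suc m} \<times> {..<Suc m}"]) auto
    show "finite {(i, j). i \<le> j \<and> j < m}" by (rule finite_subset[of _ "{..<Suc m} \<times> {..<Suc m}"]) auto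
  qed auto
  also have "sum T {(i, j). j < i \<and> i < Suc m} = (\<Sum>q\<in>{(i, j). i \<le> j \<and> j < m}. - T q)"
  \<comment> \<open>For j <= i the pair \<open>(Suc i, j)\<close> omits the same two entries as
    \<open>(j, i)\<close>, in the other order, and the exponent of the sign differs by one.\<close>
  proof (rule sum.reindex_bij_witness[of _ "\<lambda>(i, j). (Suc j, i)" "\<lambda>(i, j). (j, i - 1)"])
    fix q assume "q \<in> {(i, j). j < i \<and> i < Suc m}"
    then obtain i j where q: "q = (Suc i, j)" "j \<le> i" "i < m" by (cases q; cases "fst q") auto
    have "T (Suc i, j) = (-1) ^ (Suc i + j) * D (Suc i) j (drop_nth j (drop_nth (Suc i) vs))"
      using q by (simp add: T_def)
    also have "\<dots> = - ((-1) ^ (j + i) * D j (Suc i) (drop_nth i (drop_nth j vs)))"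
      using drop_nth_drop_nth[of j i vs] q Suc by (simp add: D_sym add.commute)
    also have "\<dots> = - T (j, i)" using q by (simp add: T_def)
    finally show "- T ((\<lambda>(i, j). (j, i - 1)) q) = T q" using q by simp
  qed auto
  finally show ?thesis by (simp add: sum_negf)
qed

section \<open>Functions on jet space\<close>

lemma Ck_on_sum:
  "open U \<Longrightarrow> (\<And>i. i \<in> I \<Longrightarrow> Ck_on k U (f i)) \<Longrightarrow> Ck_on k U (\<lambda>x. \<Sum>i\<in>I. f i x)"
  by (induction I rule: infinite_finite_induct) (auto intro: Ck_on_const Ck_on_add)

text \<open>A neighbourhood in the product topology contains a product of open sets, and finitely
  many of its factors contain intervals of a common radius; the coordinates outside \<open>J\<close>
  do not move.\<close>

lemma open_fun_finite_box:
  fixes U :: "('i \<Rightarrow> real) set"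
  assumes "open U" "z0 \<in> U" "finite J"
  obtains \<delta> where "\<delta> > 0"
    "\<And>z. (\<And>a. a \<in> J \<Longrightarrow> \<bar>z a - z0 a\<bar> < \<delta>) \<Longrightarrow> (\<And>a. a \<notin> J \<Longrightarrow> z a = z0 a) \<Longrightarrow> z \<in> U"
proof -
  have "openin (product_topology (\<lambda>i. euclidean) UNIV) U" using assms(1) open_fun_def by blast
  from product_topology_open_contains_basis[OF this assms(2)] obtain X :: "'i \<Rightarrow> real set"
    where X: "z0 \<in> (\<Pi>\<^sub>E i\<in>UNIV. X i)" "\<And>i. open (X i)" "(\<Pi>\<^sub>E i\<in>UNIV. X i) \<subseteq> U" by auto
  have z0: "z0 i \<in> X i" for i using X(1) by auto
  have "\<exists>d>0. ball (z0 i) d \<subseteq> X i" for i using X(2) z0 by (meson openE)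
  then obtain d where d: "\<And>i. d i > 0" "\<And>i. ball (z0 i) (d i) \<subseteq> X i" by metis
  define \<delta> where "\<delta> = Min (insert 1 (d ` J))"
  show ?thesis
  proof
    show "\<delta> > 0" using d(1) assms(3) by (auto simp: \<delta>_def)
    fix z assume z: "\<And>a. a \<in> J \<Longrightarrow> \<bar>z a - z0 a\<bar> < \<delta>" "\<And>a. a \<notin> J \<Longrightarrow> z a = z0 a"
    have "z i \<in> X i" for i
    proof (cases "i \<in> J")
      case True
      have "\<delta> \<le> d i" using True assms(3) by (auto simp: \<delta>_def)
      then have "z i \<in> ball (z0 i) (d i)" using z(1)[OF True] by (auto simp: dist_real_def)
      then show ?thesis using d(2) by blast
    qed (use z z0 in auto)
    then show "z \<in> U" using X(3) by auto
  qed
qed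

text \<open>A product rule in which the factor \<open>m\<close> only has a limit at the point,
  because \<open>g\<close> vanishes there. It is applied with \<open>m\<close> a difference
  quotient, about whose differentiability nothing is known.\<close>

lemma has_derivative_mult_tendsto:
  fixes g m :: "'a::real_normed_vector \<Rightarrow> real"
  assumes g: "(g has_derivative g') (at x0)" "g x0 = 0" and m: "(m \<longlongrightarrow> m0) (at x0)"
  shows "((\<lambda>x. m x * g x) has_derivative (\<lambda>v. m0 * g' v)) (at x0)"
proof -
  interpret bounded_linear g' using g has_derivative_bounded_linear by blast
  obtain K where K: "\<And>v. norm (g' v) \<le> norm v * K" "K > 0" using pos_bounded by blast
  let ?r = "\<lambda>x. norm (g x - g' (x - x0)) / norm (x - x0)"
  have r: "(?r \<longlongrightarrow> 0) (at x0)"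
    using g by (simp add: has_derivative_iff_norm)
  have lim: "((\<lambda>x. \<bar>m x\<bar> * ?r x + \<bar>m x - m0\<bar> * K) \<longlongrightarrow> \<bar>m0\<bar> * 0 + \<bar>m0 - m0\<bar> * K) (at x0)"
    by (intro tendsto_intros r m)
  then have lim: "((\<lambda>x. \<bar>m x\<bar> * ?r x + \<bar>m x - m0\<bar> * K) \<longlongrightarrow> 0) (at x0)" by (simp only: mult_zero_right diff_self abs_zero mult_zero_left add_0)
  have "((\<lambda>x. norm (m x * g x - m0 * g' (x - x0)) / norm (x - x0)) \<longlongrightarrow> 0) (at x0)"
  proof (rule Lim_null_comparison[OF _ lim], intro always_eventually allI)
    fix x
    have "\<bar>m x * g x - m0 * g' (x - x0)\<bar> = \<bar>m x * (g x - g' (x - x0)) + (m x - m0) * g' (x - x0)\<bar>"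
      by (simp add: algebra_simps)
    also have "\<dots> \<le> \<bar>m x\<bar> * \<bar>g x - g' (x - x0)\<bar> + \<bar>m x - m0\<bar> * (norm (x - x0) * K)"
      by (rule order_trans[OF abs_triangle_ineq]) (use K(1)[of "x - x0"] in \<open>auto simp: abs_mult intro!: add_mono mult_left_mono\<close>)
    finally show "norm (norm (m x * g x - m0 * g' (x - x0)) / norm (x - x0)) \<le> \<bar>m x\<bar> * ?r x + \<bar>m x - m0\<bar> * K"
      by (cases "x = x0") (auto simp: divide_simps K(2) less_imp_le algebra_simps)
  qed
  then show ?thesis unfolding has_derivative_iff_norm using g(2)
    by (auto simp: bounded_linear_axioms intro!: bounded_linear_const_mult)
qed

text \<open>The coordinates in \<open>J\<close> are released one at a time, each by the mean value theorem, so that only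
  continuity of the partial derivatives is used.\<close>

lemma jet_chain_partial:
  fixes f :: "'n::finite jet \<Rightarrow> real" and Z :: "'a::real_normed_vector \<Rightarrow> 'n jet"
  assumes U: "open U" "Z x0 \<in> U"
    and f: "\<And>a z. z \<in> U \<Longrightarrow> (\<lambda>s. f (z(a := s))) differentiable (at (z a))"
      "\<And>a. continuous_on U (jet_pd a f)"
    and "finite J" "\<And>a. a \<in> J \<Longrightarrow> ((\<lambda>x. Z x a) has_derivative Z' a) (at x0)"
  shows "((\<lambda>x. f (\<lambda>a. if a \<in> J then Z x a else Z x0 a)) has_derivative
     (\<lambda>v. \<Sum>a\<in>J. jet_pd a f (Z x0) * Z' a v)) (at x0)"
  using assms(5,6)
proof (induction J)
  case empty
  then show ?case by simp
next
  case (insert b J)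
  let ?\<zeta> = "\<lambda>J x a. if a \<in> J then Z x a else Z x0 a"
  let ?R = "\<lambda>x. f (?\<zeta> (insert b J) x) - f (?\<zeta> J x)"
  let ?g = "\<lambda>x. Z x b - Z x0 b"
  let ?m0 = "jet_pd b f (Z x0)"
  \<comment> \<open>\<open>m\<close> is the difference quotient in coordinate \<open>b\<close>,
    completed by the partial derivative where the increment vanishes, so that
    \<open>?R x = m x * ?g x\<close> holds everywhere.\<close>
  define m where "m x = (if ?g x = 0 then ?m0 else ?R x / ?g x)" for x
  have g: "(?g has_derivative Z' b) (at x0)"
    using has_derivative_diff[OF insert.prems[of b] has_derivative_const[of "Z x0 b"]] by simp
  have same: "?\<zeta> (insert b J) x = (?\<zeta> J x)(b := Z x b)" "?\<zeta> J x = (?\<zeta> J x)(b := Z x0 b)" for x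
    using insert.hyps by auto
  have m: "(m \<longlongrightarrow> ?m0) (at x0)"
  proof (rule tendstoI)
    fix e :: real assume e: "e > 0"
    \<comment> \<open>On \<open>?V\<close> the partial derivative is close to \<open>?m0\<close>,
      and a box around \<open>Z x0\<close> inside \<open>?V\<close> contains all intermediate points
      of the mean value theorem.\<close>
    let ?V = "U \<inter> jet_pd b f -` ball ?m0 e"
    have V: "open ?V" using f(2) U(1) by (metis continuous_on_open_vimage open_ball inf_commute)
    have "Z x0 \<in> ?V" using U e by simp
    from open_fun_finite_box[OF V this, of "insert b J"] insert.hyps(1) obtain \<delta> where \<delta>: "\<delta> > 0"
      "\<And>z. (\<And>a. a \<in> insert b J \<Longrightarrow> \<bar>z a - Z x0 a\<bar> < \<delta>) \<Longrightarrow> (\<And>a. a \<notin> insert b J \<Longrightarrow> z a = Z x0 a) \<Longrightarrow> z \<in> ?V"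
      by (metis finite_insert)
    have "\<forall>\<^sub>F x in at x0. \<forall>a\<in>insert b J. dist (Z x a) (Z x0 a) < \<delta>"
    proof (intro eventually_ball_finite ballI)
      fix a assume "a \<in> insert b J"
      then have "((\<lambda>x. Z x a) \<longlongrightarrow> Z x0 a) (at x0)"
        using insert.prems has_derivative_continuous continuous_within by blast
      then show "\<forall>\<^sub>F x in at x0. dist (Z x a) (Z x0 a) < \<delta>" using \<delta>(1) tendstoD by blast
    qed (use insert.hyps in auto)
    then show "\<forall>\<^sub>F x in at x0. dist (m x) ?m0 < e"
    proof (rule eventually_mono)
      fix x assume x: "\<forall>a\<in>insert b J. dist (Z x a) (Z x0 a) < \<delta>"
      define q where "q s = (?\<zeta> J x)(b := s)" for s
      have qV: "q s \<in> ?V" if "\<bar>s - Z x0 b\<bar> \<le> \<bar>Z x b - Z x0 b\<bar>" for s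
        using x that insert.hyps by (intro \<delta>(2)) (auto simp: q_def dist_real_def)
      have D: "((\<lambda>s. f (q s)) has_real_derivative jet_pd b f (q s)) (at s)"
        if "\<bar>s - Z x0 b\<bar> \<le> \<bar>Z x b - Z x0 b\<bar>" for s
      proof -
        have "(\<lambda>r. f ((q s)(b := r))) differentiable (at (q s b))" using f(1) qV[OF that] by blast
        then show ?thesis
          unfolding jet_pd_def by (auto simp: q_def DERIV_deriv_iff_real_differentiable)
      qed
      have R: "?R x = f (q (Z x b)) - f (q (Z x0 b))" using same[of x] by (simp add: q_def)
      consider "Z x b = Z x0 b" | "Z x b > Z x0 b" | "Z x b < Z x0 b" by linarith
      then have "\<exists>s. \<bar>s - Z x0 b\<bar> \<le> \<bar>Z x b - Z x0 b\<bar> \<and> ?R x = ?g x * jet_pd b f (q s)"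
      proof cases
        case 1
        then show ?thesis unfolding R by auto
      next
        case 2
        from MVT2[OF this D] obtain s where "Z x0 b < s" "s < Z x b"
          "f (q (Z x b)) - f (q (Z x0 b)) = (Z x b - Z x0 b) * jet_pd b f (q s)" by auto
        then show ?thesis unfolding R by (intro exI[of _ s]) auto
      next
        case 3
        from MVT2[OF this D] obtain s where "Z x b < s" "s < Z x0 b"
          "f (q (Z x0 b)) - f (q (Z x b)) = (Z x0 b - Z x b) * jet_pd b f (q s)" by auto
        then show ?thesis unfolding R by (intro exI[of _ s]) (auto simp: algebra_simps)
      qed
      then obtain s where s: "\<bar>s - Z x0 b\<bar> \<le> \<bar>Z x b - Z x0 b\<bar>" "?R x = ?g x * jet_pd b f (q s)" by blast
      have "dist (jet_pd b f (q s)) ?m0 < e" using qV[OF s(1)] by (auto simp: dist_commute)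
      then show "dist (m x) ?m0 < e" unfolding m_def s(2) using e by auto
    qed
  qed
  have R: "?R x = m x * ?g x" for x
  proof (cases "?g x = 0")
    case True
    then have "?\<zeta> (insert b J) x = ?\<zeta> J x" using insert.hyps by auto
    then have "f (?\<zeta> (insert b J) x) = f (?\<zeta> J x)" by (rule arg_cong)
    then show ?thesis using True by (simp only: diff_self mult_zero_right)
  qed (simp add: m_def)
  have "(?R has_derivative (\<lambda>v. ?m0 * Z' b v)) (at x0)"
    unfolding R by (rule has_derivative_mult_tendsto[OF g _ m]) simp
  from has_derivative_add[OF this insert.IH[OF insert.prems]] show ?case
    using insert.hyps by simp
qed

lemma jet_chain:
  fixes f :: "'n::finite jet \<Rightarrow> real" and Z :: "'a::real_normed_vector \<Rightarrow> 'n jet"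
  assumes U: "open U" and W: "open W" "x0 \<in> W" and Z: "\<And>x. x \<in> W \<Longrightarrow> Z x \<in> U"
    and f: "\<And>a z. z \<in> U \<Longrightarrow> (\<lambda>s. f (z(a := s))) differentiable (at (z a))"
      "\<And>a. continuous_on U (jet_pd a f)"
    and J: "finite J" "\<And>a. a \<in> J \<Longrightarrow> ((\<lambda>x. Z x a) has_derivative Z' a) (at x0)"
    and dep: "\<And>z z'. z \<in> U \<Longrightarrow> z' \<in> U \<Longrightarrow> (\<And>a. a \<in> J \<Longrightarrow> z a = z' a) \<Longrightarrow> f z = f z'"
  shows "((\<lambda>x. f (Z x)) has_derivative (\<lambda>v. \<Sum>a\<in>J. jet_pd a f (Z x0) * Z' a v)) (at x0)"
proof -
  let ?\<zeta> = "\<lambda>x a. if a \<in> J then Z x a else Z x0 a"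
  obtain \<delta> where \<delta>: "\<delta> > 0"
    "\<And>z. (\<And>a. a \<in> J \<Longrightarrow> \<bar>z a - Z x0 a\<bar> < \<delta>) \<Longrightarrow> (\<And>a. a \<notin> J \<Longrightarrow> z a = Z x0 a) \<Longrightarrow> z \<in> U"
    using open_fun_finite_box[OF U Z[OF W(2)] J(1)] by metis
  have "\<forall>\<^sub>F x in nhds x0. \<forall>a\<in>J. dist (Z x a) (Z x0 a) < \<delta>"
  proof (intro eventually_ball_finite ballI J(1))
    fix a assume "a \<in> J"
    then have "isCont (\<lambda>x. Z x a) x0"
      using J(2) has_derivative_continuous by blast
    then show "\<forall>\<^sub>F x in nhds x0. dist (Z x a) (Z x0 a) < \<delta>"
      using \<delta>(1) tendsto_at_iff_tendsto_nhds[of "\<lambda>x. Z x a" x0] tendstoD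
      unfolding isCont_def by blast
  qed
  moreover have "\<forall>\<^sub>F x in nhds x0. x \<in> W" using W eventually_nhds_in_open by blast
  ultimately have ev: "\<forall>\<^sub>F x in nhds x0. f (?\<zeta> x) = f (Z x)"
  proof eventually_elim
    case (elim x)
    have "?\<zeta> x \<in> U" by (rule \<delta>(2)) (use elim in \<open>auto simp: dist_real_def\<close>)
    then show ?case using elim Z by (intro dep) auto
  qed
  have "((\<lambda>x. f (?\<zeta> x)) has_derivative (\<lambda>v. \<Sum>a\<in>J. jet_pd a f (Z x0) * Z' a v)) (at x0)"
    using jet_chain_partial[OF U Z[OF W(2)] f J] .
  then show ?thesis
    using has_derivative_transform_eventually[of _ _ x0 UNIV "\<lambda>x. f (Z x)"] ev
    by (simp add: eventually_nhds_conv_at)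
qed

text \<open>The chain rule expresses the derivative through the functions \<open>jet_pd a f\<close>
  along \<open>Z\<close>. These fall under the induction hypothesis, since a partial derivative of f
  depends on the same finite set \<open>J\<close>.\<close>

lemma Ck_on_jet_compose:
  fixes f :: "'n::finite jet \<Rightarrow> real" and Z :: "'a::euclidean_space \<Rightarrow> 'n jet"
  assumes U: "open U" and W: "open W" and Z: "\<And>x. x \<in> W \<Longrightarrow> Z x \<in> U"
    and J: "finite J" "\<And>a. a \<in> J \<Longrightarrow> smooth_on W (\<lambda>x. Z x a)"
  shows "(\<And>k. jet_Ck k U f) \<Longrightarrow>
    (\<And>z z'. z \<in> U \<Longrightarrow> z' \<in> U \<Longrightarrow> (\<And>a. a \<in> J \<Longrightarrow> z a = z' a) \<Longrightarrow> f z = f z') \<Longrightarrow>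
    Ck_on k W (\<lambda>x. f (Z x))"
proof (induction k arbitrary: f)
  have der: "((\<lambda>x. f (Z x)) has_derivative
      (\<lambda>v. \<Sum>a\<in>J. jet_pd a f (Z x) * frechet_derivative (\<lambda>x. Z x a) (at x) v)) (at x)"
    if "x \<in> W" "\<And>k. jet_Ck k U f"
      "\<And>z z'. z \<in> U \<Longrightarrow> z' \<in> U \<Longrightarrow> (\<And>a. a \<in> J \<Longrightarrow> z a = z' a) \<Longrightarrow> f z = f z'" for x f
  proof (rule jet_chain[OF U W that(1) Z _ _ J(1)])
    have Ck: "jet_Ck k U f" for k using that(2) .
    show "(\<lambda>s. f (z(a := s))) differentiable (at (z a))" if "z \<in> U" for a z
      using Ck[of "Suc 0"] that by simp
    show "continuous_on U (jet_pd a f)" for a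
      using that(2)[of "Suc 0"] by simp
    show "((\<lambda>x. Z x a) has_derivative frechet_derivative (\<lambda>x. Z x a) (at x)) (at x)" if "a \<in> J" for a
      using smooth_on_has_derivative[OF J(2)[OF that] \<open>x \<in> W\<close>] .
    show "f z = f z'" if "z \<in> U" "z' \<in> U" "\<And>a. a \<in> J \<Longrightarrow> z a = z' a" for z z'
      using \<open>\<And>z z'. z \<in> U \<Longrightarrow> z' \<in> U \<Longrightarrow> (\<And>a. a \<in> J \<Longrightarrow> z a = z' a) \<Longrightarrow> f z = f z'\<close> that by blast
  qed
  {
    case 0
    have "isCont (\<lambda>x. f (Z x)) x" if "x \<in> W" for x
      by (rule has_derivative_continuous[OF der[OF that]]) (fact 0)+
    then show ?case by (simp add: continuous_at_imp_continuous_on)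
  next
    case (Suc k)
    show ?case
    proof (rule Ck_on_SucI[OF W])
      show "((\<lambda>x. f (Z x)) has_derivative
          (\<lambda>v. \<Sum>a\<in>J. jet_pd a f (Z x) * frechet_derivative (\<lambda>x. Z x a) (at x) v)) (at x)"
        if "x \<in> W" for x
        by (rule der[OF that]) (fact Suc.prems)+
      fix v
      have "smooth_on W (\<lambda>x. frechet_derivative (\<lambda>x. Z x a) (at x) v)" if "a \<in> J" for a
        using smooth_on_frechet J(2) that by blast
      moreover have "Ck_on k W (\<lambda>x. jet_pd a f (Z x))" if a: "a \<in> J" for a
      proof (rule Suc.IH)
        show "jet_Ck k U (jet_pd a f)" for k using Suc.prems(1)[of "Suc k"] by simp
        \<comment> \<open>Small changes of coordinate \<open>a\<close> at \<open>z\<close> and at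
          \<open>z'\<close> stay inside \<open>U\<close>, where f cannot distinguish the two jets;
          so the partial derivatives agree.\<close>
        fix z z' assume z: "z \<in> U" "z' \<in> U" "\<And>a. a \<in> J \<Longrightarrow> z a = z' a"
        obtain d where d: "d > 0" "\<And>y. (\<And>b. b \<in> {a} \<Longrightarrow> \<bar>y b - z b\<bar> < d) \<Longrightarrow> (\<And>b. b \<notin> {a} \<Longrightarrow> y b = z b) \<Longrightarrow> y \<in> U"
          using open_fun_finite_box[OF U z(1), of "{a}"] by (metis finite.emptyI finite.insertI)
        obtain d' where d': "d' > 0" "\<And>y. (\<And>b. b \<in> {a} \<Longrightarrow> \<bar>y b - z' b\<bar> < d') \<Longrightarrow> (\<And>b. b \<notin> {a} \<Longrightarrow> y b = z' b) \<Longrightarrow> y \<in> U"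
          using open_fun_finite_box[OF U z(2), of "{a}"] by (metis finite.emptyI finite.insertI)
        have "\<forall>\<^sub>F s in nhds (z a). \<bar>s - z a\<bar> < min d d'"
          using d(1) d'(1) by (auto simp: eventually_nhds_metric dist_real_def intro!: exI[of _ "min d d'"])
        then have "\<forall>\<^sub>F s in nhds (z a). f (z(a := s)) = f (z'(a := s))"
        proof (rule eventually_mono)
          fix s assume s: "\<bar>s - z a\<bar> < min d d'"
          have zs: "z(a := s) \<in> U" "z'(a := s) \<in> U"
            using s z(3)[OF a] d(2)[of "z(a := s)"] d'(2)[of "z'(a := s)"] by auto
          show "f (z(a := s)) = f (z'(a := s))"
            by (rule Suc.prems(2)[OF zs]) (simp add: z(3))
        qed
        then show "jet_pd a f z = jet_pd a f z'"
          unfolding jet_pd_def using z(3)[OF a] deriv_cong_ev by metis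
      qed
      ultimately have "Ck_on k W (\<lambda>x. jet_pd a f (Z x) * frechet_derivative (\<lambda>x. Z x a) (at x) v)" if "a \<in> J" for a
        using that unfolding smooth_on_def by (intro Ck_on_bounded_bilinear[OF bounded_bilinear_mult W]) auto
      then show "Ck_on k W (\<lambda>x. \<Sum>a\<in>J. jet_pd a f (Z x) * frechet_derivative (\<lambda>x. Z x a) (at x) v)"
        by (rule Ck_on_sum[OF W])
    qed
  }
qed

text \<open>There are finitely many lists of bounded length over a finite type. This gives the
  finite set \<open>J\<close> of the chain rule for form functions of finite order.\<close>

lemma finite_jet_order_le: "finite {a :: 'n::finite jet_coord. jet_order a \<le> k}"
proof -
  let ?L = "{l :: 'n list. length l \<le> k}"
  have "finite ?L" using finite_lists_length_le[of "UNIV :: 'n set" k] by simp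
  then have fin: "finite (insert Time (range Pos \<union> (\<Union>i. Vel i ` ?L) \<union> Dens ` ?L \<union> Entr ` ?L))"
    by auto
  have mem: "a \<in> insert Time (range Pos \<union> (\<Union>i. Vel i ` ?L) \<union> Dens ` ?L \<union> Entr ` ?L)"
    if "jet_order a \<le> k" for a :: "'n jet_coord"
    using that by (cases a) auto
  show ?thesis by (rule finite_subset[OF subsetI fin]) (use mem in \<open>simp only: mem_Collect_eq\<close>)
qed

lemma open_jet_domain:
  fixes c :: "('m, 'n::finite) chart"
  assumes "open (chart_image c)"
  shows "open (jet_domain c)"
proof -
  have "continuous_on UNIV (\<lambda>z :: 'n jet. (\<chi> i. z (Pos i)) :: real^'n)"
    by (intro continuous_on_vec_lambda continuous_on_product_coordinates)
  then have "open ((\<lambda>z :: 'n jet. (\<chi> i. z (Pos i)) :: real^'n) -` chart_image c)"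
    using assms continuous_on_open_vimage[OF open_UNIV] by auto
  moreover have "open ((\<lambda>z :: 'n jet. z (Dens [])) -` {0<..})"
    using continuous_on_open_vimage[of UNIV "\<lambda>z :: 'n jet. z (Dens [])"] by auto
  moreover have "jet_domain c = ((\<lambda>z. \<chi> i. z (Pos i)) -` chart_image c) \<inter> ((\<lambda>z. z (Dens [])) -` {0<..})"
    by (auto simp: jet_domain_def)
  ultimately show ?thesis by auto
qed

lemma smooth_on_foldr_pd:
  "smooth_on W f \<Longrightarrow> smooth_on W (foldr pd l f)"
  by (induction l) (auto simp: pd_def[abs_def] intro: smooth_on_frechet)

lemma smooth_on_jet_of:
  assumes "open W" "smooth_on W u" "smooth_on W \<rho>" "smooth_on W S"
  shows "smooth_on W (\<lambda>y. jet_of t y u \<rho> S a)"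
  using assms
  by (cases a) (auto intro: smooth_on_const smooth_on_nth smooth_on_ident smooth_on_foldr_pd)

lemma jet_of_in_domain:
  "y \<in> chart_image c \<Longrightarrow> \<rho> y > 0 \<Longrightarrow> jet_of t y u \<rho> S \<in> jet_domain c"
  by (simp add: jet_domain_def)

lemmas jet_form_alt = jet_form_def[THEN iffD1, THEN conjunct1, rule_format]
lemmas jet_form_finite_order = jet_form_def[THEN iffD1, THEN conjunct2, THEN conjunct1]
lemmas jet_form_Ck = jet_form_def[THEN iffD1, THEN conjunct2, THEN conjunct2, THEN conjunct1, rule_format]
lemmas jet_form_overlap = jet_form_def[THEN iffD1, THEN conjunct2, THEN conjunct2, THEN conjunct2, rule_format]

text \<open>Makes d(d \<beta>) = 0 available for a flux evaluated on fields: finite order leaves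
  finitely many jet coordinates, each of them smooth along smooth fields.\<close>

lemma smooth_on_jet_form:
  fixes A :: "('m, 'n::finite) chart set"
  assumes \<beta>: "jet_form A q \<beta>" "c \<in> A" "open (chart_image c)"
    and W: "open W" "W \<subseteq> chart_image c" "smooth_on W u" "smooth_on W \<rho>" "smooth_on W S"
      "\<And>y. y \<in> W \<Longrightarrow> \<rho> y > 0"
  shows "smooth_on W (\<lambda>y. \<beta> c (jet_of t y u \<rho> S) vs)"
proof -
  obtain k where "\<forall>c\<in>A. \<forall>z\<in>jet_domain c. \<forall>z'\<in>jet_domain c.
        (\<forall>a. jet_order a \<le> k \<longrightarrow> z a = z' a) \<longrightarrow> \<beta> c z = \<beta> c z'"
    by (rule exE[OF jet_form_finite_order[OF \<beta>(1)]])
  from bspec[OF this \<beta>(2)] have k: "\<beta> c z = \<beta> c z'" if "z \<in> jet_domain c" "z' \<in> jet_domain c"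
      "\<And>a. jet_order a \<le> k \<Longrightarrow> z a = z' a" for z z'
    using that by blast
  show ?thesis unfolding smooth_on_def
  proof (intro allI Ck_on_jet_compose[where f="\<lambda>z. \<beta> c z vs" and Z="\<lambda>y. jet_of t y u \<rho> S",
        OF open_jet_domain[OF \<beta>(3)] W(1) _ finite_jet_order_le[of k]])
    show "jet_Ck k' (jet_domain c) (\<lambda>z. \<beta> c z vs)" for k'
      by (rule jet_form_Ck[OF \<beta>(1,2)])
    show "\<beta> c z vs = \<beta> c z' vs" if "z \<in> jet_domain c" "z' \<in> jet_domain c"
      "\<And>a. a \<in> {a. jet_order a \<le> k} \<Longrightarrow> z a = z' a" for z z'
      by (rule fun_cong[OF k[OF that(1,2)]]) (use that(3) in simp)
    show "jet_of t y u \<rho> S \<in> jet_domain c" if "y \<in> W" for y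
      using W that by (intro jet_of_in_domain) auto
    show "smooth_on W (\<lambda>y. jet_of t y u \<rho> S a)" for a
      using smooth_on_jet_of W by blast
  qed
qed

section \<open>Closure properties of smooth functions of jets\<close>

lemma jet_pd_cong:
  assumes "open U" "\<And>z. z \<in> U \<Longrightarrow> f z = g z" "z \<in> U"
  shows "jet_pd a f z = jet_pd a g z"
    "(\<lambda>s. f (z(a := s))) differentiable (at (z a)) \<longleftrightarrow> (\<lambda>s. g (z(a := s))) differentiable (at (z a))"
proof -
  obtain d where d: "d > 0" "\<And>y. (\<And>b. b \<in> {a} \<Longrightarrow> \<bar>y b - z b\<bar> < d) \<Longrightarrow> (\<And>b. b \<notin> {a} \<Longrightarrow> y b = z b) \<Longrightarrow> y \<in> U"
    using open_fun_finite_box[OF assms(1,3), of "{a}"] by (metis finite.emptyI finite.insertI)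
  have ev: "f (z(a := s)) = g (z(a := s))" if "s \<in> ball (z a) d" for s
    using that by (intro assms(2) d(2)) (auto simp: dist_real_def)
  then have "\<forall>\<^sub>F s in nhds (z a). f (z(a := s)) = g (z(a := s))"
    using d(1) unfolding eventually_nhds_metric by (intro exI[of _ d]) (simp add: dist_commute)
  then show "jet_pd a f z = jet_pd a g z" unfolding jet_pd_def by (rule deriv_cong_ev) simp
  have "((\<lambda>s. f (z(a := s))) has_derivative D) (at (z a)) \<longleftrightarrow> ((\<lambda>s. g (z(a := s))) has_derivative D) (at (z a))" for D
  proof
    assume "((\<lambda>s. f (z(a := s))) has_derivative D) (at (z a))"
    then show "((\<lambda>s. g (z(a := s))) has_derivative D) (at (z a))"
      by (rule has_derivative_transform_within_open[where s="ball (z a) d"]) (use d(1) ev in auto)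
  next
    assume "((\<lambda>s. g (z(a := s))) has_derivative D) (at (z a))"
    then show "((\<lambda>s. f (z(a := s))) has_derivative D) (at (z a))"
      by (rule has_derivative_transform_within_open[where s="ball (z a) d"]) (use d(1) ev in auto)
  qed
  then show "(\<lambda>s. f (z(a := s))) differentiable (at (z a)) \<longleftrightarrow> (\<lambda>s. g (z(a := s))) differentiable (at (z a))"
    unfolding differentiable_def by simp
qed

lemma jet_Ck_cong:
  "open U \<Longrightarrow> (\<And>z. z \<in> U \<Longrightarrow> f z = g z) \<Longrightarrow> jet_Ck k U f \<longleftrightarrow> jet_Ck k U g"
proof (induction k arbitrary: f g)
  case 0
  then show ?case by (simp cong: continuous_on_cong)
next
  case (Suc k)
  have "continuous_on U f \<longleftrightarrow> continuous_on U g" using Suc.prems(2) by (simp cong: continuous_on_cong)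
  moreover have "jet_Ck k U (jet_pd a f) \<longleftrightarrow> jet_Ck k U (jet_pd a g)" for a
    by (rule Suc.IH[OF Suc.prems(1)]) (rule jet_pd_cong(1)[of U f g], use Suc.prems in auto)
  ultimately show ?case using jet_pd_cong(2)[of U f g, OF Suc.prems] by simp
qed

lemma jet_Ck_diff:
  "open U \<Longrightarrow> jet_Ck k U f \<Longrightarrow> jet_Ck k U g \<Longrightarrow> jet_Ck k U (\<lambda>z. f z - g z)"
proof (induction k arbitrary: f g)
  case 0
  then show ?case by (auto intro: continuous_intros)
next
  case (Suc k)
  have pd: "jet_pd a (\<lambda>z. f z - g z) z = jet_pd a f z - jet_pd a g z" if "z \<in> U" for a z
  proof -
    have "((\<lambda>s. f (z(a := s))) has_real_derivative jet_pd a f z) (at (z a))"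
      "((\<lambda>s. g (z(a := s))) has_real_derivative jet_pd a g z) (at (z a))"
      unfolding jet_pd_def using Suc.prems(2,3) that by (simp_all add: DERIV_deriv_iff_real_differentiable)
    from DERIV_diff[OF this] show ?thesis
      unfolding jet_pd_def[of a "\<lambda>z. f z - g z"] by (rule DERIV_imp_deriv)
  qed
  have "jet_Ck k U (\<lambda>z. jet_pd a f z - jet_pd a g z)" for a
    using Suc.prems by (intro Suc.IH) auto
  then have "jet_Ck k U (jet_pd a (\<lambda>z. f z - g z))" for a
    by (subst jet_Ck_cong[OF Suc.prems(1), where g="\<lambda>z. jet_pd a f z - jet_pd a g z"]) (rule pd, assumption)
  note pd_Ck = this
  have c: "continuous_on U f" "continuous_on U g"
    and d: "\<And>a z. z \<in> U \<Longrightarrow> (\<lambda>s. f (z(a := s))) differentiable (at (z a))"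
      "\<And>a z. z \<in> U \<Longrightarrow> (\<lambda>s. g (z(a := s))) differentiable (at (z a))"
    using Suc.prems(2,3) by simp_all
  show ?case unfolding jet_Ck.simps
    by (intro conjI allI ballI pd_Ck continuous_on_diff c differentiable_diff d)
qed

text \<open>By \<open>upd\<close>, moving coordinate \<open>a\<close> moves \<open>\<pi>\<close>
  along the fixed vector \<open>e a\<close>, so a partial derivative of the composite is again a
  smooth function composed with \<open>\<pi>\<close> and the induction closes. It serves the
  explicit flux of the circulation.\<close>

lemma jet_Ck_smooth_compose:
  fixes \<pi> :: "'n::finite jet \<Rightarrow> 'e::euclidean_space"
  assumes U: "open U" and V: "open V" and \<pi>: "\<And>z. z \<in> U \<Longrightarrow> \<pi> z \<in> V" "continuous_on U \<pi>"
    and upd: "\<And>z a s. \<pi> (z(a := s)) = \<pi> z + (s - z a) *\<^sub>R e a"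
  shows "smooth_on V \<kappa> \<Longrightarrow> jet_Ck k U (\<lambda>z. \<kappa> (\<pi> z) :: real)"
proof (induction k arbitrary: \<kappa>)
  case 0
  have "continuous_on U (\<lambda>z. \<kappa> (\<pi> z))"
    by (rule continuous_on_compose2[OF smooth_on_continuous[OF 0] \<pi>(2)]) (use \<pi>(1) in blast)
  then show ?case by simp
next
  case (Suc k)
  have D: "((\<lambda>s. \<kappa> (\<pi> (z(a := s)))) has_derivative (\<lambda>r. frechet_derivative \<kappa> (at (\<pi> z)) (r *\<^sub>R e a))) (at (z a))"
    if "z \<in> U" for z a
  proof -
    have "((\<lambda>s. \<pi> z + (s - z a) *\<^sub>R e a) has_derivative (\<lambda>r. r *\<^sub>R e a)) (at (z a))"
      by (auto intro!: derivative_eq_intros)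
    moreover have "(\<kappa> has_derivative frechet_derivative \<kappa> (at (\<pi> z))) (at (\<pi> z + (z a - z a) *\<^sub>R e a))"
      using smooth_on_has_derivative[OF Suc.prems \<pi>(1)[OF that]] by simp
    ultimately show ?thesis unfolding upd using has_derivative_compose by blast
  qed
  have pd: "jet_pd a (\<lambda>z. \<kappa> (\<pi> z)) z = frechet_derivative \<kappa> (at (\<pi> z)) (e a)" if "z \<in> U" for z a
  proof -
    have "linear (frechet_derivative \<kappa> (at (\<pi> z)))"
      by (rule linear_frechet_derivative[OF smooth_on_differentiable[OF Suc.prems \<pi>(1)[OF that]]])
    then have "(\<lambda>r. frechet_derivative \<kappa> (at (\<pi> z)) (r *\<^sub>R e a)) = (*) (frechet_derivative \<kappa> (at (\<pi> z)) (e a))"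
      by (simp add: fun_eq_iff linear_scale)
    then have "((\<lambda>s. \<kappa> (\<pi> (z(a := s)))) has_real_derivative frechet_derivative \<kappa> (at (\<pi> z)) (e a)) (at (z a))"
      using D[OF that, of a] unfolding has_field_derivative_def by (simp only:)
    then show ?thesis unfolding jet_pd_def by (rule DERIV_imp_deriv)
  qed
  have "jet_Ck k U (jet_pd a (\<lambda>z. \<kappa> (\<pi> z)))" for a
    by (subst jet_Ck_cong[OF U, where g="\<lambda>z. frechet_derivative \<kappa> (at (\<pi> z)) (e a)"])
       (rule pd, assumption, rule Suc.IH[OF smooth_on_frechet[OF Suc.prems]])
  moreover have "continuous_on U (\<lambda>z. \<kappa> (\<pi> z))"
    by (rule continuous_on_compose2[OF smooth_on_continuous[OF Suc.prems] \<pi>(2)]) (use \<pi>(1) in blast)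
  moreover have "(\<lambda>s. \<kappa> (\<pi> (z(a := s)))) differentiable (at (z a))" if "z \<in> U" for z a
    by (rule differentiableI[OF D[OF that]])
  ultimately show ?case by simp
qed

section \<open>The rate of change of a density along the flow\<close>

lemma alt_form_length: "alt_form p \<omega> \<Longrightarrow> length vs \<noteq> p \<Longrightarrow> \<omega> vs = 0"
  unfolding alt_form_def by simp

lemma alt_form_linear: "alt_form p \<omega> \<Longrightarrow> length vs = p \<Longrightarrow> i < p \<Longrightarrow> linear (\<lambda>w. \<omega> (vs[i := w]))"
  unfolding alt_form_def by simp

lemma alt_form_linear_Cons:
  assumes "alt_form (Suc p) \<omega>" "length ws = p"
  shows "linear (\<lambda>w. \<omega> (w # ws))"
  using alt_form_linear[OF assms(1), of "0 # ws" 0] assms(2) by simp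

lemma alt_form_Cons_zero:
  assumes "alt_form p \<omega>"
  shows "\<omega> (0 # ws) = 0"
proof (cases "length (0 # ws) = p")
  case True
  then have "linear (\<lambda>w. \<omega> (w # ws))"
    using alt_form_linear_Cons[of "p - 1" \<omega> ws] assms by (cases p) auto
  from linear_0[OF this] show ?thesis .
qed (rule alt_form_length[OF assms])

lemma alt_form_Cons_expand:
  fixes \<omega> :: "'n::finite form"
  assumes "alt_form p \<omega>"
  shows "\<omega> (w # ws) = (\<Sum>k\<in>UNIV. w $ k * \<omega> (axis k 1 # ws))"
proof (cases "length (w # ws) = p")
  case True
  then have L: "linear (\<lambda>w. \<omega> (w # ws))"
    using alt_form_linear_Cons[of "p - 1" \<omega> ws] assms by (cases p) auto
  have "\<omega> (w # ws) = \<omega> ((\<Sum>k\<in>UNIV. w $ k *\<^sub>R axis k 1) # ws)"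
    using basis_expansion[of w] by (simp add: scalar_mult_eq_scaleR)
  also have "\<dots> = (\<Sum>k\<in>UNIV. w $ k * \<omega> (axis k 1 # ws))"
    by (simp add: linear_sum[OF L] linear_scale[OF L])
  finally show ?thesis .
next
  case False
  then have "\<omega> (w # ws) = 0" "\<omega> (axis k 1 # ws) = 0" for k
    using alt_form_length[OF assms] by simp_all
  then show ?thesis by simp
qed

lemma frechet_derivative_eq: "(f has_derivative D) (at x) \<Longrightarrow> frechet_derivative f (at x) = D"
  by (rule frechet_derivative_at[symmetric])

text \<open>In components the contraction is a sum of products, to which the product rule applies.
  The two resulting sums are the derivative with \<open>u\<close> frozen and the form evaluated on
  the derivative of \<open>u\<close>.\<close>

lemma has_derivative_contraction:
  fixes \<omega> :: "real^'n \<Rightarrow> 'n::finite form"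
  assumes W: "open W" "y \<in> W" and alt: "\<And>x. x \<in> W \<Longrightarrow> alt_form p (\<omega> x)"
    and \<omega>: "\<And>ws. (\<lambda>x. \<omega> x ws) differentiable (at y)" and u: "(u has_derivative u') (at y)"
  shows "((\<lambda>x. \<omega> x (u x # ws)) has_derivative
     (\<lambda>v. frechet_derivative (\<lambda>x. \<omega> x (u y # ws)) (at y) v + \<omega> y (u' v # ws))) (at y)"
proof -
  let ?D = "\<lambda>k. frechet_derivative (\<lambda>x. \<omega> x (axis k 1 # ws)) (at y)"
  have D: "((\<lambda>x. \<omega> x (axis k 1 # ws)) has_derivative ?D k) (at y)" for k
    using \<omega> frechet_derivative_works by blast
  have expand: "((\<lambda>x. \<omega> x (f x # ws)) has_derivative D') (at y)"
    if "((\<lambda>x. \<Sum>k\<in>UNIV. f x $ k * \<omega> x (axis k 1 # ws)) has_derivative D') (at y)" for f D'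
    by (rule has_derivative_transform_within_open[OF that W]) (simp add: alt_form_Cons_expand[OF alt])
  have 1: "((\<lambda>x. \<omega> x (u x # ws)) has_derivative
      (\<lambda>v. \<Sum>k\<in>UNIV. u y $ k * ?D k v + u' v $ k * \<omega> y (axis k 1 # ws))) (at y)"
    by (intro expand has_derivative_sum has_derivative_mult D bounded_linear.has_derivative[OF bounded_linear_vec_nth] u)
  have 2: "((\<lambda>x. \<omega> x (u y # ws)) has_derivative (\<lambda>v. \<Sum>k\<in>UNIV. u y $ k * ?D k v)) (at y)"
    by (intro expand has_derivative_sum has_derivative_mult_right D)
  have "(\<lambda>v. \<Sum>k\<in>UNIV. u y $ k * ?D k v + u' v $ k * \<omega> y (axis k 1 # ws))
     = (\<lambda>v. frechet_derivative (\<lambda>x. \<omega> x (u y # ws)) (at y) v + \<omega> y (u' v # ws))"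
    unfolding frechet_derivative_eq[OF 2] alt_form_Cons_expand[OF alt[OF W(2)], of "u' _"]
    by (simp add: sum.distrib)
  with 1 show ?thesis by (simp only:)
qed

text \<open>The terms that differentiate the form along the arguments cancel between the two
  summands of Cartan's formula. What survives is the derivative along \<open>u\<close> and the terms
  with one argument replaced by its image under \<open>u'\<close>; the sign comes from moving that
  argument to the front.\<close>

lemma lie_deriv_eq:
  fixes \<omega> :: "real^'n \<Rightarrow> 'n::finite form"
  assumes W: "open W" "y \<in> W" and alt: "\<And>x. x \<in> W \<Longrightarrow> alt_form p (\<omega> x)"
    and \<omega>: "\<And>ws. (\<lambda>x. \<omega> x ws) differentiable (at y)" and u: "(u has_derivative u') (at y)"
  shows "lie_deriv u \<omega> y vs = frechet_derivative (\<lambda>x. \<omega> x vs) (at y) (u y)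
    + (\<Sum>i<length vs. (-1)^i * \<omega> y (u' (vs ! i) # drop_nth i vs))"
proof -
  have "ext_deriv \<omega> y (u y # vs) = frechet_derivative (\<lambda>x. \<omega> x vs) (at y) (u y)
     - (\<Sum>i<length vs. (-1)^i * frechet_derivative (\<lambda>x. \<omega> x (u y # drop_nth i vs)) (at y) (vs ! i))"
    unfolding ext_deriv_def list.size sum.lessThan_Suc_shift add_Suc_right add_0_right
    by (simp add: sum_negf)
  moreover have "ext_deriv (\<lambda>x. interior_prod (u x) (\<omega> x)) y vs
     = (\<Sum>i<length vs. (-1)^i * (frechet_derivative (\<lambda>x. \<omega> x (u y # drop_nth i vs)) (at y) (vs ! i)
          + \<omega> y (u' (vs ! i) # drop_nth i vs)))"
    unfolding ext_deriv_def interior_prod_def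
    by (simp add: frechet_derivative_eq[OF has_derivative_contraction[OF assms]])
  ultimately show ?thesis
    unfolding lie_deriv_def interior_prod_def by (simp add: algebra_simps sum.distrib)
qed

section \<open>Elimination of the time derivatives\<close>

definition christoffel_sq :: "(real^'n \<Rightarrow> real^'n^'n) \<Rightarrow> real^'n::finite \<Rightarrow> real^'n \<Rightarrow> real^'n" where
  "christoffel_sq G y v = (\<chi> i. \<Sum>j\<in>UNIV. \<Sum>k\<in>UNIV. christoffel G i j k y * v $ j * v $ k)"

definition christoffel_tr :: "(real^'n \<Rightarrow> real^'n^'n) \<Rightarrow> real^'n::finite \<Rightarrow> real^'n \<Rightarrow> real" where
  "christoffel_tr G y v = (\<Sum>i\<in>UNIV. \<Sum>k\<in>UNIV. christoffel G i i k y * v $ k)"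

lemma pd_eq: "(f has_derivative f') (at y) \<Longrightarrow> pd i f y = f' (axis i 1)"
  unfolding pd_def by (simp add: frechet_derivative_eq)

lemma cov_deriv_eq:
  fixes u :: "real^'n::finite \<Rightarrow> real^'n"
  assumes "(u has_derivative u') (at y)"
  shows "cov_deriv G u u y = u' (u y) + christoffel_sq G y (u y)"
proof -
  have comp: "((\<lambda>x. u x $ i) has_derivative (\<lambda>v. u' v $ i)) (at y)" for i
    by (rule bounded_linear.has_derivative[OF bounded_linear_vec_nth assms])
  have lin: "linear u'" using assms has_derivative_linear by blast
  have "u' (u y) = u' (\<Sum>j\<in>UNIV. u y $ j *\<^sub>R axis j 1)"
    using basis_expansion[of "u y"] by (simp add: scalar_mult_eq_scaleR)
  also have "\<dots> = (\<Sum>j\<in>UNIV. u y $ j *\<^sub>R u' (axis j 1))"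
    by (simp add: linear_sum[OF lin] linear_scale[OF lin])
  finally show ?thesis
    unfolding cov_deriv_def cov_pd_def christoffel_sq_def pd_eq[OF comp]
    by (simp add: vec_eq_iff sum.distrib algebra_simps sum_distrib_left)
qed

lemma divergence_scaleR_eq:
  fixes u :: "real^'n::finite \<Rightarrow> real^'n"
  assumes u: "(u has_derivative u') (at y)" and \<rho>: "(\<rho> has_derivative \<rho>') (at y)"
  shows "divergence G (\<lambda>x. \<rho> x *\<^sub>R u x) y
    = \<rho>' (u y) + \<rho> y * ((\<Sum>i\<in>UNIV. u' (axis i 1) $ i) + christoffel_tr G y (u y))"
proof -
  have comp: "((\<lambda>x. (\<rho> x *\<^sub>R u x) $ i) has_derivative (\<lambda>v. \<rho> y * u' v $ i + \<rho>' v * u y $ i)) (at y)" for i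
    unfolding vector_scaleR_component real_scaleR_def
    by (intro has_derivative_mult bounded_linear.has_derivative[OF bounded_linear_vec_nth] assms)
  have lin: "linear \<rho>'" using assms has_derivative_linear by blast
  have "\<rho>' (u y) = \<rho>' (\<Sum>j\<in>UNIV. u y $ j *\<^sub>R axis j 1)"
    using basis_expansion[of "u y"] by (simp add: scalar_mult_eq_scaleR)
  also have "\<dots> = (\<Sum>j\<in>UNIV. u y $ j * \<rho>' (axis j 1))"
    by (simp add: linear_sum[OF lin] linear_scale[OF lin])
  finally show ?thesis
    unfolding divergence_def cov_pd_def christoffel_tr_def pd_eq[OF comp]
    by (simp add: sum.distrib algebra_simps sum_distrib_left)
qed

text \<open>\<open>D\<^sub>t \<alpha> + \<L>\<^sub>u \<alpha>\<close> with the time derivatives eliminated by the fluid equations.\<close>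

definition fluid_rate ::
  "(real \<Rightarrow> real \<Rightarrow> real) \<Rightarrow> (real^'n \<Rightarrow> real^'n^'n) \<Rightarrow>
   (real \<Rightarrow> real^'n \<Rightarrow> real^'n \<Rightarrow> real \<Rightarrow> real \<Rightarrow> 'n::finite form) \<Rightarrow> real \<Rightarrow>
   (real^'n \<Rightarrow> real^'n) \<Rightarrow> (real^'n \<Rightarrow> real) \<Rightarrow> (real^'n \<Rightarrow> real) \<Rightarrow> real^'n \<Rightarrow> 'n form" where
  "fluid_rate P G a t u \<rho> S x ws =
     frechet_derivative (\<lambda>(t, y, u, \<rho>, S). a t y u \<rho> S ws) (at (t, x, u x, \<rho> x, S x))
       (1, u x, - christoffel_sq G x (u x) - (1 / \<rho> x) *\<^sub>R grad G (\<lambda>x. P (\<rho> x) (S x)) x,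
        - \<rho> x * ((\<Sum>i\<in>UNIV. frechet_derivative u (at x) (axis i 1) $ i) + christoffel_tr G x (u x)), 0)
     + (\<Sum>i<length ws. (-1)^i * a t x (u x) (\<rho> x) (S x) (frechet_derivative u (at x) (ws ! i) # drop_nth i ws))"

text \<open>The time derivative and the derivative along \<open>u\<close> add up to the material
  derivative of each field, in which the advection terms of the fluid equations cancel: velocity
  keeps the Christoffel and pressure terms, density keeps the compression term, entropy keeps
  nothing.\<close>

lemma advective_deriv_eq_fluid_rate:
  fixes \<alpha> :: "('m::{t2_space, second_countable_topology}, 'n::finite) kinematic"
  assumes \<alpha>: "kinematic_form A p \<alpha>" and c: "c \<in> A" "open (chart_image c)"
    and sol: "formal_solution g P c t W u \<rho> S" and x: "x \<in> W"
  shows "advective_deriv \<alpha> c t u \<rho> S x ws = fluid_rate P (g c) (\<alpha> c) t (u t) (\<rho> t) (S t) x ws"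
proof -
  let ?a = "\<lambda>ws (t, y, u, \<rho>, S). \<alpha> c t y u \<rho> S ws"
  let ?Z = "\<lambda>s x. (s, x, u s x, \<rho> s x, S s x)"
  let ?D = "\<lambda>ws. frechet_derivative (?a ws) (at (?Z t x))"
  have W: "open W" "W \<subseteq> chart_image c"
    and sm: "smooth_on W (u t)" "smooth_on W (\<rho> t)" "smooth_on W (S t)"
    and pos: "\<And>y. y \<in> W \<Longrightarrow> \<rho> t y > 0"
    using sol unfolding formal_solution_def by auto
  define ut where "ut = - cov_deriv (g c) (u t) (u t) x - (1 / \<rho> t x) *\<^sub>R grad (g c) (\<lambda>x. P (\<rho> t x) (S t x)) x"
  define \<rho>t where "\<rho>t = - divergence (g c) (\<lambda>x. \<rho> t x *\<^sub>R u t x) x"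
  define St where "St = - frechet_derivative (S t) (at x) (u t x)"
  have der: "((\<lambda>s. u s x) has_vector_derivative ut) (at t)" "((\<lambda>s. \<rho> s x) has_real_derivative \<rho>t) (at t)"
    "((\<lambda>s. S s x) has_real_derivative St) (at t)"
    using sol x unfolding formal_solution_def ut_def \<rho>t_def St_def by auto
  have u': "(u t has_derivative frechet_derivative (u t) (at x)) (at x)"
    and \<rho>': "(\<rho> t has_derivative frechet_derivative (\<rho> t) (at x)) (at x)"
    and S': "(S t has_derivative frechet_derivative (S t) (at x)) (at x)"
    using sm x smooth_on_has_derivative by blast+
  have Z: "?Z t y \<in> UNIV \<times> chart_image c \<times> UNIV \<times> {0<..} \<times> UNIV" if "y \<in> W" for y
    using W pos that by auto
  have a: "smooth_on (UNIV \<times> chart_image c \<times> UNIV \<times> {0<..} \<times> UNIV) (?a ws)" for ws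
    using \<alpha> c(1) unfolding kinematic_form_def by blast
  have aD: "(?a ws has_derivative ?D ws) (at (?Z t x))" for ws
    by (rule smooth_on_has_derivative[OF a Z[OF x]])
  have linD: "linear (?D ws)" for ws using aD has_derivative_linear by blast
  have time: "((\<lambda>s. \<alpha> c s x (u s x) (\<rho> s x) (S s x) ws) has_real_derivative ?D ws (1, 0, ut, \<rho>t, St)) (at t)"
  proof -
    have "((\<lambda>s. ?Z s x) has_derivative (\<lambda>r. (r, 0, r *\<^sub>R ut, r *\<^sub>R \<rho>t, r *\<^sub>R St))) (at t)"
      using der unfolding has_real_derivative_iff_has_vector_derivative has_vector_derivative_def
      by (intro has_derivative_Pair has_derivative_ident has_derivative_const)
    from has_derivative_compose[OF this aD]
    have "((\<lambda>s. ?a ws (?Z s x)) has_derivative (\<lambda>r. ?D ws (r *\<^sub>R (1, 0, ut, \<rho>t, St)))) (at t)"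
      by (simp add: scaleR_Pair)
    then show ?thesis
      unfolding linear_scale[OF linD]
      by (simp add: has_real_derivative_iff_has_vector_derivative has_vector_derivative_def)
  qed
  have space: "((\<lambda>y. on_fields \<alpha> c t u \<rho> S y ws) has_derivative
      (\<lambda>v. ?D ws (0, v, frechet_derivative (u t) (at x) v, frechet_derivative (\<rho> t) (at x) v, frechet_derivative (S t) (at x) v))) (at x)" for ws
  proof -
    have "(?Z t has_derivative (\<lambda>v. (0, v, frechet_derivative (u t) (at x) v, frechet_derivative (\<rho> t) (at x) v,
        frechet_derivative (S t) (at x) v))) (at x)"
      by (intro has_derivative_Pair has_derivative_ident has_derivative_const u' \<rho>' S')
    from has_derivative_compose[OF this aD] show ?thesis by (simp add: on_fields_def)
  qed
  have lie: "lie_deriv (u t) (on_fields \<alpha> c t u \<rho> S) x ws =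
      ?D ws (0, u t x, frechet_derivative (u t) (at x) (u t x), frechet_derivative (\<rho> t) (at x) (u t x), frechet_derivative (S t) (at x) (u t x))
      + (\<Sum>i<length ws. (-1)^i * on_fields \<alpha> c t u \<rho> S x (frechet_derivative (u t) (at x) (ws ! i) # drop_nth i ws))"
  proof -
    have "alt_form p (on_fields \<alpha> c t u \<rho> S y)" if "y \<in> W" for y
      using \<alpha> c(1) W pos that unfolding kinematic_form_def on_fields_def by blast
    then show ?thesis
      by (subst lie_deriv_eq[OF W(1) x _ _ u'])
         (use space in \<open>auto intro: differentiableI simp: frechet_derivative_eq[OF space]\<close>)
  qed
  have comps: "ut + frechet_derivative (u t) (at x) (u t x)
      = - christoffel_sq (g c) x (u t x) - (1 / \<rho> t x) *\<^sub>R grad (g c) (\<lambda>x. P (\<rho> t x) (S t x)) x"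
    "\<rho>t + frechet_derivative (\<rho> t) (at x) (u t x)
      = - \<rho> t x * ((\<Sum>i\<in>UNIV. frechet_derivative (u t) (at x) (axis i 1) $ i) + christoffel_tr (g c) x (u t x))"
    "St + frechet_derivative (S t) (at x) (u t x) = 0"
    unfolding ut_def \<rho>t_def St_def cov_deriv_eq[OF u'] divergence_scaleR_eq[OF u' \<rho>'] by simp_all
  have "advective_deriv \<alpha> c t u \<rho> S x ws = ?D ws (1, 0, ut, \<rho>t, St)
     + ?D ws (0, u t x, frechet_derivative (u t) (at x) (u t x), frechet_derivative (\<rho> t) (at x) (u t x), frechet_derivative (S t) (at x) (u t x))
      + (\<Sum>i<length ws. (-1)^i * on_fields \<alpha> c t u \<rho> S x (frechet_derivative (u t) (at x) (ws ! i) # drop_nth i ws))"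
    unfolding advective_deriv_def lie using DERIV_imp_deriv[OF time] by (simp add: on_fields_def)
  also have "?D ws (1, 0, ut, \<rho>t, St)
     + ?D ws (0, u t x, frechet_derivative (u t) (at x) (u t x), frechet_derivative (\<rho> t) (at x) (u t x), frechet_derivative (S t) (at x) (u t x))
     = ?D ws (1, u t x, ut + frechet_derivative (u t) (at x) (u t x), \<rho>t + frechet_derivative (\<rho> t) (at x) (u t x), St + frechet_derivative (S t) (at x) (u t x))"
    by (simp add: linear_add[OF linD, symmetric])
  finally show ?thesis unfolding fluid_rate_def comps on_fields_def .
qed

text \<open>Fields affine in \<open>s - t\<close>, with the right-hand sides of the fluid equations
  as slopes. Hence the fields on one time slice can be prescribed freely.\<close>

lemma formal_solution_extension:
  assumes "open W" "W \<subseteq> chart_image c" "smooth_on W u" "smooth_on W \<rho>" "smooth_on W S"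
    "\<And>y. y \<in> W \<Longrightarrow> \<rho> y > 0"
  obtains U R \<Sigma> where "formal_solution g P c t W U R \<Sigma>" "U t = u" "R t = \<rho>" "\<Sigma> t = S"
proof -
  let ?ut = "\<lambda>y. - cov_deriv (g c) u u y - (1 / \<rho> y) *\<^sub>R grad (g c) (\<lambda>x. P (\<rho> x) (S x)) y"
  let ?\<rho>t = "\<lambda>y. - divergence (g c) (\<lambda>x. \<rho> x *\<^sub>R u x) y"
  let ?St = "\<lambda>y. - frechet_derivative S (at y) (u y)"
  let ?U = "\<lambda>s y. u y + (s - t) *\<^sub>R ?ut y" and ?R = "\<lambda>s y. \<rho> y + (s - t) * ?\<rho>t y" and ?S = "\<lambda>s y. S y + (s - t) * ?St y"
  have t: "?U t = u" "?R t = \<rho>" "?S t = S" by auto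
  have "((\<lambda>s. ?U s y) has_vector_derivative ?ut y) (at t)" for y
    by (auto intro!: derivative_eq_intros)
  moreover have "((\<lambda>s. ?R s y) has_real_derivative ?\<rho>t y) (at t)" for y
    by (auto intro!: derivative_eq_intros)
  moreover have "((\<lambda>s. ?S s y) has_real_derivative ?St y) (at t)" for y
    by (auto intro!: derivative_eq_intros)
  ultimately have "formal_solution g P c t W ?U ?R ?S"
    unfolding formal_solution_def t using assms by auto
  from that[OF this t] show thesis .
qed

text \<open>On the fields of one time slice the rate equals - d \<beta>, whence it is smooth and
  closed. From here on the flux is no longer mentioned in the necessity part.\<close>

lemma conserved_closed:
  fixes \<alpha> :: "('m::{t2_space, second_countable_topology}, 'n::finite) kinematic"
  assumes cons: "conserved A g P p \<alpha>" and c: "c \<in> A" "open (chart_image c)"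
    and W: "open W" "W \<subseteq> chart_image c" and sm: "smooth_on W u" "smooth_on W \<rho>" "smooth_on W S"
    and pos: "\<And>y. y \<in> W \<Longrightarrow> \<rho> y > 0"
  shows "smooth_on W (\<lambda>x. fluid_rate P (g c) (\<alpha> c) t u \<rho> S x ws)"
    and "y \<in> W \<Longrightarrow> ext_deriv (fluid_rate P (g c) (\<alpha> c) t u \<rho> S) y vs = 0"
proof -
  obtain \<beta> where \<beta>: "jet_form A (p - 1) \<beta>"
    and flux: "\<forall>c\<in>A. \<forall>t W u \<rho> S. formal_solution g P c t W u \<rho> S \<longrightarrow>
           (\<forall>y\<in>W. \<forall>vs. advective_deriv \<alpha> c t u \<rho> S y vs =
              - ext_deriv (\<lambda>x. \<beta> c (jet_of t x (u t) (\<rho> t) (S t))) y vs)"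
    using cons unfolding conserved_def by (elim conjE exE)
  have kin: "kinematic_form A p \<alpha>" using cons unfolding conserved_def by (elim conjE)
  obtain U R \<Sigma> where sol: "formal_solution g P c t W U R \<Sigma>" "U t = u" "R t = \<rho>" "\<Sigma> t = S"
    by (rule formal_solution_extension[OF W sm pos])
  let ?b = "\<lambda>x. \<beta> c (jet_of t x u \<rho> S)"
  have b: "smooth_on W (\<lambda>x. ?b x ws)" for ws
    by (rule smooth_on_jet_form[OF \<beta> c W sm pos])
  have eq: "fluid_rate P (g c) (\<alpha> c) t u \<rho> S x ws = - ext_deriv ?b x ws" if "x \<in> W" for x ws
    using flux[rule_format, OF c(1) sol(1) that] advective_deriv_eq_fluid_rate[OF kin c sol(1) that]
    unfolding sol(2-4) by simp
  have sb: "smooth_on W (\<lambda>x. ext_deriv ?b x ws)" for ws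
    unfolding ext_deriv_def by (intro smooth_on_sum smooth_on_mult smooth_on_const smooth_on_frechet b W)
  show "smooth_on W (\<lambda>x. fluid_rate P (g c) (\<alpha> c) t u \<rho> S x ws)"
    by (rule smooth_on_eqI[OF smooth_on_minus[OF W(1) sb] W(1) eq])
  show "ext_deriv (fluid_rate P (g c) (\<alpha> c) t u \<rho> S) y vs = 0" if y: "y \<in> W"
  proof -
    have der: "((\<lambda>x. fluid_rate P (g c) (\<alpha> c) t u \<rho> S x ws) has_derivative
        (\<lambda>v. - frechet_derivative (\<lambda>x. ext_deriv ?b x ws) (at y) v)) (at y)" for ws
      by (rule has_derivative_transform_within_open[OF
            has_derivative_minus[OF smooth_on_has_derivative[OF sb y]] W(1) y]) (simp add: eq)
    have "ext_deriv (fluid_rate P (g c) (\<alpha> c) t u \<rho> S) y vs = - ext_deriv (ext_deriv ?b) y vs"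
      unfolding ext_deriv_def[of "fluid_rate P (g c) (\<alpha> c) t u \<rho> S"] ext_deriv_def[of "ext_deriv ?b"]
      by (simp add: frechet_derivative_eq[OF der] sum_negf)
    then show ?thesis using ext_deriv_ext_deriv[OF W(1) y b] by simp
  qed
qed

section \<open>Test fields in a chart\<close>

lemma smooth_on_Pair:
  assumes "open U" "smooth_on U f" "smooth_on U g"
  shows "smooth_on U (\<lambda>x. (f x, g x))"
proof -
  have "bounded_linear (\<lambda>x. (x, 0))" "bounded_linear (\<lambda>x. (0, x))"
    by (auto intro: bounded_linear_Pair bounded_linear_ident bounded_linear_zero)
  from smooth_on_add[OF assms(1) smooth_on_bounded_linear[OF this(1) assms(1,2)] smooth_on_bounded_linear[OF this(2) assms(1,3)]]
  show ?thesis by simp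
qed

lemma smooth_on_fst: "open U \<Longrightarrow> smooth_on U f \<Longrightarrow> smooth_on U (\<lambda>x. fst (f x))"
  by (rule smooth_on_bounded_linear[OF bounded_linear_fst])

lemma smooth_on_snd: "open U \<Longrightarrow> smooth_on U f \<Longrightarrow> smooth_on U (\<lambda>x. snd (f x))"
  by (rule smooth_on_bounded_linear[OF bounded_linear_snd])

lemma ext_deriv_Cons:
  "ext_deriv \<omega> y (v # vs) = frechet_derivative (\<lambda>x. \<omega> x vs) (at y) v
     - (\<Sum>i<length vs. (-1)^i * frechet_derivative (\<lambda>x. \<omega> x (v # drop_nth i vs)) (at y) (vs ! i))"
  unfolding ext_deriv_def list.size sum.lessThan_Suc_shift add_Suc_right add_0_right
  by (simp add: sum_negf)

text \<open>Turns a derivative of the rate into calculus in one variable: the values of f on a line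
  determine its derivative along that line once f is known to be differentiable.\<close>

lemma frechet_derivative_line:
  fixes f :: "'a::euclidean_space \<Rightarrow> real"
  assumes "open W" "y \<in> W" "smooth_on W f"
    and eq: "\<And>\<theta>. y + \<theta> *\<^sub>R v \<in> W \<Longrightarrow> f (y + \<theta> *\<^sub>R v) = h \<theta>" and h: "(h has_real_derivative d) (at 0)"
  shows "frechet_derivative f (at y) v = d"
proof -
  let ?l = "\<lambda>\<theta>. y + \<theta> *\<^sub>R v"
  have D: "(f has_derivative frechet_derivative f (at y)) (at (?l 0))"
    using smooth_on_has_derivative[OF assms(3,2)] by simp
  have "(?l has_derivative (\<lambda>r. r *\<^sub>R v)) (at 0)" by (auto intro!: derivative_eq_intros)
  from has_derivative_compose[OF this D]
  have fl: "((\<lambda>\<theta>. f (?l \<theta>)) has_real_derivative frechet_derivative f (at y) v) (at 0)"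
    using linear_scale[OF linear_frechet_derivative[OF smooth_on_differentiable[OF assms(3,2)]]]
    by (simp add: has_real_derivative_iff_has_vector_derivative has_vector_derivative_def)
  have "open (?l -` W)"
    by (rule continuous_open_vimage[OF assms(1)]) (intro continuous_intros)
  then have "(h has_real_derivative frechet_derivative f (at y) v) (at 0)"
    by (rule has_field_derivative_transform_within_open[OF fl]) (use assms(2) eq in auto)
  then show ?thesis using h DERIV_unique by blast
qed

lemma smooth_on_curve:
  fixes \<Phi> :: "'a::euclidean_space \<Rightarrow> real"
  assumes "smooth_on U \<Phi>" "Z 0 \<in> U" "(Z has_vector_derivative Z') (at 0)"
  shows "((\<lambda>\<theta>. \<Phi> (Z \<theta>)) has_real_derivative frechet_derivative \<Phi> (at (Z 0)) Z') (at 0)"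
proof -
  have "(Z has_derivative (\<lambda>r. r *\<^sub>R Z')) (at 0)" using assms(3) by (simp add: has_vector_derivative_def)
  from has_derivative_compose[OF this smooth_on_has_derivative[OF assms(1,2)]]
  show ?thesis
    using linear_scale[OF linear_frechet_derivative[OF smooth_on_differentiable[OF assms(1,2)]]]
    by (simp add: has_real_derivative_iff_has_vector_derivative has_vector_derivative_def)
qed

section \<open>The rate as an affine function of the first derivatives of the fields\<close>

type_synonym 'n phase = "real \<times> (real^'n) \<times> (real^'n) \<times> real \<times> real"

locale metric_chart =
  fixes Y :: "(real^'n::finite) set" and G :: "real^'n \<Rightarrow> real^'n^'n"
  assumes open_Y: "open Y" and smooth_G: "smooth_on Y G"
    and G_sym: "\<And>y. y \<in> Y \<Longrightarrow> transpose (G y) = G y"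
    and G_pos: "\<And>y v. y \<in> Y \<Longrightarrow> v \<noteq> 0 \<Longrightarrow> v \<bullet> (G y *v v) > 0"
begin

lemma G_inner_commute: "y \<in> Y \<Longrightarrow> v \<bullet> (G y *v w) = w \<bullet> (G y *v v)"
  using G_sym[of y] by (metis dot_lmul_matrix inner_commute transpose_matrix_vector)

lemma invertible_G: assumes "y \<in> Y" shows "invertible (G y)"
proof -
  have "v = 0" if "G y *v v = 0" for v
    using G_pos[OF assms, of v] that by fastforce
  then show ?thesis using invertible_left_inverse matrix_left_invertible_ker by blast
qed

lemma G_matrix_inv: "y \<in> Y \<Longrightarrow> G y *v (matrix_inv (G y) *v v) = v"
  "y \<in> Y \<Longrightarrow> matrix_inv (G y) *v (G y *v v) = v"
  using matrix_inv_right_left[OF invertible_G] by (simp_all add: matrix_vector_mul_assoc)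

lemma smooth_christoffel: "smooth_on Y (christoffel G i j k)"
  unfolding christoffel_def[abs_def] pd_def
  by (intro smooth_on_mult smooth_on_const smooth_on_sum smooth_on_add smooth_on_diff
      smooth_on_frechet smooth_on_nth smooth_on_matrix_inv smooth_G open_Y invertible_G)

end

text \<open>What is retained of a conserved density in one chart. Smoothness of the rate accompanies
  closedness because \<open>ext_deriv\<close> is meaningful only where the derivatives
  exist.\<close>

locale closed_rate = metric_chart Y G
  for Y :: "(real^'n::finite) set" and G :: "real^'n \<Rightarrow> real^'n^'n" +
  fixes P :: "real \<Rightarrow> real \<Rightarrow> real" and p :: nat
    and a :: "real \<Rightarrow> real^'n \<Rightarrow> real^'n \<Rightarrow> real \<Rightarrow> real \<Rightarrow> 'n form"
  assumes alt_a: "\<And>t y u \<rho> S. y \<in> Y \<Longrightarrow> \<rho> > 0 \<Longrightarrow> alt_form p (a t y u \<rho> S)"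
    and smooth_a': "\<And>ws. smooth_on (UNIV \<times> Y \<times> UNIV \<times> {0<..} \<times> UNIV) (\<lambda>(t, y, u, \<rho>, S). a t y u \<rho> S ws)"
    and smooth_P: "smooth_on ({0<..} \<times> UNIV) (\<lambda>(\<rho>, S). P \<rho> S)"
    and smooth_rate: "\<And>t W u \<rho> S ws. open W \<Longrightarrow> W \<subseteq> Y \<Longrightarrow> smooth_on W u \<Longrightarrow> smooth_on W \<rho> \<Longrightarrow>
      smooth_on W S \<Longrightarrow> (\<And>y. y \<in> W \<Longrightarrow> \<rho> y > 0) \<Longrightarrow> smooth_on W (\<lambda>x. fluid_rate P G a t u \<rho> S x ws)"
    and closed_rate: "\<And>t W u \<rho> S y vs. open W \<Longrightarrow> W \<subseteq> Y \<Longrightarrow> smooth_on W u \<Longrightarrow> smooth_on W \<rho> \<Longrightarrow>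
      smooth_on W S \<Longrightarrow> (\<And>y. y \<in> W \<Longrightarrow> \<rho> y > 0) \<Longrightarrow> y \<in> W \<Longrightarrow> ext_deriv (fluid_rate P G a t u \<rho> S) y vs = 0"
begin

definition Om :: "'n phase set" where "Om = UNIV \<times> Y \<times> UNIV \<times> {0<..} \<times> UNIV"

definition af :: "(real^'n) list \<Rightarrow> 'n phase \<Rightarrow> real" where
  "af ws = (\<lambda>(t, y, u, \<rho>, S). a t y u \<rho> S ws)"

definition Da :: "(real^'n) list \<Rightarrow> 'n phase \<Rightarrow> 'n phase \<Rightarrow> real" where
  "Da ws Z = frechet_derivative (af ws) (at Z)"

text \<open>The terms of \<open>fluid_rate\<close>: \<open>rate0\<close> collects what does not involve spatial derivatives of the
  fields, and a pressure gradient \<open>P\<^sub>\<rho> \<zeta>\<close> or \<open>P\<^sub>S \<zeta>\<close> contributes \<open>- Pr * Bf \<zeta>\<close> or \<open>- Ps * Bf \<zeta>\<close>.\<close>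

definition rate0 :: "(real^'n) list \<Rightarrow> 'n phase \<Rightarrow> real" where
  "rate0 ws Z = Da ws Z (1, fst (snd (snd Z)), - christoffel_sq G (fst (snd Z)) (fst (snd (snd Z))),
     - fst (snd (snd (snd Z))) * christoffel_tr G (fst (snd Z)) (fst (snd (snd Z))), 0)"

definition Bf :: "real^'n \<Rightarrow> (real^'n) list \<Rightarrow> 'n phase \<Rightarrow> real" where
  "Bf \<zeta> ws Z = Da ws Z (0, 0, matrix_inv (G (fst (snd Z))) *v \<zeta>, 0, 0)"

definition DP :: "real \<Rightarrow> real \<Rightarrow> real \<times> real \<Rightarrow> real" where
  "DP \<rho> S = frechet_derivative (\<lambda>(\<rho>, S). P \<rho> S) (at (\<rho>, S))"

text \<open>The factor 1/\<rho> of the pressure force is absorbed here: P_\<rho>/\<rho>, and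
  likewise P_S/\<rho> in \<open>Ps\<close>.\<close>

definition Pr :: "'n phase \<Rightarrow> real" where
  "Pr Z = inverse (fst (snd (snd (snd Z)))) * DP (fst (snd (snd (snd Z)))) (snd (snd (snd (snd Z)))) (1, 0)"

definition Ps :: "'n phase \<Rightarrow> real" where
  "Ps Z = inverse (fst (snd (snd (snd Z)))) * DP (fst (snd (snd (snd Z)))) (snd (snd (snd (snd Z)))) (0, 1)"

lemma open_Om: "open Om" unfolding Om_def by (intro open_Times open_Y) auto

lemma OmI: "y \<in> Y \<Longrightarrow> \<rho> > 0 \<Longrightarrow> (t, y, u, \<rho>, S) \<in> Om" by (simp add: Om_def)

lemma smooth_af: "smooth_on Om (af ws)" unfolding Om_def af_def by (rule smooth_a')

lemma smooth_proj:
  "smooth_on Om (\<lambda>Z. fst (snd Z))" "smooth_on Om (\<lambda>Z. fst (snd (snd Z)))"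
  "smooth_on Om (\<lambda>Z. fst (snd (snd (snd Z))))"
  by (intro smooth_on_fst smooth_on_snd smooth_on_ident open_Om)+

lemma smooth_of_pos:
  assumes "smooth_on Y f"
  shows "smooth_on Om (\<lambda>Z. f (fst (snd Z)))"
proof (rule smooth_on_compose_bounded_linear[OF assms _ open_Om open_Y])
  show "bounded_linear (\<lambda>Z :: 'n phase. fst (snd Z))"
    by (intro bounded_linear_fst_comp bounded_linear_snd)
qed (auto simp: Om_def)

lemma smooth_rate0: "smooth_on Om (rate0 ws)"
  unfolding rate0_def[abs_def] Da_def christoffel_sq_def christoffel_tr_def
  by (intro smooth_on_frechet_along smooth_af smooth_on_Pair smooth_on_const smooth_proj smooth_on_minus
      smooth_on_vec_lambda smooth_on_sum smooth_on_mult smooth_on_nth smooth_of_pos smooth_christoffel open_Om)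

lemma smooth_Bf: "smooth_on Om (Bf \<zeta> ws)"
proof -
  have "smooth_on Y (\<lambda>y. matrix_inv (G y) *v \<zeta>)"
    unfolding matrix_vector_mult_def
    by (intro smooth_on_vec_lambda smooth_on_sum smooth_on_mult smooth_on_const smooth_on_matrix_inv
        smooth_G open_Y invertible_G)
  from smooth_of_pos[OF this] show ?thesis
    unfolding Bf_def[abs_def] Da_def
    by (intro smooth_on_frechet_along smooth_af smooth_on_Pair smooth_on_const open_Om)
qed

lemma smooth_DP: "smooth_on Om (\<lambda>Z. DP (fst (snd (snd (snd Z)))) (snd (snd (snd (snd Z)))) v)"
proof -
  have o: "open ({0::real<..} \<times> (UNIV :: real set))" by (intro open_Times) auto
  have "bounded_linear (\<lambda>Z :: 'n phase. snd (snd (snd Z)))"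
    by (intro bounded_linear_snd_comp bounded_linear_snd)
  moreover have "(\<lambda>Z :: 'n phase. snd (snd (snd Z))) ` Om \<subseteq> {0<..} \<times> UNIV" by (auto simp: Om_def)
  ultimately have "smooth_on Om (\<lambda>Z. frechet_derivative (\<lambda>(\<rho>, S). P \<rho> S) (at (snd (snd (snd Z)))) v)"
    by (intro smooth_on_compose_bounded_linear[OF smooth_on_frechet[OF smooth_P]] open_Om o)
  then show ?thesis by (simp add: DP_def)
qed

lemma smooth_Pr: "smooth_on Om Pr" and smooth_Ps: "smooth_on Om Ps"
  unfolding Pr_def[abs_def] Ps_def[abs_def]
  by (intro smooth_on_mult smooth_on_inverse smooth_DP smooth_proj open_Om; auto simp: Om_def)+

lemma linear_Da: "Z \<in> Om \<Longrightarrow> linear (Da ws Z)"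
  unfolding Da_def using linear_frechet_derivative smooth_on_differentiable smooth_af by blast

lemma linear_Bf:
  assumes "Z \<in> Om"
  shows "linear (\<lambda>\<zeta>. Bf \<zeta> ws Z)"
proof -
  let ?M = "matrix_inv (G (fst (snd Z)))"
  have "(0, 0, ?M *v (x + y), 0, 0) = ((0, 0, ?M *v x, 0, 0) :: 'n phase) + (0, 0, ?M *v y, 0, 0)"
    "(0, 0, ?M *v (r *\<^sub>R x), 0, 0) = r *\<^sub>R ((0, 0, ?M *v x, 0, 0) :: 'n phase)" for x y r
    by (simp_all add: matrix_vector_right_distrib scaleR_matrix_vector_assoc matrix_vector_mult_scaleR)
  then show ?thesis
    unfolding Bf_def by (intro linearI) (simp_all only: linear_add[OF linear_Da[OF assms]] linear_scale[OF linear_Da[OF assms]])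
qed

lemma smooth_density_partial: "smooth_on Om (\<lambda>Z. Da ws Z v)"
  unfolding Da_def by (rule smooth_on_frechet[OF smooth_af])

text \<open>\<open>q\<close> and \<open>q'\<close> are covectors, the coordinate partial derivatives
  of density and entropy; the chain rule combines them before the index is raised.\<close>

lemma grad_pressure:
  assumes "\<rho> x > 0" and \<rho>: "(\<rho> has_derivative (\<lambda>v. q \<bullet> v)) (at x)" and S: "(S has_derivative (\<lambda>v. q' \<bullet> v)) (at x)"
  shows "grad G (\<lambda>x. P (\<rho> x) (S x)) x
    = matrix_inv (G x) *v (DP (\<rho> x) (S x) (1, 0) *\<^sub>R q + DP (\<rho> x) (S x) (0, 1) *\<^sub>R q')"
proof -
  have P: "((\<lambda>(\<rho>, S). P \<rho> S) has_derivative DP (\<rho> x) (S x)) (at (\<rho> x, S x))"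
    unfolding DP_def by (rule smooth_on_has_derivative[OF smooth_P]) (use assms in auto)
  from has_derivative_compose[OF has_derivative_Pair[OF \<rho> S] P]
  have der: "((\<lambda>x. P (\<rho> x) (S x)) has_derivative (\<lambda>v. DP (\<rho> x) (S x) (q \<bullet> v, q' \<bullet> v))) (at x)" by simp
  have lin: "DP (\<rho> x) (S x) (c, d) = c * DP (\<rho> x) (S x) (1, 0) + d * DP (\<rho> x) (S x) (0, 1)" for c d
  proof -
    have L: "linear (DP (\<rho> x) (S x))" using P has_derivative_linear by blast
    have "DP (\<rho> x) (S x) (c, d) = DP (\<rho> x) (S x) (c *\<^sub>R (1, 0) + d *\<^sub>R (0, 1))" by simp
    also have "\<dots> = DP (\<rho> x) (S x) (c *\<^sub>R (1, 0)) + DP (\<rho> x) (S x) (d *\<^sub>R (0, 1))" by (rule linear_add[OF L])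
    also have "\<dots> = c * DP (\<rho> x) (S x) (1, 0) + d * DP (\<rho> x) (S x) (0, 1)"
      unfolding linear_scale[OF L] real_scaleR_def ..
    finally show ?thesis .
  qed
  have "(\<chi> j. pd j (\<lambda>x. P (\<rho> x) (S x)) x) = DP (\<rho> x) (S x) (1, 0) *\<^sub>R q + DP (\<rho> x) (S x) (0, 1) *\<^sub>R q'"
    by (simp add: vec_eq_iff pd_eq[OF der] inner_axis lin[of "q $ j" "q' $ j" for j] mult.commute)
  then show ?thesis unfolding grad_def by (rule arg_cong)
qed

text \<open>Linearity of \<open>Da\<close> separates the contributions of the individual first
  derivatives. Test fields are inserted into this normal form.\<close>

lemma rate_eq:
  fixes t :: real
  assumes x: "x \<in> Y" "\<rho> x > 0" and u: "(u has_derivative u') (at x)"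
    and \<rho>: "(\<rho> has_derivative (\<lambda>v. q \<bullet> v)) (at x)" and S: "(S has_derivative (\<lambda>v. q' \<bullet> v)) (at x)"
  defines "Z \<equiv> (t, x, u x, \<rho> x, S x)"
  shows "fluid_rate P G a t u \<rho> S x ws = rate0 ws Z - Pr Z * Bf q ws Z - Ps Z * Bf q' ws Z
    - \<rho> x * (\<Sum>i\<in>UNIV. u' (axis i 1) $ i) * Da ws Z (0, 0, 0, 1, 0)
    + (\<Sum>i<length ws. (-1)^i * af (u' (ws ! i) # drop_nth i ws) Z)"
proof -
  have Z: "Z \<in> Om" using x by (simp add: Z_def OmI)
  note L = linear_Da[OF Z, of ws]
  let ?M = "matrix_inv (G x)" and ?tr = "\<Sum>i\<in>UNIV. u' (axis i 1) $ i"
  have "(1, u x, - christoffel_sq G x (u x) - (1 / \<rho> x) *\<^sub>R (?M *v (DP (\<rho> x) (S x) (1, 0) *\<^sub>R q + DP (\<rho> x) (S x) (0, 1) *\<^sub>R q')),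
        - \<rho> x * (?tr + christoffel_tr G x (u x)), 0)
     = (1, u x, - christoffel_sq G x (u x), - \<rho> x * christoffel_tr G x (u x), 0)
       - Pr Z *\<^sub>R (0, 0, ?M *v q, 0, 0) - Ps Z *\<^sub>R (0, 0, ?M *v q', 0, 0) - (\<rho> x * ?tr) *\<^sub>R ((0, 0, 0, 1, 0) :: 'n phase)"
    by (simp add: Z_def Pr_def Ps_def matrix_vector_right_distrib matrix_vector_mult_scaleR algebra_simps inverse_eq_divide)
  then have "Da ws Z (1, u x, - christoffel_sq G x (u x) - (1 / \<rho> x) *\<^sub>R grad G (\<lambda>x. P (\<rho> x) (S x)) x,
        - \<rho> x * (?tr + christoffel_tr G x (u x)), 0)
      = rate0 ws Z - Pr Z * Bf q ws Z - Ps Z * Bf q' ws Z - \<rho> x * ?tr * Da ws Z (0, 0, 0, 1, 0)"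
    unfolding grad_pressure[OF x(2) \<rho> S]
    by (simp only: linear_diff[OF L] linear_scale[OF L] rate0_def Bf_def real_scaleR_def) (simp add: Z_def)
  then show ?thesis
    unfolding fluid_rate_def frechet_derivative_eq[OF u] Da_def af_def Z_def by simp
qed

end

lemma smooth_on_inner_offset: "open U \<Longrightarrow> smooth_on U (\<lambda>x. \<xi> \<bullet> (x - y0))"
  by (intro smooth_on_inner smooth_on_const smooth_on_diff smooth_on_ident)

section \<open>Plane waves as test fields\<close>

context closed_rate begin

lemma af_zero:
  assumes "Z \<in> Om"
  shows "af (0 # ws) Z = 0"
  using assms alt_form_Cons_zero[OF alt_a] by (auto simp: Om_def af_def)

lemma linear_frechet: "smooth_on Om \<Phi> \<Longrightarrow> Z \<in> Om \<Longrightarrow> linear (frechet_derivative \<Phi> (at Z))"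
  by (rule linear_frechet_derivative[OF smooth_on_differentiable])

text \<open>With \<open>\<xi>\<close> orthogonal to all of \<open>vs\<close>, the second derivatives of the fields enter \<open>d E (\<xi>, vs) = 0\<close> only
  through the derivative of \<open>E vs\<close> along \<open>\<xi>\<close>; subtracting the identity for constant fields leaves
  these terms.\<close>

lemma quadratic_wave:
  fixes t s :: real and ua :: "real^'n"
  assumes y0: "y0 \<in> Y" and r: "r > 0" and \<xi>: "\<xi> \<bullet> \<xi> = 1" "\<And>v. v \<in> set vs \<Longrightarrow> \<xi> \<bullet> v = 0"
  defines "Z0 \<equiv> (t, y0, ua, r, s)"
  shows "(b * Pr Z0 + c * Ps Z0) * Bf \<xi> vs Z0 + r * (\<xi> \<bullet> w) * Da vs Z0 (0, 0, 0, 1, 0) = 0"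
proof -
  have key: "frechet_derivative (rate0 vs) (at Z0) (0, \<xi>, 0, 0, 0)
      - ((b * Pr Z0 + c * Ps Z0) * Bf \<xi> vs Z0 + r * (\<xi> \<bullet> w) * Da vs Z0 (0, 0, 0, 1, 0))
      - (\<Sum>i<length vs. (-1)^i * frechet_derivative (rate0 (\<xi> # drop_nth i vs)) (at Z0) (0, vs ! i, 0, 0, 0)) = 0"
    for b c w
  proof -
    let ?\<tau> = "\<lambda>x. \<xi> \<bullet> (x - y0)"
    \<comment> \<open>All fields are quadratic in the phase \<open>?\<tau>\<close>: their gradients
      vanish at \<open>y0\<close>, and the factor 1/2 makes the second derivative along
      \<open>\<xi>\<close> equal to the amplitude.\<close>
    define u where "u x = ua + (?\<tau> x * ?\<tau> x / 2) *\<^sub>R w" for x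
    define \<rho> where "\<rho> x = r + b * (?\<tau> x * ?\<tau> x / 2)" for x
    define S where "S x = s + c * (?\<tau> x * ?\<tau> x / 2)" for x
    define W where "W = {x \<in> Y. \<rho> x > 0}"
    have sm\<tau>: "smooth_on U (\<lambda>x. ?\<tau> x * ?\<tau> x / 2)" if "open U" for U
      using smooth_on_mult[OF that smooth_on_mult[OF that smooth_on_inner_offset[OF that] smooth_on_inner_offset[OF that]]
          smooth_on_const[OF that, of "1/2"]] by simp
    have "open W"
    proof -
      have "open (Y \<inter> \<rho> -` {0<..})"
        by (rule continuous_open_preimage[OF _ open_Y]) (auto simp: \<rho>_def intro!: continuous_intros)
      then show ?thesis by (simp add: W_def Int_def)
    qed
    moreover have sm: "smooth_on W u" "smooth_on W \<rho>" "smooth_on W S"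
      unfolding u_def \<rho>_def S_def
      by (intro smooth_on_add smooth_on_scaleR smooth_on_mult smooth_on_const sm\<tau> \<open>open W\<close>)+
    ultimately have W: "open W" "W \<subseteq> Y" "smooth_on W u" "smooth_on W \<rho>" "smooth_on W S"
      "\<And>y. y \<in> W \<Longrightarrow> \<rho> y > 0" "y0 \<in> W"
      using y0 r by (auto simp: W_def \<rho>_def)
    have d\<tau>: "((\<lambda>x. ?\<tau> x * ?\<tau> x / 2) has_derivative (\<lambda>v. ?\<tau> x * (\<xi> \<bullet> v))) (at x)" for x
      by (auto intro!: derivative_eq_intros simp: fun_eq_iff field_simps)
    have du: "(u has_derivative (\<lambda>v. (?\<tau> x * (\<xi> \<bullet> v)) *\<^sub>R w)) (at x)" for x
      unfolding u_def using d\<tau>[of x] by (auto intro!: derivative_eq_intros)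
    have d\<rho>: "(\<rho> has_derivative (\<lambda>v. ((b * ?\<tau> x) *\<^sub>R \<xi>) \<bullet> v)) (at x)" for x
      unfolding \<rho>_def using d\<tau>[of x] by (auto intro!: derivative_eq_intros)
    have dS: "(S has_derivative (\<lambda>v. ((c * ?\<tau> x) *\<^sub>R \<xi>) \<bullet> v)) (at x)" for x
      unfolding S_def using d\<tau>[of x] by (auto intro!: derivative_eq_intros)
    let ?Z = "\<lambda>x. (t, x, u x, \<rho> x, S x)"
    have Zin: "?Z x \<in> Om" if "x \<in> W" for x using W(2,6) that by (auto intro: OmI)
    have Z0: "Z0 \<in> Om" "?Z y0 = Z0" using Zin[OF W(7)] by (auto simp: Z0_def u_def \<rho>_def S_def)
    have tr: "(\<Sum>i\<in>UNIV. ((?\<tau> x * (\<xi> \<bullet> axis i 1)) *\<^sub>R w) $ i) = ?\<tau> x * (\<xi> \<bullet> w)" for x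
      using inner_vec_def[of \<xi> w] by (simp add: inner_axis sum_distrib_left mult.assoc)
    have rate: "fluid_rate P G a t u \<rho> S x ws = rate0 ws (?Z x) - ?\<tau> x * ((b * Pr (?Z x) + c * Ps (?Z x)) * Bf \<xi> ws (?Z x)
        + \<rho> x * (\<xi> \<bullet> w) * Da ws (?Z x) (0, 0, 0, 1, 0))
        + (\<Sum>i<length ws. (-1)^i * af (((?\<tau> x * (\<xi> \<bullet> ws ! i)) *\<^sub>R w) # drop_nth i ws) (?Z x))"
      if x: "x \<in> W" for x ws
    proof -
      have "x \<in> Y" "\<rho> x > 0" using W x by auto
      from rate_eq[OF this du d\<rho> dS, of t ws] show ?thesis
        unfolding tr linear_scale[OF linear_Bf[OF Zin[OF x]]] by (simp add: algebra_simps)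
    qed
    \<comment> \<open>Along \<open>\<xi>\<close> the phase equals the line parameter, so
      differentiating its product with \<open>?K\<close> at 0 returns the value of \<open>?K\<close>
      at \<open>Z0\<close>. The remaining part does not see the amplitudes to first order.\<close>
    have 1: "frechet_derivative (\<lambda>x. fluid_rate P G a t u \<rho> S x vs) (at y0) \<xi> =
        frechet_derivative (rate0 vs) (at Z0) (0, \<xi>, 0, 0, 0)
        - ((b * Pr Z0 + c * Ps Z0) * Bf \<xi> vs Z0 + r * (\<xi> \<bullet> w) * Da vs Z0 (0, 0, 0, 1, 0))"
    proof (rule frechet_derivative_line[OF W(1,7)])
      show "smooth_on W (\<lambda>x. fluid_rate P G a t u \<rho> S x vs)" by (rule smooth_rate[OF W(1-6)])
      let ?C = "\<lambda>\<theta>. ?Z (y0 + \<theta> *\<^sub>R \<xi>)"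
      let ?K = "\<lambda>Z. (b * Pr Z + c * Ps Z) * Bf \<xi> vs Z + fst (snd (snd (snd Z))) * (\<xi> \<bullet> w) * Da vs Z (0, 0, 0, 1, 0)"
      show "fluid_rate P G a t u \<rho> S (y0 + \<theta> *\<^sub>R \<xi>) vs = rate0 vs (?C \<theta>) - \<theta> * ?K (?C \<theta>)"
        if "y0 + \<theta> *\<^sub>R \<xi> \<in> W" for \<theta>
        unfolding rate[OF that] using \<xi> by (simp add: af_zero[OF Zin[OF that]])
      have C: "(?C has_vector_derivative (0, \<xi>, 0, 0, 0)) (at 0)"
        unfolding u_def \<rho>_def S_def
        by (auto intro!: derivative_eq_intros has_vector_derivative_Pair simp: zero_prod_def)
      have "smooth_on Om ?K"
        by (intro smooth_on_add smooth_on_mult smooth_on_const smooth_Pr smooth_Ps smooth_Bf smooth_proj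
            smooth_density_partial open_Om)
      from smooth_on_curve[OF this, where Z="?C"] smooth_on_curve[OF smooth_rate0[of vs], where Z="?C"] C Z0
      have "((\<lambda>\<theta>. ?K (?C \<theta>)) has_real_derivative frechet_derivative ?K (at Z0) (0, \<xi>, 0, 0, 0)) (at 0)"
        "((\<lambda>\<theta>. rate0 vs (?C \<theta>)) has_real_derivative frechet_derivative (rate0 vs) (at Z0) (0, \<xi>, 0, 0, 0)) (at 0)"
        by simp_all
      from DERIV_diff[OF this(2) DERIV_mult[OF DERIV_ident this(1)]] Z0(2)
      show "((\<lambda>\<theta>. rate0 vs (?C \<theta>) - \<theta> * ?K (?C \<theta>)) has_real_derivative
          frechet_derivative (rate0 vs) (at Z0) (0, \<xi>, 0, 0, 0)
          - ((b * Pr Z0 + c * Ps Z0) * Bf \<xi> vs Z0 + r * (\<xi> \<bullet> w) * Da vs Z0 (0, 0, 0, 1, 0))) (at 0)"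
        by (simp add: Z0_def)
    qed
    \<comment> \<open>Orthogonally to \<open>\<xi>\<close> the phase stays zero: along such a line
      the fields are constant and all their first derivatives vanish.\<close>
    have 2: "frechet_derivative (\<lambda>x. fluid_rate P G a t u \<rho> S x ws) (at y0) v =
        frechet_derivative (rate0 ws) (at Z0) (0, v, 0, 0, 0)" if v: "\<xi> \<bullet> v = 0" for v ws
    proof (rule frechet_derivative_line[OF W(1,7)])
      show "smooth_on W (\<lambda>x. fluid_rate P G a t u \<rho> S x ws)" by (rule smooth_rate[OF W(1-6)])
      let ?C = "\<lambda>\<theta>. ?Z (y0 + \<theta> *\<^sub>R v)"
      show "fluid_rate P G a t u \<rho> S (y0 + \<theta> *\<^sub>R v) ws = rate0 ws (?C \<theta>)"
        if "y0 + \<theta> *\<^sub>R v \<in> W" for \<theta>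
        unfolding rate[OF that] using v by (simp add: af_zero[OF Zin[OF that]])
      have C: "(?C has_vector_derivative (0, v, 0, 0, 0)) (at 0)"
        unfolding u_def \<rho>_def S_def using v
        by (auto intro!: derivative_eq_intros has_vector_derivative_Pair simp: zero_prod_def)
      from smooth_on_curve[OF smooth_rate0[of ws], where Z="?C"] C Z0
      show "((\<lambda>\<theta>. rate0 ws (?C \<theta>)) has_real_derivative frechet_derivative (rate0 ws) (at Z0) (0, v, 0, 0, 0)) (at 0)"
        by simp
    qed
    show ?thesis
      using closed_rate[OF W(1-6) W(7), of t "\<xi> # vs"] \<xi>(2) unfolding ext_deriv_Cons 1
      by (simp add: 2)
  qed
  from key[of b c w] key[of 0 0 0] show ?thesis by simp
qed

lemma frechet_af_zero:
  assumes "Z \<in> Om"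
  shows "frechet_derivative (af (0 # ws)) (at Z) v = 0"
proof -
  have "(af (0 # ws) has_derivative (\<lambda>v. 0)) (at Z)"
    by (rule has_derivative_transform_within_open[OF has_derivative_const[of 0] open_Om assms]) (simp add: af_zero)
  from frechet_derivative_eq[OF this] show ?thesis by simp
qed

text \<open>Two crossing waves: the one along \<open>\<xi>\<close> carries the velocity amplitude
  \<open>w\<close> and the density slope \<open>b\<close>, the one along \<open>\<eta>\<close>
  carries \<open>w'\<close> and the entropy slope \<open>c\<close>. The field gradients are
  constant, so differentiating the rate along \<open>v\<close> at \<open>y0\<close> is
  differentiating in phase space along \<open>Z' v\<close>. By \<open>no_rho\<close> the compression
  term is absent.\<close>

lemma linear_wave_direction:
  fixes t s b c :: real and ua w w' \<xi> \<eta> :: "real^'n"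
  assumes no_rho: "\<And>Z ws. Z \<in> Om \<Longrightarrow> Da ws Z (0, 0, 0, 1, 0) = 0"
    and y0: "y0 \<in> Y" and r: "r > 0"
  defines "Z0 \<equiv> (t, y0, ua, r, s)"
    and "Z' \<equiv> \<lambda>v. (0, v, (\<xi> \<bullet> v) *\<^sub>R w + (\<eta> \<bullet> v) *\<^sub>R w', b * (\<xi> \<bullet> v), c * (\<eta> \<bullet> v))"
  obtains R :: "real^'n \<Rightarrow> 'n form" where "\<And>vs. ext_deriv R y0 vs = 0"
    "\<And>ws v. frechet_derivative (\<lambda>x. R x ws) (at y0) v =
       frechet_derivative (rate0 ws) (at Z0) (Z' v)
       - b * frechet_derivative (\<lambda>Z. Pr Z * Bf \<xi> ws Z) (at Z0) (Z' v)
       - c * frechet_derivative (\<lambda>Z. Ps Z * Bf \<eta> ws Z) (at Z0) (Z' v)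
       + (\<Sum>i<length ws. (-1)^i * frechet_derivative
           (af (((\<xi> \<bullet> ws ! i) *\<^sub>R w + (\<eta> \<bullet> ws ! i) *\<^sub>R w') # drop_nth i ws)) (at Z0) (Z' v))"
proof -
  let ?\<tau> = "\<lambda>x. \<xi> \<bullet> (x - y0)" and ?\<sigma> = "\<lambda>x. \<eta> \<bullet> (x - y0)"
  define u where "u x = ua + (?\<tau> x *\<^sub>R w + ?\<sigma> x *\<^sub>R w')" for x
  define \<rho> where "\<rho> x = r + b * ?\<tau> x" for x
  define S where "S x = s + c * ?\<sigma> x" for x
  define W where "W = {x \<in> Y. \<rho> x > 0}"
  have "open W"
  proof -
    have "open (Y \<inter> \<rho> -` {0<..})"
      by (rule continuous_open_preimage[OF _ open_Y]) (auto simp: \<rho>_def intro!: continuous_intros)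
    then show ?thesis by (simp add: W_def Int_def)
  qed
  moreover have sm: "smooth_on W u" "smooth_on W \<rho>" "smooth_on W S"
    unfolding u_def \<rho>_def S_def
    by (intro smooth_on_add smooth_on_scaleR smooth_on_mult smooth_on_const smooth_on_inner_offset \<open>open W\<close>)+
  ultimately have W: "open W" "W \<subseteq> Y" "smooth_on W u" "smooth_on W \<rho>" "smooth_on W S"
    "\<And>y. y \<in> W \<Longrightarrow> \<rho> y > 0" "y0 \<in> W"
    using y0 r by (auto simp: W_def \<rho>_def)
  have du: "(u has_derivative (\<lambda>v. (\<xi> \<bullet> v) *\<^sub>R w + (\<eta> \<bullet> v) *\<^sub>R w')) (at x)" for x
    unfolding u_def by (auto intro!: derivative_eq_intros)
  have d\<rho>: "(\<rho> has_derivative (\<lambda>v. (b *\<^sub>R \<xi>) \<bullet> v)) (at x)" for x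
    unfolding \<rho>_def by (auto intro!: derivative_eq_intros)
  have dS: "(S has_derivative (\<lambda>v. (c *\<^sub>R \<eta>) \<bullet> v)) (at x)" for x
    unfolding S_def by (auto intro!: derivative_eq_intros)
  let ?Z = "\<lambda>x. (t, x, u x, \<rho> x, S x)"
  have Zin: "?Z x \<in> Om" if "x \<in> W" for x using W(2,6) that by (auto intro: OmI)
  have Z0: "Z0 \<in> Om" "?Z y0 = Z0" using Zin[OF W(7)] by (auto simp: Z0_def u_def \<rho>_def S_def)
  let ?L = "\<lambda>v. (\<xi> \<bullet> v) *\<^sub>R w + (\<eta> \<bullet> v) *\<^sub>R w'"
  have rate: "fluid_rate P G a t u \<rho> S x ws = rate0 ws (?Z x) - b * (Pr (?Z x) * Bf \<xi> ws (?Z x))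
      - c * (Ps (?Z x) * Bf \<eta> ws (?Z x))
      + (\<Sum>i<length ws. (-1)^i * af (?L (ws ! i) # drop_nth i ws) (?Z x))"
    if x: "x \<in> W" for x ws
  proof -
    have "x \<in> Y" "\<rho> x > 0" using W x by auto
    from rate_eq[OF this du d\<rho> dS, of t ws] show ?thesis
      unfolding linear_scale[OF linear_Bf[OF Zin[OF x]]] no_rho[OF Zin[OF x]] by (simp add: algebra_simps)
  qed
  show thesis
  proof (rule that[of "fluid_rate P G a t u \<rho> S"])
    show "ext_deriv (fluid_rate P G a t u \<rho> S) y0 vs = 0" for vs
      by (rule closed_rate[OF W(1-7)])
    fix ws v
    show "frechet_derivative (\<lambda>x. fluid_rate P G a t u \<rho> S x ws) (at y0) v =
       frechet_derivative (rate0 ws) (at Z0) (Z' v)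
       - b * frechet_derivative (\<lambda>Z. Pr Z * Bf \<xi> ws Z) (at Z0) (Z' v)
       - c * frechet_derivative (\<lambda>Z. Ps Z * Bf \<eta> ws Z) (at Z0) (Z' v)
       + (\<Sum>i<length ws. (-1)^i * frechet_derivative (af (?L (ws ! i) # drop_nth i ws)) (at Z0) (Z' v))"
    proof (rule frechet_derivative_line[OF W(1,7)])
      show "smooth_on W (\<lambda>x. fluid_rate P G a t u \<rho> S x ws)" by (rule smooth_rate[OF W(1-6)])
      let ?C = "\<lambda>\<theta>. ?Z (y0 + \<theta> *\<^sub>R v)"
      show "fluid_rate P G a t u \<rho> S (y0 + \<theta> *\<^sub>R v) ws = rate0 ws (?C \<theta>) - b * (Pr (?C \<theta>) * Bf \<xi> ws (?C \<theta>))
          - c * (Ps (?C \<theta>) * Bf \<eta> ws (?C \<theta>))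
          + (\<Sum>i<length ws. (-1)^i * af (?L (ws ! i) # drop_nth i ws) (?C \<theta>))"
        if "y0 + \<theta> *\<^sub>R v \<in> W" for \<theta>
        by (rule rate[OF that])
      have C: "(?C has_vector_derivative Z' v) (at 0)"
        unfolding u_def \<rho>_def S_def Z'_def
        by (auto intro!: derivative_eq_intros has_vector_derivative_Pair simp: zero_prod_def)
      have curve: "((\<lambda>\<theta>. \<Phi> (?C \<theta>)) has_real_derivative frechet_derivative \<Phi> (at Z0) (Z' v)) (at 0)"
        if "smooth_on Om \<Phi>" for \<Phi>
        using smooth_on_curve[OF that, where Z="?C"] C Z0 by simp
      show "((\<lambda>\<theta>. rate0 ws (?C \<theta>) - b * (Pr (?C \<theta>) * Bf \<xi> ws (?C \<theta>)) - c * (Ps (?C \<theta>) * Bf \<eta> ws (?C \<theta>))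
          + (\<Sum>i<length ws. (-1)^i * af (?L (ws ! i) # drop_nth i ws) (?C \<theta>))) has_real_derivative
         frechet_derivative (rate0 ws) (at Z0) (Z' v)
         - b * frechet_derivative (\<lambda>Z. Pr Z * Bf \<xi> ws Z) (at Z0) (Z' v)
         - c * frechet_derivative (\<lambda>Z. Ps Z * Bf \<eta> ws Z) (at Z0) (Z' v)
         + (\<Sum>i<length ws. (-1)^i * frechet_derivative (af (?L (ws ! i) # drop_nth i ws)) (at Z0) (Z' v))) (at 0)"
        by (intro DERIV_add DERIV_diff DERIV_cmult DERIV_sum curve smooth_rate0 smooth_af
            smooth_on_mult smooth_Pr smooth_Ps smooth_Bf open_Om)
    qed
  qed
qed

text \<open>Closedness evaluated on \<open>\<xi>\<close>, \<open>\<eta>\<close> and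
  \<open>vs\<close>, where orthonormality kills most amplitudes. The result is polynomial in
  \<open>w\<close>, \<open>w'\<close>, \<open>b\<close>, \<open>c\<close>, and single coefficients
  of it are extracted below.\<close>

lemma linear_wave:
  fixes t s b c :: real and ua w w' \<xi> \<eta> :: "real^'n"
  assumes no_rho: "\<And>Z ws. Z \<in> Om \<Longrightarrow> Da ws Z (0, 0, 0, 1, 0) = 0"
    and y0: "y0 \<in> Y" and r: "r > 0"
    and on: "\<xi> \<bullet> \<xi> = 1" "\<eta> \<bullet> \<eta> = 1" "\<xi> \<bullet> \<eta> = 0"
    and vs: "\<And>v. v \<in> set vs \<Longrightarrow> \<xi> \<bullet> v = 0" "\<And>v. v \<in> set vs \<Longrightarrow> \<eta> \<bullet> v = 0"
  defines "Z0 \<equiv> (t, y0, ua, r, s)"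
  defines "X \<equiv> \<lambda>b c ws Z'. frechet_derivative (rate0 ws) (at Z0) Z'
       - b * frechet_derivative (\<lambda>Z. Pr Z * Bf \<xi> ws Z) (at Z0) Z'
       - c * frechet_derivative (\<lambda>Z. Ps Z * Bf \<eta> ws Z) (at Z0) Z'"
  shows "X b c (\<eta> # vs) (0, \<xi>, w, b, 0) + Da (w' # vs) Z0 (0, \<xi>, w, b, 0)
    - X b c (\<xi> # vs) (0, \<eta>, w', 0, c) - Da (w # vs) Z0 (0, \<eta>, w', 0, c)
    + (\<Sum>i<length vs. (-1)^i * X b c (\<xi> # \<eta> # drop_nth i vs) (0, vs ! i, 0, 0, 0))
    + (\<Sum>i<length vs. (-1)^i * Da (w # \<eta> # drop_nth i vs) Z0 (0, vs ! i, 0, 0, 0))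
    - (\<Sum>i<length vs. (-1)^i * Da (w' # \<xi> # drop_nth i vs) Z0 (0, vs ! i, 0, 0, 0)) = 0"
proof -
  have on': "\<eta> \<bullet> \<xi> = 0" using on(3) by (simp add: inner_commute)
  have Z0: "Z0 \<in> Om" using y0 r by (simp add: Z0_def OmI)
  obtain R :: "real^'n \<Rightarrow> 'n form" where R: "\<And>vs. ext_deriv R y0 vs = 0"
    "\<And>ws v. frechet_derivative (\<lambda>x. R x ws) (at y0) v =
       X b c ws (0, v, (\<xi> \<bullet> v) *\<^sub>R w + (\<eta> \<bullet> v) *\<^sub>R w', b * (\<xi> \<bullet> v), c * (\<eta> \<bullet> v))
       + (\<Sum>i<length ws. (-1)^i * Da
           (((\<xi> \<bullet> ws ! i) *\<^sub>R w + (\<eta> \<bullet> ws ! i) *\<^sub>R w') # drop_nth i ws) Z0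
           (0, v, (\<xi> \<bullet> v) *\<^sub>R w + (\<eta> \<bullet> v) *\<^sub>R w', b * (\<xi> \<bullet> v), c * (\<eta> \<bullet> v)))"
    unfolding X_def Z0_def Da_def using linear_wave_direction[OF no_rho y0 r] by blast
  have zero: "Da (0 # ws) Z0 v = 0" for ws v
    unfolding Da_def by (rule frechet_af_zero[OF Z0])
  have vs': "\<xi> \<bullet> vs ! i = 0" "\<eta> \<bullet> vs ! i = 0" if "i < length vs" for i using vs that by simp_all
  have dvs: "\<xi> \<bullet> drop_nth i vs ! j = 0" "\<eta> \<bullet> drop_nth i vs ! j = 0" if "j < length (drop_nth i vs)" for i j
  proof -
    have "drop_nth i vs ! j \<in> set (drop_nth i vs)" using that by (rule nth_mem)
    then have "drop_nth i vs ! j \<in> set vs" by (auto dest: in_set_takeD in_set_dropD)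
    then show "\<xi> \<bullet> drop_nth i vs ! j = 0" "\<eta> \<bullet> drop_nth i vs ! j = 0" using vs by blast+
  qed
  have 1: "frechet_derivative (\<lambda>x. R x (\<eta> # vs)) (at y0) \<xi>
      = X b c (\<eta> # vs) (0, \<xi>, w, b, 0) + Da (w' # vs) Z0 (0, \<xi>, w, b, 0)"
    unfolding R(2) list.size add_Suc_right add_0_right sum.lessThan_Suc_shift
    by (simp add: on on' vs' zero)
  have 2: "frechet_derivative (\<lambda>x. R x (\<xi> # vs)) (at y0) \<eta>
      = X b c (\<xi> # vs) (0, \<eta>, w', 0, c) + Da (w # vs) Z0 (0, \<eta>, w', 0, c)"
    unfolding R(2) list.size add_Suc_right add_0_right sum.lessThan_Suc_shift
    by (simp add: on on' vs' zero)
  have 3: "frechet_derivative (\<lambda>x. R x (\<xi> # \<eta> # drop_nth i vs)) (at y0) (vs ! i)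
      = X b c (\<xi> # \<eta> # drop_nth i vs) (0, vs ! i, 0, 0, 0) + Da (w # \<eta> # drop_nth i vs) Z0 (0, vs ! i, 0, 0, 0)
       - Da (w' # \<xi> # drop_nth i vs) Z0 (0, vs ! i, 0, 0, 0)" if "i < length vs" for i
    unfolding R(2) list.size(4) add_Suc_right add_0_right sum.lessThan_Suc_shift
    using dvs[of _ i] vs'[OF that] by (simp add: on on' zero del: length_append length_take length_drop)
  have "frechet_derivative (\<lambda>x. R x (\<eta> # vs)) (at y0) \<xi> - frechet_derivative (\<lambda>x. R x (\<xi> # vs)) (at y0) \<eta>
      + (\<Sum>i<length vs. (-1)^i * frechet_derivative (\<lambda>x. R x (\<xi> # \<eta> # drop_nth i vs)) (at y0) (vs ! i)) = 0"
    using R(1)[of "\<xi> # \<eta> # vs"]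
    unfolding ext_deriv_Cons[of _ _ \<xi>] list.size add_Suc_right add_0_right sum.lessThan_Suc_shift
    by (simp add: sum_negf)
  then show ?thesis unfolding 1 2 by (simp add: 3 algebra_simps sum.distrib sum_subtractf)
qed

end

section \<open>Dependence of the density on the fluid variables\<close>

text \<open>Fewer vectors than the dimension span a proper subspace.\<close>

lemma exists_unit_orthogonal:
  fixes vs :: "'a::euclidean_space list"
  assumes "length vs < DIM('a)"
  obtains \<xi> where "\<xi> \<bullet> \<xi> = 1" "\<And>v. v \<in> set vs \<Longrightarrow> \<xi> \<bullet> v = 0"
proof -
  have "dim (set vs) \<le> card (set vs)" by (rule dim_le_card) (auto intro: span_base)
  also have "\<dots> \<le> length vs" by (rule card_length)
  finally have "dim (set vs) < DIM('a)" using assms by simp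
  from orthogonal_to_subspace_exists[OF this] obtain x where
    x: "x \<noteq> 0" "\<And>y. y \<in> span (set vs) \<Longrightarrow> orthogonal x y" by blast
  show thesis
  proof (rule that[of "(1 / norm x) *\<^sub>R x"])
    show "((1 / norm x) *\<^sub>R x) \<bullet> ((1 / norm x) *\<^sub>R x) = 1"
      using x(1) by (simp add: dot_square_norm power2_eq_square)
    show "((1 / norm x) *\<^sub>R x) \<bullet> v = 0" if "v \<in> set vs" for v
      using x(2)[OF span_base[OF that]] by (simp add: orthogonal_def)
  qed
qed

text \<open>Polarisation: \<open>alt_form\<close> demands vanishing on repeated arguments, and
  expanding the value on two copies of \<open>x + y\<close> gives antisymmetry.\<close>

lemma alt_form_swap:
  assumes alt: "alt_form p \<omega>"
  shows "\<omega> (x # y # vs) = - \<omega> (y # x # vs)"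
proof (cases "Suc (Suc (length vs)) = p")
  case True
  then have p: "Suc (length vs) = p - 1" "alt_form (Suc (p - 1)) \<omega>" using alt by (cases p; simp)+
  have 0: "linear (\<lambda>w. \<omega> (w # z # vs))" for z
    using alt_form_linear_Cons[OF p(2), of "z # vs"] p(1) by simp
  have 1: "linear (\<lambda>w. \<omega> (z # w # vs))" for z
    using alt_form_linear[OF alt, of "z # 0 # vs" 1] True by simp
  have same: "\<omega> (z # z # vs) = 0" for z
  proof -
    have "\<forall>vs i j. length vs = p \<and> i < j \<and> j < p \<and> vs ! i = vs ! j \<longrightarrow> \<omega> vs = 0"
      using alt unfolding alt_form_def by (elim conjE)
    from this[rule_format, of "z # z # vs" 0 1] True show ?thesis by auto
  qed
  have "0 = \<omega> ((x + y) # (x + y) # vs)" by (simp only: same)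
  also have "\<dots> = \<omega> (x # x # vs) + \<omega> (x # y # vs) + (\<omega> (y # x # vs) + \<omega> (y # y # vs))"
    by (simp only: linear_add[OF 0] linear_add[OF 1])
  finally show ?thesis by (simp add: same)
next
  case False
  then show ?thesis using alt_form_length[OF alt] by simp
qed

context closed_rate begin

lemma Om_line:
  assumes "smooth_on Om \<Phi>" "Z + \<theta> *\<^sub>R \<zeta> \<in> Om"
  shows "((\<lambda>\<theta>. \<Phi> (Z + \<theta> *\<^sub>R \<zeta>) :: real) has_real_derivative frechet_derivative \<Phi> (at (Z + \<theta> *\<^sub>R \<zeta>)) \<zeta>) (at \<theta>)"
proof -
  have "((\<lambda>\<theta>. Z + \<theta> *\<^sub>R \<zeta>) has_derivative (\<lambda>r. r *\<^sub>R \<zeta>)) (at \<theta>)" by (auto intro!: derivative_eq_intros)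
  from has_derivative_compose[OF this smooth_on_has_derivative[OF assms]]
  show ?thesis unfolding linear_scale[OF linear_frechet[OF assms]]
    by (simp add: has_real_derivative_iff_has_vector_derivative has_vector_derivative_def)
qed

lemma frechet_of_line:
  assumes "smooth_on Om \<Phi>" "Z \<in> Om" "((\<lambda>\<theta>. \<Phi> (Z + \<theta> *\<^sub>R \<zeta>)) has_real_derivative d) (at 0)"
  shows "frechet_derivative \<Phi> (at Z) \<zeta> = (d :: real)"
  using Om_line[OF assms(1), of Z 0 \<zeta>] assms(2,3) DERIV_unique by fastforce

lemma const_line:
  assumes \<Phi>: "smooth_on Om \<Phi>" and Z: "\<And>\<theta>. 0 \<le> \<theta> \<Longrightarrow> \<theta> \<le> 1 \<Longrightarrow> Z + \<theta> *\<^sub>R \<zeta> \<in> Om"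
    and 0: "\<And>\<theta>. 0 \<le> \<theta> \<Longrightarrow> \<theta> \<le> 1 \<Longrightarrow> frechet_derivative \<Phi> (at (Z + \<theta> *\<^sub>R \<zeta>)) \<zeta> = (0 :: real)"
  shows "\<Phi> (Z + \<zeta>) = \<Phi> Z"
proof -
  have "((\<lambda>\<theta>. \<Phi> (Z + \<theta> *\<^sub>R \<zeta>)) has_real_derivative 0) (at \<theta>)" if "0 \<le> \<theta>" "\<theta> \<le> 1" for \<theta>
    using Om_line[OF \<Phi> Z[OF that]] 0[OF that] by simp
  from MVT2[of 0 1 "\<lambda>\<theta>. \<Phi> (Z + \<theta> *\<^sub>R \<zeta>)" "\<lambda>_. 0", OF _ this] show ?thesis by auto
qed

lemma frechet_eq_on_Om:
  assumes "smooth_on Om \<Psi>" "\<And>Z. Z \<in> Om \<Longrightarrow> \<Phi> Z = \<Psi> Z" "Z \<in> Om"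
  shows "frechet_derivative \<Phi> (at Z) = frechet_derivative \<Psi> (at Z)"
  by (rule frechet_derivative_eq, rule has_derivative_transform_within_open[OF
        smooth_on_has_derivative[OF assms(1,3)] open_Om assms(3)]) (simp add: assms(2))

lemma frechet_zero_on_Om:
  assumes "\<And>Z. Z \<in> Om \<Longrightarrow> \<Phi> Z = (0 :: real)" "Z \<in> Om"
  shows "frechet_derivative \<Phi> (at Z) v = 0"
  using frechet_eq_on_Om[OF smooth_on_const[OF open_Om], of \<Phi> 0 Z] assms by simp

lemma Da_length: "length ws \<noteq> p \<Longrightarrow> Z \<in> Om \<Longrightarrow> Da ws Z v = 0"
  unfolding Da_def using alt_form_length[OF alt_a]
  by (intro frechet_zero_on_Om) (auto simp: Om_def af_def)

lemma Da_swap: "Z \<in> Om \<Longrightarrow> Da (x # y # vs) Z v = - Da (y # x # vs) Z v"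
proof -
  assume Z: "Z \<in> Om"
  have "frechet_derivative (af (x # y # vs)) (at Z) = frechet_derivative (\<lambda>Z. - af (y # x # vs) Z) (at Z)"
  proof (rule frechet_eq_on_Om[OF smooth_on_minus[OF open_Om smooth_af] _ Z])
    show "af (x # y # vs) Z = - af (y # x # vs) Z" if "Z \<in> Om" for Z
      using that alt_form_swap[OF alt_a, of "fst (snd Z)" "fst (snd (snd (snd Z)))" _ _ _ x y vs]
      by (auto simp: Om_def af_def)
  qed
  also have "\<dots> = (\<lambda>v. - frechet_derivative (af (y # x # vs)) (at Z) v)"
    by (rule frechet_derivative_eq, rule has_derivative_minus, rule smooth_on_has_derivative[OF smooth_af Z])
  finally show ?thesis unfolding Da_def by (rule fun_cong)
qed

end

section \<open>Consequences of closedness for 1 <= p < n\<close>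

locale closed_rate_dim = closed_rate Y G P p a
  for Y :: "(real^'n::finite) set" and G P p a +
  assumes p_pos: "p \<ge> 1" and p_less: "p < CARD('n)"
begin

text \<open>A longitudinal velocity wave, \<open>w\<close> = \<open>\<xi>\<close>, without density
  or entropy wave leaves only the compression term. A direction orthogonal to all p arguments exists
  since p < n.\<close>

lemma no_density_dependence: "Z \<in> Om \<Longrightarrow> Da ws Z (0, 0, 0, 1, 0) = 0"
proof (cases "length ws = p")
  case True
  assume "Z \<in> Om"
  then obtain t y ua r s where Z: "Z = (t, y, ua, r, s)" "y \<in> Y" "r > 0" by (auto simp: Om_def)
  obtain \<xi> where \<xi>: "\<xi> \<bullet> \<xi> = 1" "\<And>v. v \<in> set ws \<Longrightarrow> \<xi> \<bullet> v = 0"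
    using exists_unit_orthogonal[of ws] True p_less by auto
  from quadratic_wave[OF Z(2,3) \<xi>, where b=0 and t=t and ua=ua and s=s and c=0 and w=\<xi>] \<xi>(1) Z show ?thesis by simp
qed (use Da_length in blast)

text \<open>A density wave alone and an entropy wave alone show that \<open>Pr * Bf\<close> and
  \<open>Ps * Bf\<close> vanish; at a state where the pressure is not stationary, one of the factors
  can be cancelled.\<close>

lemma Bf_orthogonal:
  assumes Z: "Z = (t, y, ua, r, s)" "y \<in> Y" "r > 0" and DP: "DP r s (1, 0) \<noteq> 0 \<or> DP r s (0, 1) \<noteq> 0"
    and \<xi>: "\<And>v. v \<in> set ws \<Longrightarrow> \<xi> \<bullet> v = 0"
  shows "Bf \<xi> ws Z = 0"
proof (cases "\<xi> = 0")
  case True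
  then show ?thesis using linear_0[OF linear_Bf[OF OmI[OF Z(2,3)]]] Z(1) by simp
next
  case False
  let ?e = "(1 / norm \<xi>) *\<^sub>R \<xi>"
  have e: "?e \<bullet> ?e = 1" "\<And>v. v \<in> set ws \<Longrightarrow> ?e \<bullet> v = 0"
    using False \<xi> by (simp_all add: dot_square_norm power2_eq_square)
  have "Pr Z \<noteq> 0 \<or> Ps Z \<noteq> 0" using DP Z by (auto simp: Pr_def Ps_def)
  moreover have "(b * Pr Z + c * Ps Z) * Bf ?e ws Z = 0" for b c
    using quadratic_wave[OF Z(2,3) e, where b=b and t=t and ua=ua and s=s and c=c and w=0] Z(1) by simp
  from this[of 1 0] this[of 0 1] have "Pr Z * Bf ?e ws Z = 0" "Ps Z * Bf ?e ws Z = 0" by simp_all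
  ultimately have "Bf ?e ws Z = 0" by auto
  then show ?thesis using False linear_scale[OF linear_Bf[OF OmI[OF Z(2,3)]]] Z(1) by simp
qed

lemma exists_orthonormal_pair:
  assumes "Suc (length vs) < CARD('n)"
  obtains \<xi> \<eta> :: "real^'n" where "\<xi> \<bullet> \<xi> = 1" "\<eta> \<bullet> \<eta> = 1" "\<xi> \<bullet> \<eta> = 0"
    "\<And>v. v \<in> set vs \<Longrightarrow> \<xi> \<bullet> v = 0" "\<And>v. v \<in> set vs \<Longrightarrow> \<eta> \<bullet> v = 0"
proof -
  obtain \<xi> :: "real^'n" where \<xi>: "\<xi> \<bullet> \<xi> = 1" "\<And>v. v \<in> set vs \<Longrightarrow> \<xi> \<bullet> v = 0"
    using exists_unit_orthogonal[of vs] assms by auto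
  obtain \<eta> :: "real^'n" where \<eta>: "\<eta> \<bullet> \<eta> = 1" "\<And>v. v \<in> set (\<xi> # vs) \<Longrightarrow> \<eta> \<bullet> v = 0"
    using exists_unit_orthogonal[of "\<xi> # vs"] assms by auto
  show thesis using that[of \<xi> \<eta>] \<xi> \<eta> by (simp add: inner_commute)
qed

text \<open>The part of \<open>linear_wave\<close> bilinear in \<open>w\<close> and
  \<open>w'\<close> is the difference of the two sides.\<close>

lemma velocity_derivative_symmetric:
  assumes Z: "Z \<in> Om" and len: "Suc (length vs) = p"
  shows "Da (w' # vs) Z (0, 0, w, 0, 0) = Da (w # vs) Z (0, 0, w', 0, 0)"
proof -
  obtain t y ua r s where Z: "Z = (t, y, ua, r, s)" "y \<in> Y" "r > 0" using Z by (auto simp: Om_def)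
  have ZO: "Z \<in> Om" using Z by (simp add: OmI)
  obtain \<xi> \<eta> where e: "\<xi> \<bullet> \<xi> = 1" "\<eta> \<bullet> \<eta> = 1" "\<xi> \<bullet> \<eta> = 0"
    "\<And>v. v \<in> set vs \<Longrightarrow> \<xi> \<bullet> v = 0" "\<And>v. v \<in> set vs \<Longrightarrow> \<eta> \<bullet> v = 0"
    using exists_orthonormal_pair[of vs] len p_less by metis
  note lw = linear_wave[OF no_density_dependence Z(2,3) e, where vs=vs and b=0 and c=0 and t=t and ua=ua and s=s]
  have sp: "frechet_derivative \<Phi> (at Z) (0, v, w, 0, 0) = frechet_derivative \<Phi> (at Z) (0, v, 0, 0, 0) + frechet_derivative \<Phi> (at Z) (0, 0, w, 0, 0)"
    if "smooth_on Om \<Phi>" for \<Phi> v w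
    using linear_add[OF linear_frechet[OF that ZO], of "(0, v, 0, 0, 0)" "(0, 0, w, 0, 0)"] by simp
  have z: "frechet_derivative \<Phi> (at Z) (0, 0, 0, 0, 0) = 0" if "smooth_on Om \<Phi>" for \<Phi>
    using linear_0[OF linear_frechet[OF that ZO]] by (simp add: zero_prod_def)
  have z': "Da (0 # ws) Z v = 0" for ws v
    unfolding Da_def by (rule frechet_af_zero[OF ZO])
  have sa: "Da ws Z (0, v, w, 0, 0) = Da ws Z (0, v, 0, 0, 0) + Da ws Z (0, 0, w, 0, 0)" for ws v w
    unfolding Da_def by (rule sp[OF smooth_af])
  \<comment> \<open>The alternating sum over the four choices of amplitudes removes every term that
    contains at most one of \<open>w\<close> and \<open>w'\<close>.\<close>
  show ?thesis
    using lw[where w=w and w'=w'] lw[where w=w and w'=0] lw[where w=0 and w'=w'] lw[where w=0 and w'=0]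
    unfolding Z(1)[symmetric]
    by (simp add: sp[OF smooth_rate0, of _ \<xi> w] sp[OF smooth_rate0, of _ \<eta> w']
        sa[of _ \<xi> w] sa[of _ \<eta> w'] z')
qed

text \<open>The part of \<open>linear_wave\<close> bilinear in \<open>w\<close> and the entropy
  slope \<open>c\<close>. Besides the claimed derivative it contains one pressure term, which
  \<open>hyp\<close> removes; \<open>hyp\<close> has different reasons for p = 1 and for p >=
  2.\<close>

lemma entropy_derivative:
  assumes Z: "Z \<in> Om" and len: "Suc (length vs) = p"
    and hyp: "\<And>\<eta>. \<eta> \<bullet> \<eta> = 1 \<Longrightarrow> frechet_derivative (\<lambda>Z. Ps Z * Bf \<eta> (\<eta> # vs) Z) (at Z) (0, 0, w, 0, 0) = 0"
  shows "Da (w # vs) Z (0, 0, 0, 0, 1) = 0"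
proof -
  obtain t y ua r s where Z: "Z = (t, y, ua, r, s)" "y \<in> Y" "r > 0" using Z by (auto simp: Om_def)
  have ZO: "Z \<in> Om" using Z by (simp add: OmI)
  obtain \<xi> \<eta> where e: "\<xi> \<bullet> \<xi> = 1" "\<eta> \<bullet> \<eta> = 1" "\<xi> \<bullet> \<eta> = 0"
    "\<And>v. v \<in> set vs \<Longrightarrow> \<xi> \<bullet> v = 0" "\<And>v. v \<in> set vs \<Longrightarrow> \<eta> \<bullet> v = 0"
    using exists_orthonormal_pair[of vs] len p_less by metis
  note lw = linear_wave[OF no_density_dependence Z(2,3) e, where vs=vs and b=0 and t=t and ua=ua and s=s and w'=0]
  have sp: "frechet_derivative \<Phi> (at Z) (0, v, w, 0, 0) = frechet_derivative \<Phi> (at Z) (0, v, 0, 0, 0) + frechet_derivative \<Phi> (at Z) (0, 0, w, 0, 0)"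
    if "smooth_on Om \<Phi>" for \<Phi> v w
    using linear_add[OF linear_frechet[OF that ZO], of "(0, v, 0, 0, 0)" "(0, 0, w, 0, 0)"] by simp
  have z': "Da (0 # ws) Z v = 0" for ws v
    unfolding Da_def by (rule frechet_af_zero[OF ZO])
  have sS: "Da ws Z (0, \<eta>, 0, 0, 1) = Da ws Z (0, \<eta>, 0, 0, 0) + Da ws Z (0, 0, 0, 0, 1)" for ws
    using linear_add[OF linear_Da[OF ZO], of ws "(0, \<eta>, 0, 0, 0)" "(0, 0, 0, 0, 1)"] by simp
  have sm: "smooth_on Om (\<lambda>Z. Ps Z * Bf \<eta> (\<eta> # vs) Z)"
    by (intro smooth_on_mult smooth_Ps smooth_Bf open_Om)
  show ?thesis
    using lw[where c=1 and w=w] lw[where c=1 and w=0] lw[where c=0 and w=w] lw[where c=0 and w=0] hyp[OF e(2)]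
    unfolding Z(1)[symmetric]
    by (simp add: sp[OF smooth_rate0, of _ \<xi> w] sp[OF sm, of \<xi> w] sS z')
qed

text \<open>The derivative is symmetric in the first two of its slots \<open>x\<close>,
  \<open>y\<close>, \<open>z\<close> and antisymmetric in the last two. The product of these
  transpositions has order three, so applying both three times returns to the start with three sign
  changes.\<close>

lemma no_velocity_dependence:
  assumes "p \<ge> 2" "Z \<in> Om"
  shows "Da ws Z (0, 0, x, 0, 0) = 0"
proof (cases "length ws = p")
  case True
  with assms(1) obtain y z vs where ws: "ws = y # z # vs" "Suc (length (z # vs)) = p"
    by (cases ws; cases "tl ws") auto
  let ?t = "\<lambda>x y z. Da (y # z # vs) Z (0, 0, x, 0, 0)"
  have sym: "?t x y z = ?t y x z" for x y z
    using velocity_derivative_symmetric[OF assms(2), of "z # vs" y x] ws(2) by simp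
  have anti: "?t x y z = - ?t x z y" for x y z
    by (rule Da_swap[OF assms(2)])
  have "?t x y z = ?t y x z" by (rule sym)
  also have "\<dots> = - ?t y z x" by (rule anti)
  also have "\<dots> = - ?t z y x" by (simp only: sym)
  also have "\<dots> = ?t z x y" using anti[of y x z] by simp
  also have "\<dots> = ?t x z y" by (rule sym)
  also have "\<dots> = - ?t x y z" by (rule anti)
  finally show ?thesis using ws(1) by simp
qed (use Da_length assms in blast)

text \<open>Lowering the index of \<open>w\<close> turns orthogonality with respect to the metric
  into the Euclidean orthogonality of \<open>Bf_orthogonal\<close>.\<close>

lemma velocity_derivative_orthogonal:
  assumes p: "p = 1" and Z: "y \<in> Y" "r > 0" and DP: "DP r s (1, 0) \<noteq> 0 \<or> DP r s (0, 1) \<noteq> 0"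
    and wv: "w \<bullet> (G y *v v) = 0"
  shows "Da [v] (t, y, ua, r, s) (0, 0, w, 0, 0) = 0"
proof -
  have "(G y *v w) \<bullet> v = 0" using wv G_inner_commute[OF Z(1), of w v] by (simp add: inner_commute)
  then have "Bf (G y *v w) [v] (t, y, ua, r, s) = 0"
    by (intro Bf_orthogonal[OF refl Z DP]) simp
  then show ?thesis unfolding Bf_def using G_matrix_inv(2)[OF Z(1)] by simp
qed

text \<open>A symmetric bilinear form that vanishes on orthogonal pairs is a multiple of the metric.
  That the multiple is the same for all velocities uses a second dimension.\<close>

lemma velocity_derivative_conformal:
  assumes p: "p = 1" and Z: "y \<in> Y" "r > 0" and DP: "DP r s (1, 0) \<noteq> 0 \<or> DP r s (0, 1) \<noteq> 0"
  obtains K where "\<And>ua v w. Da [v] (t, y, ua, r, s) (0, 0, w, 0, 0) = K * (w \<bullet> (G y *v v))"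
proof -
  define T where "T v x w = Da [v] (t, y, x, r, s) (0, 0, w, 0, 0)" for v x w
  have ZO: "(t, y, x, r, s) \<in> Om" for x using Z by (simp add: OmI)
  have lin: "linear (\<lambda>w. T v x w)" for v x
  proof (rule linearI)
    show "T v x (w1 + w2) = T v x w1 + T v x w2" for w1 w2
      unfolding T_def using linear_add[OF linear_Da[OF ZO], of "[v]" x "(0, 0, w1, 0, 0)" "(0, 0, w2, 0, 0)"] by simp
    show "T v x (k *\<^sub>R w) = k *\<^sub>R T v x w" for k w
      unfolding T_def using linear_scale[OF linear_Da[OF ZO], of "[v]" x k "(0, 0, w, 0, 0)"] by simp
  qed
  have sym: "T v x w = T w x v" for v x w
    unfolding T_def using velocity_derivative_symmetric[OF ZO, of "[]"] p by simp
  have orth: "T v x w = 0" if "w \<bullet> (G y *v v) = 0" for v x w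
    unfolding T_def using velocity_derivative_orthogonal[OF p Z DP that] .
  define l where "l x v = T v x v / (v \<bullet> (G y *v v))" for v x
  have pos: "v \<bullet> (G y *v v) > 0" if "v \<noteq> 0" for v using G_pos[OF Z(1) that] .
  have T: "T v x w = l x v * (w \<bullet> (G y *v v))" if "v \<noteq> 0" for v x w
  proof -
    \<comment> \<open>Subtracting from \<open>w\<close> its projection onto \<open>v\<close> leaves
      a vector orthogonal to \<open>v\<close>.\<close>
    let ?c = "(w \<bullet> (G y *v v)) / (v \<bullet> (G y *v v))"
    have "T v x (w - ?c *\<^sub>R v) = 0"
      using pos[OF that] by (intro orth) (simp add: inner_diff_left)
    then have "T v x w = ?c * T v x v"
      using linear_diff[OF lin, of v x w "?c *\<^sub>R v"] linear_scale[OF lin, of v x ?c v] by simp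
    then show ?thesis by (simp add: l_def)
  qed
  have leq: "l x v = l x w" if "v \<noteq> 0" "w \<noteq> 0" for v w x
  proof -
    have 1: "l x v = l x w" if "v \<noteq> 0" "w \<noteq> 0" "w \<bullet> (G y *v v) \<noteq> 0" for v w
      using T[OF that(1), of x w] T[OF that(2), of x v] sym[of v x w] that(3) G_inner_commute[OF Z(1), of w v] by simp
    show ?thesis
    proof (cases "w \<bullet> (G y *v v) = 0")
      case True
      \<comment> \<open>Two orthogonal vectors are compared through their sum, which is orthogonal
        to neither.\<close>
      let ?u = "v + w"
      have "?u \<bullet> (G y *v v) \<noteq> 0" "w \<bullet> (G y *v ?u) \<noteq> 0"
        using True pos[OF that(1)] pos[OF that(2)] by (simp_all add: inner_add_left inner_add_right matrix_vector_right_distrib)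
      moreover from this(1) have "?u \<noteq> 0" by (metis inner_zero_left)
      ultimately show ?thesis using 1[OF that(1), of ?u] 1[of ?u w] that by simp
    qed (use 1 that in blast)
  qed
  have dim: "1 < CARD('n)" using p p_less by simp
  \<comment> \<open>\<open>l x e\<close> depends on \<open>x\<close> only through \<open>g(x, e)\<close>, and some \<open>e \<noteq> 0\<close> is orthogonal to \<open>x' - x\<close>.\<close>
  have lx: "l x v = l x' v" if v: "v \<noteq> 0" for x x' v
  proof -
    obtain e where e: "e \<bullet> e = 1" "e \<bullet> (G y *v (x' - x)) = 0"
      using exists_unit_orthogonal[of "[G y *v (x' - x)]"] dim by auto
    then have e0: "e \<noteq> 0" by auto
    have d: "(x' - x) \<bullet> (G y *v e) = 0" using e(2) G_inner_commute[OF Z(1)] by metis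
    have eq: "af [e] ((t, y, x', r, s) + \<theta> *\<^sub>R (0, 0, e, 0, 0)) = af [e] ((t, y, x, r, s) + \<theta> *\<^sub>R (0, 0, e, 0, 0))" for \<theta>
    proof -
      have "af [e] ((t, y, x + \<theta> *\<^sub>R e, r, s) + (0, 0, x' - x, 0, 0)) = af [e] (t, y, x + \<theta> *\<^sub>R e, r, s)"
        by (rule const_line[OF smooth_af])
           (use ZO orth[OF d, unfolded T_def Da_def] in \<open>simp_all\<close>)
      then show ?thesis by (simp add: algebra_simps)
    qed
    have "((\<lambda>\<theta>. af [e] ((t, y, x, r, s) + \<theta> *\<^sub>R (0, 0, e, 0, 0))) has_real_derivative T e x e) (at 0)"
      using Om_line[OF smooth_af, of "(t, y, x, r, s)" 0 "(0, 0, e, 0, 0)" "[e]"] ZO by (simp add: T_def Da_def)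
    then have "T e x' e = T e x e"
      unfolding T_def[of e x'] Da_def by (intro frechet_of_line[OF smooth_af ZO]) (simp only: eq)
    then have "l x e = l x' e" by (simp add: l_def)
    then show ?thesis using leq[OF v e0, of x] leq[OF v e0, of x'] by simp
  qed
  define e :: "real^'n" where "e = axis undefined 1"
  have e: "e \<noteq> 0" by (simp add: e_def axis_eq_0_iff)
  show thesis
  proof (rule that[of "l 0 e"])
    fix ua v w
    show "Da [v] (t, y, ua, r, s) (0, 0, w, 0, 0) = l 0 e * (w \<bullet> (G y *v v))"
    proof (cases "v = 0")
      case True
      then show ?thesis using orth[of w v ua] by (simp add: T_def)
    next
      case False
      then show ?thesis using T[OF False, of ua w] leq[OF False e, of ua] lx[OF e, of ua 0]
        by (simp add: T_def)
    qed
  qed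
qed

text \<open>The pressure term in \<open>entropy_derivative\<close> does not vary with the velocity:
  for p >= 2 it is zero by \<open>no_velocity_dependence\<close>, and for p = 1 it is P_S/\<rho>
  times a multiple of the metric that is the same for all velocities.\<close>

lemma no_entropy_dependence:
  assumes Z: "Z \<in> Om"
  shows "Da ws Z (0, 0, 0, 0, 1) = 0"
proof (cases "length ws = p")
  case True
  with p_pos obtain w vs where ws: "ws = w # vs" "Suc (length vs) = p" by (cases ws) auto
  have "Da (w # vs) Z (0, 0, 0, 0, 1) = 0"
  proof (rule entropy_derivative[OF Z ws(2)])
    fix \<eta> :: "real^'n"
    obtain t y x r s where Z': "Z = (t, y, x, r, s)" "y \<in> Y" "r > 0" using Z by (auto simp: Om_def)
    have sm: "smooth_on Om (\<lambda>Z. Ps Z * Bf \<eta> (\<eta> # vs) Z)"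
      by (intro smooth_on_mult smooth_Ps smooth_Bf open_Om)
    show "frechet_derivative (\<lambda>Z. Ps Z * Bf \<eta> (\<eta> # vs) Z) (at Z) (0, 0, w, 0, 0) = 0"
    proof (cases "p = 1")
      case False
      then have "p \<ge> 2" using p_pos by simp
      then have "Bf \<eta> (\<eta> # vs) Z = 0" if "Z \<in> Om" for Z
        unfolding Bf_def by (rule no_velocity_dependence[OF _ that])
      then show ?thesis by (intro frechet_zero_on_Om[OF _ Z]) simp
    next
      case True
      then have vs: "vs = []" using ws(2) by simp
      have "\<exists>k. \<forall>\<theta>. Ps (Z + \<theta> *\<^sub>R (0, 0, w, 0, 0)) * Bf \<eta> [\<eta>] (Z + \<theta> *\<^sub>R (0, 0, w, 0, 0)) = k"
      \<comment> \<open>Only the velocity varies along the line, so if P_S is zero at this state,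
        the factor \<open>Ps\<close> is zero on the whole line.\<close>
      proof (cases "DP r s (0, 1) = 0")
        case True
        then show ?thesis unfolding Z' by (intro exI[of _ 0]) (simp add: Ps_def)
      next
        case False
        obtain K where "\<And>ua v w. Da [v] (t, y, ua, r, s) (0, 0, w, 0, 0) = K * (w \<bullet> (G y *v v))"
          using velocity_derivative_conformal[OF True Z'(2,3), of s t] False by blast
        then show ?thesis unfolding Z' Bf_def by (simp add: Ps_def)
      qed
      then obtain k where "\<And>\<theta>. Ps (Z + \<theta> *\<^sub>R (0, 0, w, 0, 0)) * Bf \<eta> [\<eta>] (Z + \<theta> *\<^sub>R (0, 0, w, 0, 0)) = k" by blast
      then show ?thesis unfolding vs by (intro frechet_of_line[OF sm[unfolded vs] Z]) simp
    qed
  qed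
  then show ?thesis using ws(1) by simp
qed (use Da_length Z in blast)

text \<open>The vanishing partial derivatives are integrated up to the reference state \<rho> = 1, S
  = 0. The density moves along a segment between positive numbers.\<close>

lemma af_density_entropy:
  assumes "y \<in> Y" "r > 0"
  shows "af ws (t, y, x, r, s) = af ws (t, y, x, 1, 0)"
proof -
  have pos: "r + \<theta> * (1 - r) > 0" if "0 \<le> \<theta>" "\<theta> \<le> 1" for \<theta>
  proof -
    have "r + \<theta> * (1 - r) = (1 - \<theta>) * r + \<theta>" by (simp add: algebra_simps)
    also have "\<dots> > 0" using that assms(2) by (cases "\<theta> = 1") (auto intro: add_pos_nonneg)
    finally show ?thesis .
  qed
  have Oi: "(t, y, x, r + \<theta> * (1 - r), s - \<theta>' * s) \<in> Om" if "0 \<le> \<theta>" "\<theta> \<le> 1" for \<theta> \<theta>'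
    using pos[OF that] assms(1) by (simp add: OmI)
  have "af ws ((t, y, x, r, s) + (0, 0, 0, 1 - r, 0)) = af ws (t, y, x, r, s)"
  proof (rule const_line[OF smooth_af])
    fix \<theta> :: real assume th: "0 \<le> \<theta>" "\<theta> \<le> 1"
    show O: "(t, y, x, r, s) + \<theta> *\<^sub>R (0, 0, 0, 1 - r, 0) \<in> Om" using Oi[OF th, of 0] by simp
    show "frechet_derivative (af ws) (at ((t, y, x, r, s) + \<theta> *\<^sub>R (0, 0, 0, 1 - r, 0))) (0, 0, 0, 1 - r, 0) = 0"
      using linear_scale[OF linear_Da[OF O], of ws "1 - r" "(0, 0, 0, 1, 0)"] no_density_dependence[OF O, of ws]
      by (simp add: Da_def)
  qed
  moreover have "af ws ((t, y, x, 1, s) + (0, 0, 0, 0, - s)) = af ws (t, y, x, 1, s)"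
  proof (rule const_line[OF smooth_af])
    fix \<theta> :: real assume th: "0 \<le> \<theta>" "\<theta> \<le> 1"
    show O: "(t, y, x, 1, s) + \<theta> *\<^sub>R (0, 0, 0, 0, - s) \<in> Om" using assms by (simp add: OmI)
    show "frechet_derivative (af ws) (at ((t, y, x, 1, s) + \<theta> *\<^sub>R (0, 0, 0, 0, - s))) (0, 0, 0, 0, - s) = 0"
      using linear_scale[OF linear_Da[OF O], of ws "- s" "(0, 0, 0, 0, 1)"] no_entropy_dependence[OF O, of ws]
      by (simp add: Da_def)
  qed
  ultimately show ?thesis by simp
qed

lemma af_position_only:
  assumes "p \<ge> 2" "y \<in> Y" "r > 0"
  shows "af ws (t, y, x, r, s) = af ws (t, y, 0, 1, 0)"
proof -
  have "af ws ((t, y, x, r, s) + (0, 0, - x, 0, 0)) = af ws (t, y, x, r, s)"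
    by (rule const_line[OF smooth_af])
       (use assms in \<open>simp_all add: OmI no_velocity_dependence[OF assms(1), unfolded Da_def]\<close>)
  then show ?thesis using af_density_entropy[OF assms(2,3), of ws t 0 s] by simp
qed

text \<open>The density factors through the map that resets \<rho> and S to 1 and 0. This carries
  information about derivatives from one state to every other.\<close>

lemma Da_density_entropy:
  assumes "y \<in> Y" "r > 0"
  shows "Da ws (t, y, x, r, s) (\<tau>, v, w, \<beta>, \<gamma>) = Da ws (t, y, x, 1, 0) (\<tau>, v, w, 0, 0)"
proof -
  let ?T = "\<lambda>(t, y, x, r, s). (t, y, x, 1, 0) :: 'n phase"
  have O: "(t, y, x, r, s) \<in> Om" "(t, y, x, 1, 0) \<in> Om" using assms by (simp_all add: OmI)
  have T: "(?T has_derivative (\<lambda>(t, y, x, r, s). (t, y, x, 0, 0))) (at (t, y, x, r, s))"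
    unfolding case_prod_beta by (auto intro!: derivative_eq_intros simp: zero_prod_def)
  have aT: "(af ws has_derivative Da ws (t, y, x, 1, 0)) (at (?T (t, y, x, r, s)))"
    unfolding Da_def using smooth_on_has_derivative[OF smooth_af O(2)] by simp
  have "(af ws has_derivative (\<lambda>z. Da ws (t, y, x, 1, 0) ((\<lambda>(t, y, x, r, s). (t, y, x, 0, 0)) z))) (at (t, y, x, r, s))"
  proof (rule has_derivative_transform_within_open[OF has_derivative_compose[OF T aT] open_Om O(1)])
    fix Z assume "Z \<in> Om"
    then obtain t y x r s where Z: "Z = (t, y, x, r, s)" "y \<in> Y" "r > 0" by (auto simp: Om_def)
    show "af ws (?T Z) = af ws Z" unfolding Z(1) using af_density_entropy[OF Z(2,3), of ws t x s] by simp
  qed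
  from frechet_derivative_eq[OF this] show ?thesis by (simp add: Da_def)
qed

end

section \<open>The circulation coefficient\<close>

locale closed_rate_circulation = closed_rate_dim Y G P p a
  for Y :: "(real^'n::finite) set" and G P p a +
  assumes p1: "p = 1"
    and DP_nz: "\<exists>r s. r > 0 \<and> (DP r s (1, 0) \<noteq> 0 \<or> DP r s (0, 1) \<noteq> 0)"
begin

text \<open>The factor \<open>K\<close> in \<open>\<alpha>\<^sub>u[w](v) = K g(w, v)\<close>, read off at a fixed nonzero vector.\<close>

definition Kf :: "'n phase \<Rightarrow> real" where
  "Kf Z = (let e = axis undefined 1 in Da [e] Z (0, 0, e, 0, 0) * inverse (e \<bullet> (G (fst (snd Z)) *v e)))"

lemma smooth_Kf: "smooth_on Om Kf"
proof -
  let ?e = "axis undefined 1 :: real^'n"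
  have "smooth_on Y (\<lambda>y. inverse (?e \<bullet> (G y *v ?e)))"
  proof (rule smooth_on_inverse[OF open_Y])
    show "smooth_on Y (\<lambda>y. ?e \<bullet> (G y *v ?e))"
      unfolding matrix_vector_mult_def
      by (intro smooth_on_inner smooth_on_const smooth_on_vec_lambda smooth_on_sum smooth_on_mult smooth_on_nth smooth_G open_Y)
    show "?e \<bullet> (G y *v ?e) \<noteq> 0" if "y \<in> Y" for y
      using G_pos[OF that, of ?e] by (simp add: axis_eq_0_iff)
  qed
  from smooth_of_pos[OF this] show ?thesis
    unfolding Kf_def[abs_def] Let_def
    by (intro smooth_on_mult smooth_density_partial open_Om)
qed

text \<open>The factor is found at one state \<open>(r0, s0)\<close> where the pressure is not
  stationary and carried to all others by \<open>Da_density_entropy\<close>. So \<open>Kf\<close> is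
  a function of time and position.\<close>

lemma Kf:
  assumes "y \<in> Y" "r > 0"
  shows "Da [v] (t, y, x, r, s) (0, 0, w, 0, 0) = Kf (t, y, x, r, s) * (w \<bullet> (G y *v v))"
    and "Kf (t, y, x, r, s) = Kf (t, y, 0, 1, 0)"
proof -
  obtain r0 s0 where r0: "r0 > 0" "DP r0 s0 (1, 0) \<noteq> 0 \<or> DP r0 s0 (0, 1) \<noteq> 0" using DP_nz by blast
  obtain K where K: "\<And>ua v w. Da [v] (t, y, ua, r0, s0) (0, 0, w, 0, 0) = K * (w \<bullet> (G y *v v))"
    using velocity_derivative_conformal[OF p1 assms(1) r0] by blast
  have K': "Da [v] (t, y, ua, r, s) (0, 0, w, 0, 0) = K * (w \<bullet> (G y *v v))" if "r > 0" for ua v w r s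
    using K[of v ua w] unfolding Da_density_entropy[OF assms(1) that] Da_density_entropy[OF assms(1) r0(1)] .
  let ?e = "axis undefined 1 :: real^'n"
  have "?e \<bullet> (G y *v ?e) \<noteq> 0" using G_pos[OF assms(1), of ?e] by (simp add: axis_eq_0_iff)
  then have Kf: "Kf (t, y, ua, r, s) = K" if "r > 0" for ua r s
    unfolding Kf_def Let_def using K'[OF that] by simp
  show "Da [v] (t, y, x, r, s) (0, 0, w, 0, 0) = Kf (t, y, x, r, s) * (w \<bullet> (G y *v v))"
    using K'[OF assms(2)] Kf[OF assms(2)] by simp
  show "Kf (t, y, x, r, s) = Kf (t, y, 0, 1, 0)" using Kf assms(2) by simp
qed

lemma Bf_Kf: "Z \<in> Om \<Longrightarrow> Bf \<zeta> [v] Z = Kf Z * (\<zeta> \<bullet> v)"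
proof -
  assume "Z \<in> Om"
  then obtain t y x r s where Z: "Z = (t, y, x, r, s)" "y \<in> Y" "r > 0" by (auto simp: Om_def)
  show ?thesis unfolding Z(1) Bf_def using Kf(1)[OF Z(2,3)] G_inner_commute[OF Z(2), of "matrix_inv (G y) *v \<zeta>" v]
    G_matrix_inv(1)[OF Z(2), of \<zeta>] by (simp add: inner_commute)
qed

text \<open>The velocity derivative is itself independent of the velocity, so the density is affine
  in it.\<close>

lemma af_affine:
  assumes "y \<in> Y" "r > 0"
  shows "af [v] (t, y, x, r, s) = af [v] (t, y, 0, 1, 0) + Kf (t, y, 0, 1, 0) * (x \<bullet> (G y *v v))"
proof -
  let ?f = "\<lambda>\<theta>. af [v] ((t, y, 0, r, s) + \<theta> *\<^sub>R (0, 0, x, 0, 0))"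
  have "(?f has_real_derivative Kf (t, y, 0, 1, 0) * (x \<bullet> (G y *v v))) (at \<theta>)" for \<theta>
    using Om_line[OF smooth_af, of "(t, y, 0, r, s)" \<theta> "(0, 0, x, 0, 0)" "[v]"] assms
      Kf(1)[OF assms, where v=v and t=t and x="\<theta> *\<^sub>R x" and s=s and w=x]
      Kf(2)[OF assms, where t=t and x="\<theta> *\<^sub>R x" and s=s] by (simp add: Da_def OmI)
  from MVT2[of 0 1 ?f, OF _ this] have "af [v] (t, y, x, r, s) = af [v] (t, y, 0, r, s) + Kf (t, y, 0, 1, 0) * (x \<bullet> (G y *v v))"
    by auto
  then show ?thesis using af_density_entropy[OF assms, of "[v]" t 0 s] by simp
qed

text \<open>For p = 1 there are no further arguments, and \<open>Bf_Kf\<close> evaluates the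
  pressure terms: those that pair \<open>\<xi>\<close> with \<open>\<eta>\<close> vanish, the others
  reduce to \<open>Kf\<close>.\<close>

lemma linear_wave_circulation:
  fixes t s :: real and x :: "real^'n"
  assumes y: "y \<in> Y" "r > 0" and on: "\<xi> \<bullet> \<xi> = 1" "\<eta> \<bullet> \<eta> = 1" "\<xi> \<bullet> \<eta> = 0"
  defines "dd \<equiv> \<lambda>\<Phi>. frechet_derivative \<Phi> (at ((t, y, x, r, s) :: 'n phase))"
  shows "dd (rate0 [\<eta>]) (0, \<xi>, w, b, 0) - c * dd (\<lambda>Z. Ps Z * Kf Z) (0, \<xi>, w, b, 0) + dd (af [w']) (0, \<xi>, w, b, 0)
    - dd (rate0 [\<xi>]) (0, \<eta>, w', 0, c) + b * dd (\<lambda>Z. Pr Z * Kf Z) (0, \<eta>, w', 0, c) - dd (af [w]) (0, \<eta>, w', 0, c) = 0"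
proof -
  have Z: "(t, y, x, r, s) \<in> Om" using y by (simp add: OmI)
  have on': "\<eta> \<bullet> \<xi> = 0" using on(3) by (simp add: inner_commute)
  have 1: "dd (\<lambda>Z. Pr Z * Bf \<xi> [\<eta>] Z) v = 0" "dd (\<lambda>Z. Ps Z * Bf \<eta> [\<xi>] Z) v = 0" for v
    unfolding dd_def by (rule frechet_zero_on_Om[OF _ Z]; simp add: Bf_Kf on on')+
  have 2: "dd (\<lambda>Z. Pr Z * Bf \<xi> [\<xi>] Z) = dd (\<lambda>Z. Pr Z * Kf Z)" "dd (\<lambda>Z. Ps Z * Bf \<eta> [\<eta>] Z) = dd (\<lambda>Z. Ps Z * Kf Z)"
    unfolding dd_def
    by (rule frechet_eq_on_Om[OF _ _ Z], intro smooth_on_mult smooth_Pr smooth_Ps smooth_Kf open_Om, simp add: Bf_Kf on)+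
  from linear_wave[OF no_density_dependence y on, where vs="[]" and t=t and ua=x and s=s and b=b and c=c and w=w and w'=w']
  show ?thesis unfolding Da_def dd_def by (simp add: 1[unfolded dd_def] 2[unfolded dd_def])
qed

lemma smooth_PKf: "smooth_on Om (\<lambda>Z. Ps Z * Kf Z)" "smooth_on Om (\<lambda>Z. Pr Z * Kf Z)"
  by (intro smooth_on_mult smooth_Pr smooth_Ps smooth_Kf open_Om)+

text \<open>The baroclinic term d(1/\<rho>) wedge dP appears as the coefficient of
  \<open>b * c\<close>: the \<rho>-derivative of K P_S/\<rho> equals the S-derivative of K
  P_\<rho>/\<rho>. As K does not depend on the state, the mixed second derivatives of P cancel, and
  K P_S/\<rho>^2 = 0 remains.\<close>

lemma Kf_entropy_pressure:
  assumes "y \<in> Y" "r > 0"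
  shows "Kf (t, y, x, r, s) * DP r s (0, 1) = 0"
proof -
  let ?Z = "(t, y, x, r, s)"
  let ?dd = "\<lambda>\<Phi>. frechet_derivative \<Phi> (at ?Z)"
  have Z: "?Z \<in> Om" using assms by (simp add: OmI)
  obtain \<xi> \<eta> :: "real^'n" where on: "\<xi> \<bullet> \<xi> = 1" "\<eta> \<bullet> \<eta> = 1" "\<xi> \<bullet> \<eta> = 0"
    using exists_orthonormal_pair[of "[]"] p1 p_less by auto
  have split: "?dd \<Phi> (0, v, 0, b, c) = ?dd \<Phi> (0, v, 0, 0, 0) + b * ?dd \<Phi> (0, 0, 0, 1, 0) + c * ?dd \<Phi> (0, 0, 0, 0, 1)"
    if "smooth_on Om \<Phi>" for \<Phi> v b c
  proof -
    note L = linear_frechet[OF that Z]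
    have "?dd \<Phi> (0, v, 0, b, c) = ?dd \<Phi> ((0, v, 0, 0, 0) + b *\<^sub>R (0, 0, 0, 1, 0) + c *\<^sub>R (0, 0, 0, 0, 1))" by simp
    then show ?thesis unfolding linear_add[OF L] linear_scale[OF L] by simp
  qed
  note lw = linear_wave_circulation[OF assms on, where t=t and x=x and s=s and w=0 and w'=0]
  \<comment> \<open>The alternating sum over the values 0 and 1 of \<open>b\<close> and
    \<open>c\<close> isolates the coefficient of their product.\<close>
  have "?dd (\<lambda>Z. Ps Z * Kf Z) (0, 0, 0, 1, 0) = ?dd (\<lambda>Z. Pr Z * Kf Z) (0, 0, 0, 0, 1)"
    using lw[where b=1 and c=1] lw[where b=1 and c=0] lw[where b=0 and c=1] lw[where b=0 and c=0]
      split[OF smooth_rate0[of "[\<eta>]"], of \<xi> 1 0] split[OF smooth_rate0[of "[\<xi>]"], of \<eta> 0 1]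
      split[OF smooth_PKf(1), of \<xi> 1 0] split[OF smooth_PKf(2), of \<eta> 0 1]
      split[OF smooth_af[of "[0]"], of \<xi> 1 0] split[OF smooth_af[of "[0]"], of \<eta> 0 1]
    by simp
  \<comment> \<open>\<open>M\<close> is the mixed second derivative of P; \<open>M'\<close> reads
    the same number in the other order of differentiation.\<close>
  moreover define M where "M = frechet_derivative (\<lambda>z. frechet_derivative (\<lambda>(\<rho>, S). P \<rho> S) (at z) (0, 1)) (at (r, s)) (1, 0)"
  have o: "open ({0::real<..} \<times> (UNIV :: real set))" by (intro open_Times) auto
  have M': "M = frechet_derivative (\<lambda>z. frechet_derivative (\<lambda>(\<rho>, S). P \<rho> S) (at z) (1, 0)) (at (r, s)) (0, 1)"
    unfolding M_def by (rule frechet_derivative_commute[OF o _ smooth_P]) (use assms in auto)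
  have "?dd (\<lambda>Z. Ps Z * Kf Z) (0, 0, 0, 1, 0) = (inverse r * M - inverse r * inverse r * DP r s (0, 1)) * Kf ?Z"
  proof (rule frechet_of_line[OF smooth_PKf(1) Z])
    have "((\<lambda>\<theta>. (r + \<theta>, s)) has_vector_derivative (1, 0)) (at 0)"
      by (auto intro!: derivative_eq_intros has_vector_derivative_Pair)
    from smooth_on_curve[OF smooth_on_frechet[OF smooth_P, of "(0, 1)"], where Z="\<lambda>\<theta>. (r + \<theta>, s)", OF _ this] assms
    have D: "((\<lambda>\<theta>. DP (r + \<theta>) s (0, 1)) has_real_derivative M) (at 0)" by (simp add: M_def DP_def)
    have "((\<lambda>\<theta>. inverse (r + \<theta>)) has_real_derivative - (inverse r * inverse r)) (at 0)"
      using assms(2) by (auto intro!: derivative_eq_intros)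
    from DERIV_cmult_right[OF DERIV_mult[OF this D], of "Kf ?Z"]
    have "((\<lambda>\<theta>. inverse (r + \<theta>) * DP (r + \<theta>) s (0, 1) * Kf ?Z) has_real_derivative
        (inverse r * M - inverse r * inverse r * DP r s (0, 1)) * Kf ?Z) (at 0)"
      by (simp add: algebra_simps)
    then show "((\<lambda>\<theta>. Ps (?Z + \<theta> *\<^sub>R (0, 0, 0, 1, 0)) * Kf (?Z + \<theta> *\<^sub>R (0, 0, 0, 1, 0))) has_real_derivative
        (inverse r * M - inverse r * inverse r * DP r s (0, 1)) * Kf ?Z) (at 0)"
    proof (rule has_field_derivative_transform_within_open[of _ _ _ "{- r<..}"])
      fix \<theta> assume "\<theta> \<in> {- r<..}"
      then have "r + \<theta> > 0" by simp
      then show "inverse (r + \<theta>) * DP (r + \<theta>) s (0, 1) * Kf ?Z = Ps (?Z + \<theta> *\<^sub>R (0, 0, 0, 1, 0)) * Kf (?Z + \<theta> *\<^sub>R (0, 0, 0, 1, 0))"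
        using Kf(2)[OF assms(1), of "r + \<theta>" t x s] Kf(2)[OF assms, of t x s] by (simp add: Ps_def)
    qed (use assms in auto)
  qed
  moreover have "?dd (\<lambda>Z. Pr Z * Kf Z) (0, 0, 0, 0, 1) = inverse r * M * Kf ?Z"
  proof (rule frechet_of_line[OF smooth_PKf(2) Z])
    have "((\<lambda>\<theta>. (r, s + \<theta>)) has_vector_derivative (0, 1)) (at 0)"
      by (auto intro!: derivative_eq_intros has_vector_derivative_Pair)
    from smooth_on_curve[OF smooth_on_frechet[OF smooth_P, of "(1, 0)"], where Z="\<lambda>\<theta>. (r, s + \<theta>)", OF _ this] assms
    have D: "((\<lambda>\<theta>. DP r (s + \<theta>) (1, 0)) has_real_derivative M) (at 0)" by (simp add: M' DP_def)
    have "((\<lambda>\<theta>. inverse r * DP r (s + \<theta>) (1, 0) * Kf ?Z) has_real_derivative inverse r * M * Kf ?Z) (at 0)"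
      by (rule DERIV_cmult_right[OF DERIV_cmult[OF D]])
    then show "((\<lambda>\<theta>. Pr (?Z + \<theta> *\<^sub>R (0, 0, 0, 0, 1)) * Kf (?Z + \<theta> *\<^sub>R (0, 0, 0, 0, 1))) has_real_derivative
        inverse r * M * Kf ?Z) (at 0)"
      using Kf(2)[OF assms, of t x s] Kf(2)[OF assms, of t x "s + \<theta>" for \<theta>] by (simp add: Pr_def)
  qed
  ultimately have "inverse r * inverse r * DP r s (0, 1) * Kf ?Z = 0" by (simp add: algebra_simps)
  then show ?thesis using assms(2) by auto
qed

lemma rate0_density: "y \<in> Y \<Longrightarrow> r > 0 \<Longrightarrow> rate0 ws (t, y, x, r, s) = Da ws (t, y, x, 1, 0) (1, x, - christoffel_sq G y x, 0, 0)"
  unfolding rate0_def by (simp add: Da_density_entropy[of y r ws t x s])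

text \<open>The coefficient of the density slope \<open>b\<close> without other waves:
  \<open>rate0\<close> does not depend on \<rho>, so only the derivative of K P_\<rho>/\<rho> along
  \<open>\<eta>\<close> is left. Here \<open>\<eta>\<close> is parallel to \<open>v\<close>, and
  P_\<rho>/\<rho> does not involve the position.\<close>

lemma Kf_space:
  assumes y: "y \<in> Y" and r: "r > 0" "DP r s (1, 0) \<noteq> 0"
  shows "frechet_derivative Kf (at (t, y, x, r, s)) (0, v, 0, 0, 0) = 0"
proof (cases "v = 0")
  case True
  have "(t, y, x, r, s) \<in> Om" using y r by (simp add: OmI)
  from linear_0[OF linear_frechet[OF smooth_Kf this]] True show ?thesis by (simp add: zero_prod_def)
next
  case False
  let ?Z = "(t, y, x, r, s)"
  let ?dd = "\<lambda>\<Phi>. frechet_derivative \<Phi> (at ?Z)"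
  have Z: "?Z \<in> Om" using y r by (simp add: OmI)
  define \<eta> where "\<eta> = (1 / norm v) *\<^sub>R v"
  have \<eta>: "\<eta> \<bullet> \<eta> = 1" using False by (simp add: \<eta>_def dot_square_norm power2_eq_square)
  obtain \<xi> where \<xi>: "\<xi> \<bullet> \<xi> = 1" "\<xi> \<bullet> \<eta> = 0"
    using exists_unit_orthogonal[of "[\<eta>]"] p1 p_less by auto
  note lw = linear_wave_circulation[OF y r(1) \<xi>(1) \<eta> \<xi>(2), where t=t and x=x and s=s and w=0 and w'=0 and c=0]
  have split: "?dd \<Phi> (0, \<xi>, 0, 1, 0) = ?dd \<Phi> (0, \<xi>, 0, 0, 0) + ?dd \<Phi> (0, 0, 0, 1, 0)"
    if "smooth_on Om \<Phi>" for \<Phi>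
    using linear_add[OF linear_frechet[OF that Z], of "(0, \<xi>, 0, 0, 0)" "(0, 0, 0, 1, 0)"] by simp
  have a0: "?dd (af [0]) z = 0" for z using frechet_af_zero[OF Z] .
  have "?dd (rate0 [\<eta>]) (0, 0, 0, 1, 0) = 0"
  proof (rule frechet_of_line[OF smooth_rate0 Z])
    have "((\<lambda>\<theta>. rate0 [\<eta>] ?Z) has_real_derivative 0) (at 0)" by simp
    then show "((\<lambda>\<theta>. rate0 [\<eta>] (?Z + \<theta> *\<^sub>R (0, 0, 0, 1, 0))) has_real_derivative 0) (at 0)"
      by (rule has_field_derivative_transform_within_open[of _ _ _ "{- r<..}"])
         (use r y in \<open>auto simp: rate0_density\<close>)
  qed
  then have "?dd (\<lambda>Z. Pr Z * Kf Z) (0, \<eta>, 0, 0, 0) = 0"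
    using lw[where b=1] lw[where b=0] split[OF smooth_rate0[of "[\<eta>]"]] a0 by simp
  moreover have "?dd (\<lambda>Z. Pr Z * Kf Z) (0, \<eta>, 0, 0, 0) = Pr ?Z * ?dd Kf (0, \<eta>, 0, 0, 0)"
  proof (rule frechet_of_line[OF smooth_PKf(2) Z])
    have "((\<lambda>\<theta>. Kf (?Z + \<theta> *\<^sub>R (0, \<eta>, 0, 0, 0))) has_real_derivative ?dd Kf (0, \<eta>, 0, 0, 0)) (at 0)"
      using Om_line[OF smooth_Kf, of ?Z 0 "(0, \<eta>, 0, 0, 0)"] Z by simp
    from DERIV_cmult[OF this, of "Pr ?Z"]
    show "((\<lambda>\<theta>. Pr (?Z + \<theta> *\<^sub>R (0, \<eta>, 0, 0, 0)) * Kf (?Z + \<theta> *\<^sub>R (0, \<eta>, 0, 0, 0))) has_real_derivative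
        Pr ?Z * ?dd Kf (0, \<eta>, 0, 0, 0)) (at 0)" by (simp add: Pr_def)
  qed
  ultimately have "?dd Kf (0, \<eta>, 0, 0, 0) = 0" using r by (simp add: Pr_def)
  then have "norm v * ?dd Kf (0, \<eta>, 0, 0, 0) = 0" by simp
  then show ?thesis
    using linear_scale[OF linear_frechet[OF smooth_Kf Z], of "norm v" "(0, \<eta>, 0, 0, 0)"] False by (simp add: \<eta>_def)
qed

text \<open>At zero velocity, the terms linear in \<open>w\<close> = \<open>\<eta>\<close> equate
  the velocity derivative of \<open>rate0\<close> with a position derivative of the density. The
  same position derivative occurs inside the former and cancels, leaving the mixed derivative in
  time and velocity, which is K_t g(\<eta>, \<eta>).\<close>

lemma Kf_time:
  assumes y: "y \<in> Y"
  shows "frechet_derivative Kf (at (t, y, 0, 1, 0)) (1, 0, 0, 0, 0) = 0"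
proof -
  let ?Z = "(t, y, 0, 1, 0) :: 'n phase"
  let ?dd = "\<lambda>\<Phi>. frechet_derivative \<Phi> (at ?Z)"
  have Z: "?Z \<in> Om" using y by (simp add: OmI)
  obtain \<xi> \<eta> :: "real^'n" where on: "\<xi> \<bullet> \<xi> = 1" "\<eta> \<bullet> \<eta> = 1" "\<xi> \<bullet> \<eta> = 0"
    using exists_orthonormal_pair[of "[]"] p1 p_less by auto
  have e0: "\<eta> \<noteq> 0" using on(2) by auto
  note lw = linear_wave_circulation[OF y zero_less_one on, where t=t and x=0 and s=0 and b=0 and c=0 and w'=0]
  have split: "?dd \<Phi> (0, \<xi>, \<eta>, 0, 0) = ?dd \<Phi> (0, \<xi>, 0, 0, 0) + ?dd \<Phi> (0, 0, \<eta>, 0, 0)"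
    if "smooth_on Om \<Phi>" for \<Phi>
    using linear_add[OF linear_frechet[OF that Z], of "(0, \<xi>, 0, 0, 0)" "(0, 0, \<eta>, 0, 0)"] by simp
  have z: "?dd (af [0]) v = 0" for v using frechet_af_zero[OF Z] .
  have 1: "?dd (rate0 [\<eta>]) (0, 0, \<eta>, 0, 0) = ?dd (af [\<eta>]) (0, \<eta>, 0, 0, 0)"
    using lw[where w=\<eta>] lw[where w=0] split[OF smooth_rate0[of "[\<eta>]"]] z by simp
  let ?l = "\<lambda>\<theta>. ?Z + \<theta> *\<^sub>R (0, 0, \<eta>, 0, 0)"
  have lO: "?l \<theta> \<in> Om" for \<theta> using y by (simp add: OmI)
  have sq: "christoffel_sq G y (\<theta> *\<^sub>R \<eta>) = (\<theta> * \<theta>) *\<^sub>R christoffel_sq G y \<eta>" for \<theta>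
    by (simp add: christoffel_sq_def vec_eq_iff sum_distrib_left algebra_simps)
  have "?dd (rate0 [\<eta>]) (0, 0, \<eta>, 0, 0) = ?dd (\<lambda>Z. Da [\<eta>] Z (1, 0, 0, 0, 0)) (0, 0, \<eta>, 0, 0) + Da [\<eta>] ?Z (0, \<eta>, 0, 0, 0)"
  proof (rule frechet_of_line[OF smooth_rate0 Z])
    let ?f = "\<lambda>v \<theta>. Da [\<eta>] (?l \<theta>) v"
    have f: "(?f v has_real_derivative ?dd (\<lambda>Z. Da [\<eta>] Z v) (0, 0, \<eta>, 0, 0)) (at 0)" for v
      using Om_line[OF smooth_density_partial, of ?Z 0 "(0, 0, \<eta>, 0, 0)"] Z by simp
    \<comment> \<open>An expansion in \<theta>: the Christoffel term is quadratic in the velocity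
      and has zero derivative at 0.\<close>
    have "rate0 [\<eta>] (?l \<theta>) = ?f (1, 0, 0, 0, 0) \<theta> + \<theta> * ?f (0, \<eta>, 0, 0, 0) \<theta>
        - \<theta> * \<theta> * ?f (0, 0, christoffel_sq G y \<eta>, 0, 0) \<theta>" for \<theta>
    proof -
      have "rate0 [\<eta>] (?l \<theta>) = Da [\<eta>] (?l \<theta>) (1, \<theta> *\<^sub>R \<eta>, - (\<theta> * \<theta>) *\<^sub>R christoffel_sq G y \<eta>, 0, 0)"
        using rate0_density[OF y zero_less_one, of "[\<eta>]" t "\<theta> *\<^sub>R \<eta>" 0] by (simp add: sq)
      also have "\<dots> = Da [\<eta>] (?l \<theta>) ((1, 0, 0, 0, 0) + \<theta> *\<^sub>R (0, \<eta>, 0, 0, 0) - (\<theta> * \<theta>) *\<^sub>R (0, 0, christoffel_sq G y \<eta>, 0, 0))"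
        by (simp add: zero_prod_def)
      finally show ?thesis
        unfolding linear_diff[OF linear_Da[OF lO]] linear_add[OF linear_Da[OF lO]] linear_scale[OF linear_Da[OF lO]] by simp
    qed
    then show "((\<lambda>\<theta>. rate0 [\<eta>] (?l \<theta>)) has_real_derivative
        ?dd (\<lambda>Z. Da [\<eta>] Z (1, 0, 0, 0, 0)) (0, 0, \<eta>, 0, 0) + Da [\<eta>] ?Z (0, \<eta>, 0, 0, 0)) (at 0)"
      by (simp only:) (rule derivative_eq_intros f refl | simp)+
  qed
  then have "?dd (\<lambda>Z. Da [\<eta>] Z (1, 0, 0, 0, 0)) (0, 0, \<eta>, 0, 0) = 0"
    using 1 by (simp add: Da_def)
  \<comment> \<open>Second derivatives commute, so the time derivative falls on the velocity
    derivative, which \<open>Kf\<close> evaluates.\<close>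
  then have "?dd (\<lambda>Z. Da [\<eta>] Z (0, 0, \<eta>, 0, 0)) (1, 0, 0, 0, 0) = 0"
    unfolding Da_def using frechet_derivative_commute[OF open_Om Z smooth_af] by metis
  moreover have "?dd (\<lambda>Z. Da [\<eta>] Z (0, 0, \<eta>, 0, 0)) (1, 0, 0, 0, 0) = ?dd Kf (1, 0, 0, 0, 0) * (\<eta> \<bullet> (G y *v \<eta>))"
  proof (rule frechet_of_line[OF smooth_density_partial Z])
    have "((\<lambda>\<theta>. Kf (?Z + \<theta> *\<^sub>R (1, 0, 0, 0, 0))) has_real_derivative ?dd Kf (1, 0, 0, 0, 0)) (at 0)"
      using Om_line[OF smooth_Kf, of ?Z 0 "(1, 0, 0, 0, 0)"] Z by simp
    from DERIV_cmult_right[OF this, of "\<eta> \<bullet> (G y *v \<eta>)"]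
    show "((\<lambda>\<theta>. Da [\<eta>] (?Z + \<theta> *\<^sub>R (1, 0, 0, 0, 0)) (0, 0, \<eta>, 0, 0)) has_real_derivative
        ?dd Kf (1, 0, 0, 0, 0) * (\<eta> \<bullet> (G y *v \<eta>))) (at 0)"
      using Kf(1)[OF y zero_less_one] by simp
  qed
  ultimately show ?thesis using G_pos[OF y e0] by simp
qed

definition kappa :: "real^'n \<Rightarrow> real" where "kappa y = Kf (0, y, 0, 1, 0)"

lemma Kf_kappa:
  assumes "y \<in> Y"
  shows "Kf (t, y, 0, 1, 0) = kappa y"
proof -
  have "Kf ((0, y, 0, 1, 0) + (t, 0, 0, 0, 0)) = Kf (0, y, 0, 1, 0)"
  proof (rule const_line[OF smooth_Kf])
    fix \<theta> :: real
    show O: "(0, y, 0, 1, 0) + \<theta> *\<^sub>R (t, 0, 0, 0, 0) \<in> Om" using assms by (simp add: OmI)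
    show "frechet_derivative Kf (at ((0, y, 0, 1, 0) + \<theta> *\<^sub>R (t, 0, 0, 0, 0))) (t, 0, 0, 0, 0) = 0"
      using linear_scale[OF linear_frechet[OF smooth_Kf O], of t "(1, 0, 0, 0, 0)"] Kf_time[OF assms] by simp
  qed
  then show ?thesis by (simp add: kappa_def)
qed

lemma kappa_derivative:
  assumes "r > 0" "DP r s (1, 0) \<noteq> 0" and y: "y \<in> Y"
  shows "(kappa has_derivative (\<lambda>v. 0)) (at y)"
proof -
  have Z: "(0, y, 0, r, s) \<in> Om" using assms by (simp add: OmI)
  have "((\<lambda>y. (0, y, 0, r, s) :: 'n phase) has_derivative (\<lambda>v. (0, v, 0, 0, 0))) (at y)"
    by (auto intro!: derivative_eq_intros simp: zero_prod_def)
  from has_derivative_compose[OF this smooth_on_has_derivative[OF smooth_Kf Z]]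
  have "((\<lambda>y. Kf (0, y, 0, r, s)) has_derivative (\<lambda>v. 0)) (at y)"
    using Kf_space[OF y assms(1,2)] by simp
  then show ?thesis
  proof (rule has_derivative_transform_within_open[OF _ open_Y y])
    show "Kf (0, z, 0, r, s) = kappa z" if "z \<in> Y" for z
      using Kf(2)[OF that assms(1), of 0 0 s] by (simp add: kappa_def)
  qed
qed

end

section \<open>Conservation of circulation\<close>

lemma bounded_bilinear_matrix_vector: "bounded_bilinear ((*v) :: real^'n^'m \<Rightarrow> real^'n \<Rightarrow> real^'m)"
  unfolding bilinear_conv_bounded_bilinear[symmetric] bilinear_def
  by (auto intro!: linearI simp: matrix_vector_right_distrib matrix_vector_mult_scaleR
      matrix_vector_mult_add_rdistrib scaleR_matrix_vector_assoc)

context metric_chart begin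

definition dG :: "real^'n \<Rightarrow> real^'n \<Rightarrow> real^'n^'n" where
  "dG y = frechet_derivative G (at y)"

lemma dG: "y \<in> Y \<Longrightarrow> (G has_derivative dG y) (at y)"
  unfolding dG_def by (rule smooth_on_has_derivative[OF smooth_G])

lemma pd_G: "y \<in> Y \<Longrightarrow> pd j (\<lambda>x. G x $ l $ k) y = dG y (axis j 1) $ l $ k"
  by (rule pd_eq) (intro bounded_linear.has_derivative[OF bounded_linear_vec_nth] dG)

lemma dG_expand: "y \<in> Y \<Longrightarrow> dG y v $ i $ k = (\<Sum>j\<in>UNIV. v $ j * dG y (axis j 1) $ i $ k)"
proof -
  assume "y \<in> Y"
  then have L: "linear (dG y)" using dG has_derivative_linear by blast
  have "dG y v = dG y (\<Sum>j\<in>UNIV. v $ j *\<^sub>R axis j 1)"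
    using basis_expansion[of v] by (simp add: scalar_mult_eq_scaleR)
  then show ?thesis by (simp add: linear_sum[OF L] linear_scale[OF L])
qed

text \<open>Lowering the upper index produces the Christoffel symbols of the first kind.\<close>

lemma christoffel_lower:
  assumes y: "y \<in> Y"
  shows "(\<Sum>l\<in>UNIV. G y $ i $ l * christoffel G l j k y)
    = (dG y (axis j 1) $ i $ k + dG y (axis k 1) $ i $ j - dG y (axis i 1) $ j $ k) / 2"
proof -
  let ?c = "\<chi> l. dG y (axis j 1) $ l $ k + dG y (axis k 1) $ l $ j - dG y (axis l 1) $ j $ k"
  have c: "christoffel G l j k y = ((1/2) *\<^sub>R (matrix_inv (G y) *v ?c)) $ l" for l
    unfolding christoffel_def pd_G[OF y] matrix_vector_mult_def by simp
  have "(\<Sum>l\<in>UNIV. G y $ i $ l * christoffel G l j k y) = (G y *v ((1/2) *\<^sub>R (matrix_inv (G y) *v ?c))) $ i"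
    by (simp only: c matrix_vector_mult_def[of "G y"] vec_lambda_beta)
  also have "\<dots> = (1/2) * ?c $ i"
    unfolding matrix_vector_mult_scaleR G_matrix_inv(1)[OF y] by simp
  finally show ?thesis by simp
qed

text \<open>Of the three derivative terms in the lowered symbol, two coincide when contracted with
  \<open>u\<close> twice. The third supplies the metric part of the differential of g(u,
  u)/2.\<close>

lemma inner_christoffel_sq:
  assumes y: "y \<in> Y"
  shows "\<zeta> \<bullet> (G y *v christoffel_sq G y u) = \<zeta> \<bullet> (dG y u *v u) - (u \<bullet> (dG y \<zeta> *v u)) / 2"
proof -
  let ?A = "\<lambda>j i k. dG y (axis j 1) $ i $ k"
  define X where "X i = (\<Sum>j\<in>UNIV. \<Sum>k\<in>UNIV. ?A i j k * u $ j * u $ k)" for i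
  have row: "(G y *v christoffel_sq G y u) $ i = (dG y u *v u) $ i - (\<Sum>j\<in>UNIV. \<Sum>k\<in>UNIV. ?A i j k * u $ j * u $ k) / 2" for i
  proof -
    have "(G y *v christoffel_sq G y u) $ i
        = (\<Sum>l\<in>UNIV. \<Sum>j\<in>UNIV. \<Sum>k\<in>UNIV. G y $ i $ l * christoffel G l j k y * u $ j * u $ k)"
      by (simp add: matrix_vector_mult_def christoffel_sq_def sum_distrib_left mult.assoc)
    also have "\<dots> = (\<Sum>j\<in>UNIV. \<Sum>l\<in>UNIV. \<Sum>k\<in>UNIV. G y $ i $ l * christoffel G l j k y * u $ j * u $ k)"
      by (rule sum.swap)
    also have "\<dots> = (\<Sum>j\<in>UNIV. \<Sum>k\<in>UNIV. \<Sum>l\<in>UNIV. G y $ i $ l * christoffel G l j k y * u $ j * u $ k)"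
      by (intro sum.cong refl sum.swap)
    also have "\<dots> = (\<Sum>j\<in>UNIV. \<Sum>k\<in>UNIV. (\<Sum>l\<in>UNIV. G y $ i $ l * christoffel G l j k y) * u $ j * u $ k)"
      by (simp add: sum_distrib_right)
    also have "\<dots> = (\<Sum>j\<in>UNIV. \<Sum>k\<in>UNIV. ?A j i k * u $ j * u $ k) / 2
        + (\<Sum>j\<in>UNIV. \<Sum>k\<in>UNIV. ?A k i j * u $ j * u $ k) / 2 - (\<Sum>j\<in>UNIV. \<Sum>k\<in>UNIV. ?A i j k * u $ j * u $ k) / 2"
      unfolding christoffel_lower[OF y]
      by (simp add: sum_divide_distrib sum.distrib[symmetric] sum_subtractf[symmetric] add_divide_distrib
          diff_divide_distrib algebra_simps)
    also have "(\<Sum>j\<in>UNIV. \<Sum>k\<in>UNIV. ?A k i j * u $ j * u $ k) = (\<Sum>j\<in>UNIV. \<Sum>k\<in>UNIV. ?A j i k * u $ j * u $ k)"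
      by (subst sum.swap) (simp add: mult.commute mult.left_commute)
    also have "(\<Sum>j\<in>UNIV. \<Sum>k\<in>UNIV. ?A j i k * u $ j * u $ k) = (dG y u *v u) $ i"
      unfolding matrix_vector_mult_def by (subst sum.swap) (simp add: dG_expand[OF y, of u] sum_distrib_left sum_distrib_right mult_ac)
    finally show ?thesis by simp
  qed
  have "u \<bullet> (dG y \<zeta> *v u) = (\<Sum>j\<in>UNIV. \<Sum>k\<in>UNIV. \<Sum>i\<in>UNIV. \<zeta> $ i * (?A i j k * u $ j * u $ k))"
    by (simp add: inner_vec_def matrix_vector_mult_def dG_expand[OF y, of \<zeta>] sum_distrib_left sum_distrib_right mult_ac)
  also have "\<dots> = (\<Sum>j\<in>UNIV. \<Sum>i\<in>UNIV. \<Sum>k\<in>UNIV. \<zeta> $ i * (?A i j k * u $ j * u $ k))"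
    by (intro sum.cong refl sum.swap)
  also have "\<dots> = (\<Sum>i\<in>UNIV. \<Sum>j\<in>UNIV. \<Sum>k\<in>UNIV. \<zeta> $ i * (?A i j k * u $ j * u $ k))"
    by (rule sum.swap)
  also have "\<dots> = (\<Sum>i\<in>UNIV. \<zeta> $ i * (\<Sum>j\<in>UNIV. \<Sum>k\<in>UNIV. ?A i j k * u $ j * u $ k))"
    by (simp add: sum_distrib_left)
  finally have "u \<bullet> (dG y \<zeta> *v u) = (\<Sum>i\<in>UNIV. \<zeta> $ i * X i)" by (simp only: X_def)
  then have q: "(u \<bullet> (dG y \<zeta> *v u)) / 2 = (\<Sum>i\<in>UNIV. \<zeta> $ i * (X i / 2))"
    by (simp add: sum_divide_distrib)
  show ?thesis unfolding q unfolding inner_vec_def row X_def[symmetric]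
    by (simp add: sum_subtractf[symmetric] right_diff_distrib)
qed

lemma has_derivative_metric:
  assumes "f x \<in> Y" "(f has_derivative f') (at x)" "(u has_derivative u') (at x)" "(v has_derivative v') (at x)"
  shows "((\<lambda>x. v x \<bullet> (G (f x) *v u x)) has_derivative
    (\<lambda>h. v x \<bullet> (G (f x) *v u' h + dG (f x) (f' h) *v u x) + v' h \<bullet> (G (f x) *v u x))) (at x)"
  by (intro has_derivative_inner assms bounded_bilinear.FDERIV[OF bounded_bilinear_matrix_vector]
      has_derivative_compose[OF assms(2) dG[OF assms(1)]])

end

section \<open>The velocity form with a locally constant factor\<close>

lemma chart_homeomorphism:
  assumes "smooth_atlas A" "c \<in> A"
  shows "open (fst c)" "open (chart_image c)"
    "homeomorphism (fst c) (chart_image c) (snd c) (inv_into (fst c) (snd c))"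
  using assms unfolding smooth_atlas_def by blast+

lemma chart_inv: "smooth_atlas A \<Longrightarrow> c \<in> A \<Longrightarrow> x \<in> fst c \<Longrightarrow> inv_into (fst c) (snd c) (snd c x) = x"
  using chart_homeomorphism(3) homeomorphism_apply1 by metis

lemma transition_apply:
  "smooth_atlas A \<Longrightarrow> c \<in> A \<Longrightarrow> x \<in> fst c \<Longrightarrow> transition c c' (snd c x) = snd c' x"
  using chart_inv[of A c x] by (simp add: transition_def)

lemma metric_chart:
  assumes "riemannian_manifold A g" "c \<in> A"
  shows "metric_chart (chart_image c) (g c)"
proof
  show "open (chart_image c)" using assms chart_homeomorphism unfolding riemannian_manifold_def by blast
qed (use assms in \<open>auto simp: riemannian_manifold_def\<close>)

text \<open>The manifold may be disconnected, so a coefficient whose derivative vanishes in every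
  chart can take different values on different components.\<close>

definition locally_const :: "('a::topological_space \<Rightarrow> real) \<Rightarrow> bool" where
  "locally_const k \<longleftrightarrow> (\<forall>x. eventually (\<lambda>x'. k x' = k x) (nhds x))"

definition chart_fun :: "('m \<Rightarrow> real) \<Rightarrow> ('m, 'n::finite) chart \<Rightarrow> real^'n \<Rightarrow> real" where
  "chart_fun k c y = k (inv_into (fst c) (snd c) y)"

text \<open>Continuity of the inverse chart map turns local constancy on the manifold into local
  constancy in the chart.\<close>

lemma chart_fun_derivative:
  assumes A: "smooth_atlas A" "c \<in> A" and k: "locally_const k" and y: "y \<in> chart_image c"
  shows "(chart_fun k c has_derivative (\<lambda>v. 0)) (at y)"
proof -
  let ?i = "inv_into (fst c) (snd c)"
  note c = chart_homeomorphism[OF A]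
  have "continuous_on (chart_image c) ?i" using c(3) by (simp add: homeomorphism_def)
  then have "isCont ?i y" using c(2) y continuous_on_eq_continuous_at by blast
  then have "filterlim ?i (nhds (?i y)) (nhds y)"
    using tendsto_at_iff_tendsto_nhds[of ?i y] by (simp add: isCont_def)
  then have "\<forall>\<^sub>F z in nhds y. chart_fun k c z = chart_fun k c y"
    unfolding chart_fun_def using k filterlim_iff unfolding locally_const_def by blast
  then obtain U where U: "open U" "y \<in> U" "\<And>z. z \<in> U \<Longrightarrow> chart_fun k c z = chart_fun k c y"
    unfolding eventually_nhds by blast
  show ?thesis
    by (rule has_derivative_transform_within_open[OF has_derivative_const[of "chart_fun k c y"] U(1,2)]) (simp add: U(3))
qed

lemma smooth_chart_fun:
  assumes "smooth_atlas A" "c \<in> A" "locally_const k"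
  shows "smooth_on (chart_image c) (chart_fun k c)"
  using chart_homeomorphism(2)[OF assms(1,2)]
  by (rule smooth_on_SucI[OF _ chart_fun_derivative[OF assms]]) (auto intro: smooth_on_const chart_homeomorphism(2)[OF assms(1,2)])

definition circulation ::
  "(('m, 'n::finite) chart \<Rightarrow> real^'n \<Rightarrow> real^'n^'n) \<Rightarrow> ('m \<Rightarrow> real) \<Rightarrow> ('m, 'n) kinematic" where
  "circulation g k c t y u \<rho> S vs = chart_fun k c y * velocity_form g c t y u \<rho> S vs"

lemma circulation_single: "circulation g k c t y u \<rho> S [\<zeta>] = chart_fun k c y * (\<zeta> \<bullet> (g c y *v u))"
  by (simp add: circulation_def velocity_form_def)

lemma circulation_other: "length vs \<noteq> 1 \<Longrightarrow> circulation g k c t y u \<rho> S vs = 0"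
  by (auto simp: circulation_def velocity_form_def split: list.splits)

lemma length_1_cases: "length vs = 1 \<Longrightarrow> (\<And>\<zeta>. vs = [\<zeta>] \<Longrightarrow> thesis) \<Longrightarrow> thesis"
  by (cases vs) auto

text \<open>The transformation law is that of the metric, because velocity and argument are mapped
  by the same Jacobian.\<close>

lemma kinematic_form_circulation:
  fixes g :: "('m::{t2_space, second_countable_topology}, 'n::finite) chart \<Rightarrow> real^'n \<Rightarrow> real^'n^'n"
  assumes R: "riemannian_manifold A g" and k: "locally_const k"
  shows "kinematic_form A 1 (circulation g k)"
proof -
  have A: "smooth_atlas A" using R unfolding riemannian_manifold_def by blast
  have alt: "alt_form 1 (circulation g k c t y u \<rho> S)" for c t y u \<rho> S
    unfolding alt_form_def
  proof (intro conjI allI impI)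
    fix vs :: "(real^'n) list" and i :: nat assume "length vs = 1 \<and> i < 1"
    then have "vs[i := w] = [w]" for w by (cases vs) auto
    then show "linear (\<lambda>w. circulation g k c t y u \<rho> S (vs[i := w]))"
      by (simp add: circulation_single linearI inner_add_left distrib_left mult.left_commute)
  qed (auto simp: circulation_other)
  have smooth: "smooth_on (UNIV \<times> chart_image c \<times> UNIV \<times> {0<..} \<times> UNIV) (\<lambda>(t, y, u, \<rho>, S). circulation g k c t y u \<rho> S vs)"
    if c: "c \<in> A" for c vs
  proof -
    let ?O = "UNIV \<times> chart_image c \<times> UNIV \<times> {0<..} \<times> UNIV :: 'n phase set"
    interpret metric_chart "chart_image c" "g c" by (rule metric_chart[OF R c])
    have O: "open ?O" by (intro open_Times open_Y) auto
    have comp: "smooth_on ?O (\<lambda>Z. f (fst (snd Z)))" if "smooth_on (chart_image c) f" for f :: "real^'n \<Rightarrow> 'b::real_normed_vector"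
    proof (rule smooth_on_compose_bounded_linear[OF that _ O open_Y])
      show "bounded_linear (\<lambda>Z :: 'n phase. fst (snd Z))" by (intro bounded_linear_fst_comp bounded_linear_snd)
    qed auto
    show ?thesis
    proof (cases "length vs = 1")
      case True
      then obtain \<zeta> where \<zeta>: "vs = [\<zeta>]" by (rule length_1_cases)
      have "smooth_on ?O (\<lambda>Z. chart_fun k c (fst (snd Z)) * (\<zeta> \<bullet> (g c (fst (snd Z)) *v fst (snd (snd Z)))))"
        by (intro smooth_on_mult smooth_on_inner smooth_on_bounded_bilinear[OF bounded_bilinear_matrix_vector]
            smooth_on_const smooth_on_fst smooth_on_snd smooth_on_ident comp smooth_chart_fun[OF A c k] smooth_G O)
      then show ?thesis unfolding \<zeta> case_prod_beta circulation_single .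
    next
      case False
      then show ?thesis
        by (intro smooth_on_eqI[OF smooth_on_const[OF O, of "0 :: real"] O]) (auto simp: circulation_other)
    qed
  qed
  have overlap: "circulation g k c t (snd c x) u \<rho> S vs =
      circulation g k c' t (snd c' x) (jacobian c c' (snd c x) u) \<rho> S (map (jacobian c c' (snd c x)) vs)"
    if "c \<in> A" "c' \<in> A" "x \<in> fst c \<inter> fst c'" for c c' x t u \<rho> S vs
  proof (cases "length vs = 1")
    case True
    then obtain \<zeta> where \<zeta>: "vs = [\<zeta>]" by (rule length_1_cases)
    have "\<zeta> \<bullet> (g c (snd c x) *v u) = jacobian c c' (snd c x) \<zeta> \<bullet> (g c' (snd c' x) *v jacobian c c' (snd c x) u)"
      using R that unfolding riemannian_manifold_def by blast
    moreover have "chart_fun k c (snd c x) = chart_fun k c' (snd c' x)"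
      using chart_inv[OF A] that by (simp add: chart_fun_def)
    ultimately show ?thesis by (simp add: \<zeta> circulation_single)
  qed (simp add: circulation_other)
  show ?thesis unfolding kinematic_form_def using alt smooth overlap by blast
qed

lemma linear_functional_inner:
  fixes f :: "real^'n::finite \<Rightarrow> real"
  assumes "linear f"
  shows "f v = v \<bullet> (\<chi> j. f (axis j 1))"
proof -
  have "f v = f (\<Sum>j\<in>UNIV. v $ j *\<^sub>R axis j 1)"
    using basis_expansion[of v] by (simp add: scalar_mult_eq_scaleR)
  then show ?thesis by (simp add: linear_sum[OF assms] linear_scale[OF assms] inner_vec_def)
qed

text \<open>The enthalpy \<open>h\<close> of a barotropic fluid is a primitive of \<open>P'(\<rho>) / \<rho>\<close>.\<close>

lemma barotropic_enthalpy:
  assumes "equation_of_state P"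
  obtains h \<phi> where "smooth_on {0<..} h" "\<And>r. r > 0 \<Longrightarrow> (h has_real_derivative \<phi> r / r) (at r)"
    "\<And>r. r > 0 \<Longrightarrow> ((\<lambda>r. P r 0) has_real_derivative \<phi> r) (at r)"
proof -
  have o: "open ({0::real<..} \<times> (UNIV :: real set))" by (intro open_Times) auto
  have sP: "smooth_on ({0<..} \<times> UNIV) (\<lambda>(\<rho>, S). P \<rho> S)" using assms unfolding equation_of_state_def by blast
  have "bounded_linear (\<lambda>r :: real. (r, 0 :: real))"
    by (intro bounded_linear_Pair bounded_linear_ident bounded_linear_zero)
  from smooth_on_compose_bounded_linear[OF sP this _ o, of "{0<..}"]
  have sP0: "smooth_on {0<..} (\<lambda>r. P r 0)" by auto
  define \<phi> where "\<phi> r = frechet_derivative (\<lambda>r. P r 0) (at r) 1" for r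
  have s\<phi>: "smooth_on {0<..} \<phi>" unfolding \<phi>_def by (rule smooth_on_frechet[OF sP0])
  have P0: "((\<lambda>r. P r 0) has_real_derivative \<phi> r) (at r)" if "r > 0" for r
  proof -
    have "((\<lambda>r. P r 0) has_derivative frechet_derivative (\<lambda>r. P r 0) (at r)) (at r)"
      by (rule smooth_on_has_derivative[OF sP0]) (use that in simp)
    moreover then have "linear (frechet_derivative (\<lambda>r. P r 0) (at r))" by (rule has_derivative_linear)
    from linear_scale[OF this] have "frechet_derivative (\<lambda>r. P r 0) (at r) (v *\<^sub>R 1) = v *\<^sub>R \<phi> r" for v
      unfolding \<phi>_def .
    then have "frechet_derivative (\<lambda>r. P r 0) (at r) = (*) (\<phi> r)"
      by (simp add: fun_eq_iff)
    ultimately show ?thesis by (simp add: has_field_derivative_def)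
  qed
  have s\<psi>: "smooth_on {0<..} (\<lambda>r. \<phi> r * inverse r)"
    by (intro smooth_on_mult smooth_on_inverse smooth_on_ident s\<phi>) auto
  have cont: "isCont (\<lambda>r. \<phi> r * inverse r) r" if "r > 0" for r
    using smooth_on_continuous[OF s\<psi>] that continuous_on_eq_continuous_at[OF open_greaterThan] by blast
  \<comment> \<open>The antiderivative lives on the whole half-line of positive densities, where the
    integrand is continuous.\<close>
  have "\<exists>h. \<forall>x :: real. ereal 0 < x \<longrightarrow> x < (\<infinity> :: ereal) \<longrightarrow> (h has_vector_derivative \<phi> x * inverse x) (at x)"
    by (rule einterval_antiderivative) (use cont in auto)
  then obtain h where h: "\<And>r. r > 0 \<Longrightarrow> (h has_real_derivative \<phi> r / r) (at r)"
    by (auto simp: has_real_derivative_iff_has_vector_derivative divide_inverse)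
  have "smooth_on {0<..} h"
  proof (rule smooth_on_SucI)
    show "(h has_derivative (\<lambda>v. (\<phi> r * inverse r) * v)) (at r)" if "r \<in> {0<..}" for r
      using h[of r] that by (simp add: has_field_derivative_def divide_inverse)
    show "smooth_on {0<..} (\<lambda>r. \<phi> r * inverse r * v)" for v
      by (intro smooth_on_mult[OF _ s\<psi>] smooth_on_const) auto
  qed auto
  from that[OF this h P0] show thesis .
qed

definition jet_pos :: "'n::finite jet \<Rightarrow> real^'n" where "jet_pos z = (\<chi> i. z (Pos i))"
definition jet_vel :: "'n::finite jet \<Rightarrow> real^'n" where "jet_vel z = (\<chi> i. z (Vel i []))"

text \<open>The kinetic energy has the opposite sign to that in the Bernoulli function: for curves
  moving with the fluid, the Lie derivative adds the differential of g(u, u).\<close>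

definition bernoulli_flux ::
  "(('m, 'n::finite) chart \<Rightarrow> real^'n \<Rightarrow> real^'n^'n) \<Rightarrow> (real \<Rightarrow> real) \<Rightarrow> ('m \<Rightarrow> real) \<Rightarrow> ('m, 'n) chart \<Rightarrow> 'n jet \<Rightarrow> 'n form" where
  "bernoulli_flux g h k c z vs = (if vs = [] then chart_fun k c (jet_pos z) *
     (h (z (Dens [])) - (jet_vel z \<bullet> (g c (jet_pos z) *v jet_vel z)) / 2) else 0)"

lemma jet_pos_jet_of [simp]: "jet_pos (jet_of t y u \<rho> S) = y"
  and jet_vel_jet_of [simp]: "jet_vel (jet_of t y u \<rho> S) = u y"
  by (simp_all add: jet_pos_def jet_vel_def vec_eq_iff)

text \<open>Order 0 is enough: the flux involves position, velocity and density, that is, it is a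
  smooth function of the linear projection \<open>?\<pi>\<close> of the jet.\<close>

lemma jet_form_bernoulli_flux:
  fixes g :: "('m::{t2_space, second_countable_topology}, 'n::finite) chart \<Rightarrow> real^'n \<Rightarrow> real^'n^'n"
  assumes R: "riemannian_manifold A g" and k: "locally_const k" and h: "smooth_on {0<..} h"
  shows "jet_form A 0 (bernoulli_flux g h k)"
  unfolding jet_form_def
proof (intro conjI ballI allI impI)
  have A: "smooth_atlas A" using R unfolding riemannian_manifold_def by blast
  show "alt_form 0 (bernoulli_flux g h k c z)" for c z
    unfolding alt_form_def bernoulli_flux_def by simp
  show "\<exists>ka. \<forall>c\<in>A. \<forall>z\<in>jet_domain c. \<forall>z'\<in>jet_domain c.
      (\<forall>a. jet_order a \<le> ka \<longrightarrow> z a = z' a) \<longrightarrow> bernoulli_flux g h k c z = bernoulli_flux g h k c z'"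
    by (rule exI[of _ 0]) (simp add: bernoulli_flux_def jet_pos_def jet_vel_def fun_eq_iff)
  show "jet_Ck i (jet_domain c) (\<lambda>z. bernoulli_flux g h k c z vs)" if c: "c \<in> A" for c vs i
  proof -
    interpret metric_chart "chart_image c" "g c" by (rule metric_chart[OF R c])
    let ?V = "chart_image c \<times> UNIV \<times> {0<..} :: ((real^'n) \<times> (real^'n) \<times> real) set"
    let ?\<pi> = "\<lambda>z :: 'n jet. (jet_pos z, jet_vel z, z (Dens []))"
    \<comment> \<open>\<open>?e a\<close> is the direction in which \<open>?\<pi>\<close> moves with
      coordinate \<open>a\<close>; it is zero for time, entropy and all coordinates of positive
      order.\<close>
    let ?e = "\<lambda>a :: 'n jet_coord. (case a of Pos i \<Rightarrow> (axis i 1, 0, 0) | Vel i l \<Rightarrow> (if l = [] then (0, axis i 1, 0) else 0)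
      | Dens l \<Rightarrow> (if l = [] then (0, 0, 1) else 0) | _ \<Rightarrow> 0) :: (real^'n) \<times> (real^'n) \<times> real"
    let ?\<kappa> = "\<lambda>q :: (real^'n) \<times> (real^'n) \<times> real. if vs = [] then chart_fun k c (fst q) *
      (h (snd (snd q)) - (fst (snd q) \<bullet> (g c (fst q) *v fst (snd q))) * (1/2)) else 0"
    have V: "open ?V" by (intro open_Times open_Y) auto
    have smY: "smooth_on ?V (\<lambda>q. f (fst q))" if "smooth_on (chart_image c) f" for f :: "real^'n \<Rightarrow> 'b::real_normed_vector"
      by (rule smooth_on_compose_bounded_linear[OF that bounded_linear_fst V open_Y]) auto
    have smh: "smooth_on ?V (\<lambda>q. h (snd (snd q)))"
      by (rule smooth_on_compose_bounded_linear[OF h _ V]) (auto intro: bounded_linear_snd_comp bounded_linear_snd)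
    have "smooth_on ?V ?\<kappa>"
    proof (cases "vs = []")
      case True
      have "smooth_on ?V (\<lambda>q. chart_fun k c (fst q) * (h (snd (snd q)) - (fst (snd q) \<bullet> (g c (fst q) *v fst (snd q))) * (1/2)))"
        by (intro smooth_on_mult smooth_on_diff smooth_on_inner smooth_on_const
            smooth_on_bounded_bilinear[OF bounded_bilinear_matrix_vector] smooth_on_fst smooth_on_snd smooth_on_ident
            smY smooth_chart_fun[OF A c k] smooth_G smh V)
      then show ?thesis using True by simp
    next
      case False
      then show ?thesis using smooth_on_const[OF V, of "0 :: real"] by simp
    qed
    then have "jet_Ck i (jet_domain c) (\<lambda>z. ?\<kappa> (?\<pi> z))"
    proof (rule jet_Ck_smooth_compose[OF open_jet_domain[OF open_Y] V, rotated -1])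
      show "?\<pi> z \<in> ?V" if "z \<in> jet_domain c" for z
        using that by (simp add: jet_domain_def jet_pos_def)
      have "continuous_on UNIV (\<lambda>z :: 'n jet. (jet_pos z, jet_vel z, z (Dens [])))"
        unfolding jet_pos_def jet_vel_def
        by (intro continuous_on_Pair continuous_on_vec_lambda continuous_on_product_coordinates)
      then show "continuous_on (jet_domain c) ?\<pi>" by (rule continuous_on_subset) simp
      show "?\<pi> (z(a := s)) = ?\<pi> z + (s - z a) *\<^sub>R ?e a" for z a s
        by (cases a) (auto simp: jet_pos_def jet_vel_def vec_eq_iff axis_def)
    qed
    moreover have "(\<lambda>z. ?\<kappa> (?\<pi> z)) = (\<lambda>z. bernoulli_flux g h k c z vs)"
      by (simp add: fun_eq_iff bernoulli_flux_def)
    ultimately show ?thesis by (simp only:)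
  qed
  fix c c' W t vs y and u u' :: "real^'n \<Rightarrow> real^'n" and \<rho> S \<rho>' S' :: "real^'n \<Rightarrow> real"
  assume c: "c \<in> A" "c' \<in> A"
    and *: "open W \<and> W \<subseteq> snd c ` (fst c \<inter> fst c') \<and>
        smooth_on W u \<and> smooth_on W \<rho> \<and> smooth_on W S \<and>
        smooth_on (transition c c' ` W) u' \<and> smooth_on (transition c c' ` W) \<rho>' \<and>
        smooth_on (transition c c' ` W) S' \<and>
        (\<forall>y\<in>W. \<rho> y > 0 \<and> u' (transition c c' y) = jacobian c c' y (u y) \<and>
           \<rho>' (transition c c' y) = \<rho> y \<and> S' (transition c c' y) = S y)"
    and y: "y \<in> W"
  from * y obtain x where x: "x \<in> fst c \<inter> fst c'" "y = snd c x" by blast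
  have tr: "transition c c' y = snd c' x" using transition_apply[OF A c(1)] x by simp
  have "chart_fun k c y = chart_fun k c' (snd c' x)"
    using chart_inv[OF A c(1)] chart_inv[OF A c(2)] x by (simp add: chart_fun_def)
  moreover have "v \<bullet> (g c y *v w) = jacobian c c' y v \<bullet> (g c' (snd c' x) *v jacobian c c' y w)" for v w
    using R c x unfolding riemannian_manifold_def by blast
  moreover have "u' (snd c' x) = jacobian c c' y (u y)" "\<rho>' (snd c' x) = \<rho> y"
    using * y tr by auto
  ultimately show "bernoulli_flux g h k c (jet_of t y u \<rho> S) vs
      = bernoulli_flux g h k c' (jet_of t (transition c c' y) u' \<rho>' S') (map (jacobian c c' y) vs)"
    unfolding bernoulli_flux_def tr by simp
qed

text \<open>The Christoffel term and the derivative of the metric along \<open>u\<close> leave half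
  the \<zeta>-derivative of the metric on (u, u); with g(u' \<zeta>, u) from the Lie derivative this
  is the differential of g(u, u)/2. The pressure term is minus the differential of the enthalpy, and
  the locally constant factor is not differentiated.\<close>

lemma fluid_rate_circulation:
  fixes g :: "('m::{t2_space, second_countable_topology}, 'n::finite) chart \<Rightarrow> real^'n \<Rightarrow> real^'n^'n"
  assumes R: "riemannian_manifold A g" and k: "locally_const k" and c: "c \<in> A"
    and W: "open W" "W \<subseteq> chart_image c" "\<And>y. y \<in> W \<Longrightarrow> \<rho> y > 0" "x \<in> W"
    and u: "(u has_derivative u') (at x)" and \<rho>: "(\<rho> has_derivative \<rho>') (at x)"
    and h: "(h has_real_derivative \<phi> / \<rho> x) (at (\<rho> x))"
    and P: "((\<lambda>r. P r 0) has_real_derivative \<phi>) (at (\<rho> x))" "\<And>r S. r > 0 \<Longrightarrow> P r S = P r 0"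
  shows "fluid_rate P (g c) (circulation g k c) t u \<rho> S x [\<zeta>]
    = - ext_deriv (\<lambda>x. bernoulli_flux g h k c (jet_of t x u \<rho> S)) x [\<zeta>]"
proof -
  have A: "smooth_atlas A" using R unfolding riemannian_manifold_def by blast
  interpret metric_chart "chart_image c" "g c" by (rule metric_chart[OF R c])
  have x: "x \<in> chart_image c" "\<rho> x > 0" using W by auto
  let ?G = "g c" and ?\<kappa> = "chart_fun k c x"
  have lin\<rho>: "linear \<rho>'" using \<rho> has_derivative_linear by blast
  have "((\<lambda>x. P (\<rho> x) 0) has_derivative (\<lambda>v. \<phi> * \<rho>' v)) (at x)"
    using has_derivative_compose[OF \<rho> P(1)[unfolded has_field_derivative_def]] by simp
  then have DP: "((\<lambda>x. P (\<rho> x) (S x)) has_derivative (\<lambda>v. \<phi> * \<rho>' v)) (at x)"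
    by (rule has_derivative_transform_within_open[OF _ W(1,4)]) (use P(2) W(3) in metis)
  have Ggrad: "\<zeta> \<bullet> (?G x *v grad ?G (\<lambda>x. P (\<rho> x) (S x)) x) = \<phi> * \<rho>' \<zeta>"
  proof -
    have "\<zeta> \<bullet> (?G x *v grad ?G (\<lambda>x. P (\<rho> x) (S x)) x) = \<zeta> \<bullet> (\<chi> j. \<phi> * \<rho>' (axis j 1))"
      unfolding grad_def G_matrix_inv(1)[OF x(1)] pd_eq[OF DP] ..
    also have "\<dots> = \<phi> * (\<zeta> \<bullet> (\<chi> j. \<rho>' (axis j 1)))"
      by (simp add: inner_vec_def sum_distrib_left mult_ac)
    finally show ?thesis using linear_functional_inner[OF lin\<rho>, of \<zeta>] by simp
  qed
  have D1: "((\<lambda>(t, y, u, \<rho>, S). circulation g k c t y u \<rho> S [\<zeta>]) has_derivative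
      (\<lambda>h. ?\<kappa> * (\<zeta> \<bullet> (?G x *v fst (snd (snd h)) + dG x (fst (snd h)) *v u x)))) (at (t, x, u x, \<rho> x, S x))"
  proof -
    let ?Z = "(t, x, u x, \<rho> x, S x)"
    have p: "((\<lambda>Z. fst (snd Z)) has_derivative (\<lambda>h. fst (snd h))) (at ?Z)"
      "((\<lambda>Z. fst (snd (snd Z))) has_derivative (\<lambda>h. fst (snd (snd h)))) (at ?Z)"
      by (auto intro!: derivative_eq_intros)
    have \<kappa>: "((\<lambda>Z. chart_fun k c (fst (snd Z))) has_derivative (\<lambda>h. 0)) (at ?Z)"
      using has_derivative_compose[OF p(1), of "chart_fun k c" "\<lambda>_. 0"] chart_fun_derivative[OF A c k x(1)] by simp
    from has_derivative_mult[OF \<kappa> has_derivative_metric[OF _ p(1) p(2) has_derivative_const[of \<zeta>]]] x(1)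
    show ?thesis by (simp add: case_prod_unfold circulation_single)
  qed
  have lhs: "fluid_rate P ?G (circulation g k c) t u \<rho> S x [\<zeta>]
      = ?\<kappa> * ((u x \<bullet> (dG x \<zeta> *v u x)) / 2 - \<phi> / \<rho> x * \<rho>' \<zeta> + u' \<zeta> \<bullet> (?G x *v u x))"
    unfolding fluid_rate_def frechet_derivative_eq[OF D1] frechet_derivative_eq[OF u]
    using arg_cong[OF inner_christoffel_sq[OF x(1), of \<zeta> "u x"], of "(*) ?\<kappa>"] Ggrad
    by (simp add: circulation_single matrix_vector_right_distrib matrix_vector_mult_diff_distrib
        matrix_vector_mult_scaleR inner_add_right inner_diff_right algebra_simps
        linear_neg[OF matrix_vector_mul_linear])
  have D2: "((\<lambda>x. chart_fun k c x * (h (\<rho> x) - (u x \<bullet> (?G x *v u x)) * (1/2))) has_derivative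
      (\<lambda>v. ?\<kappa> * (\<phi> / \<rho> x * \<rho>' v - (u x \<bullet> (?G x *v u' v + dG x v *v u x) + u' v \<bullet> (?G x *v u x)) * (1/2)))) (at x)"
  proof -
    have "((\<lambda>x. h (\<rho> x)) has_derivative (\<lambda>v. \<phi> / \<rho> x * \<rho>' v)) (at x)"
      using has_derivative_compose[OF \<rho> h[unfolded has_field_derivative_def]] .
    from has_derivative_mult[OF chart_fun_derivative[OF A c k x(1)] has_derivative_diff[OF this
          has_derivative_mult_left[OF has_derivative_metric[OF x(1) has_derivative_ident u u], of "1/2"]]]
    show ?thesis by simp
  qed
  have "ext_deriv (\<lambda>x. bernoulli_flux g h k c (jet_of t x u \<rho> S)) x [\<zeta>] =
      ?\<kappa> * (\<phi> / \<rho> x * \<rho>' \<zeta> - (u x \<bullet> (?G x *v u' \<zeta> + dG x \<zeta> *v u x) + u' \<zeta> \<bullet> (?G x *v u x)) * (1/2))"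
    unfolding ext_deriv_def bernoulli_flux_def using frechet_derivative_eq[OF D2] by simp
  then show ?thesis
    unfolding lhs using G_inner_commute[OF x(1), of "u x" "u' \<zeta>"] by (simp add: inner_add_right algebra_simps)
qed

lemma conserved_circulation:
  fixes g :: "('m::{t2_space, second_countable_topology}, 'n::finite) chart \<Rightarrow> real^'n \<Rightarrow> real^'n^'n"
  assumes R: "riemannian_manifold A g" and eos: "equation_of_state P" "barotropic P" and k: "locally_const k"
  shows "conserved A g P 1 (circulation g k)"
proof -
  obtain h \<phi> where h: "smooth_on {0<..} h" "\<And>r. r > 0 \<Longrightarrow> (h has_real_derivative \<phi> r / r) (at r)"
    "\<And>r. r > 0 \<Longrightarrow> ((\<lambda>r. P r 0) has_real_derivative \<phi> r) (at r)"
    using barotropic_enthalpy[OF eos(1)] by metis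
  have P0: "P r S = P r 0" if "r > 0" for r S using eos(2) that unfolding barotropic_def by metis
  have A: "smooth_atlas A" using R unfolding riemannian_manifold_def by blast
  note kin = kinematic_form_circulation[OF R k]
  have j: "jet_form A (1 - 1) (bernoulli_flux g h k)" using jet_form_bernoulli_flux[OF R k h(1)] by simp
  show ?thesis unfolding conserved_def
  proof (intro conjI exI[of _ "bernoulli_flux g h k"] kin j ballI allI impI)
    fix c t W u \<rho> S y vs
    assume c: "c \<in> A" and sol: "formal_solution g P c t W u \<rho> S" and y: "y \<in> W"
    have W: "open W" "W \<subseteq> chart_image c" "\<And>y. y \<in> W \<Longrightarrow> \<rho> t y > 0"
      and sm: "smooth_on W (u t)" "smooth_on W (\<rho> t)"
      using sol unfolding formal_solution_def by auto
    note oc = chart_homeomorphism(2)[OF A c]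
    show "advective_deriv (circulation g k) c t u \<rho> S y vs
        = - ext_deriv (\<lambda>x. bernoulli_flux g h k c (jet_of t x (u t) (\<rho> t) (S t))) y vs"
    proof (cases "length vs = 1")
      case True
      then obtain \<zeta> where \<zeta>: "vs = [\<zeta>]" by (rule length_1_cases)
      show ?thesis
        unfolding advective_deriv_eq_fluid_rate[OF kin c oc sol y] \<zeta>
        by (rule fluid_rate_circulation[where h=h and \<phi>="\<phi> (\<rho> t y)" and P=P, OF R k c W y
              smooth_on_has_derivative[OF sm(1) y] smooth_on_has_derivative[OF sm(2) y]
              h(2)[OF W(3)[OF y]] h(3)[OF W(3)[OF y]]]) (assumption, erule P0)
    next
      case False
      have "(\<lambda>(t, y, u, \<rho>, S). circulation g k c t y u \<rho> S vs) = (\<lambda>_. 0)"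
        by (auto simp: circulation_other[OF False])
      then have "advective_deriv (circulation g k) c t u \<rho> S y vs = 0"
        unfolding advective_deriv_eq_fluid_rate[OF kin c oc sol y] fluid_rate_def
        using False by (auto intro!: sum.neutral circulation_other)
      moreover have "ext_deriv (\<lambda>x. bernoulli_flux g h k c (jet_of t x (u t) (\<rho> t) (S t))) y vs = 0"
      proof -
        \<comment> \<open>The flux lives on the empty list, which arises by omitting an entry only
          from a list of length one.\<close>
        have "drop_nth i vs \<noteq> []" if "i < length vs" for i using False that by auto
        then show ?thesis
          unfolding ext_deriv_def bernoulli_flux_def by (simp del: append_is_Nil_conv)
      qed
      ultimately show ?thesis by simp
    qed
  qed
qed

section \<open>The classification\<close>

lemma alt_form_diff:
  "alt_form p f \<Longrightarrow> alt_form p g \<Longrightarrow> alt_form p (\<lambda>vs. f vs - g vs)"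
  unfolding alt_form_def by (auto intro: linear_compose_sub)

lemmas kinematic_alt = kinematic_form_def[THEN iffD1, THEN conjunct1, rule_format]
lemmas kinematic_smooth = kinematic_form_def[THEN iffD1, THEN conjunct2, THEN conjunct1, rule_format]
lemmas kinematic_overlap = kinematic_form_def[THEN iffD1, THEN conjunct2, THEN conjunct2, rule_format]

lemma kinematic_form_diff:
  fixes \<alpha> \<alpha>' :: "('m::{t2_space, second_countable_topology}, 'n::finite) kinematic"
  assumes A: "smooth_atlas A" and \<alpha>: "kinematic_form A p \<alpha>" "kinematic_form A p \<alpha>'"
  shows "kinematic_form A p (\<lambda>c t y u \<rho> S vs. \<alpha> c t y u \<rho> S vs - \<alpha>' c t y u \<rho> S vs)"
  unfolding kinematic_form_def
proof (intro conjI ballI allI impI)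
  show "alt_form p (\<lambda>vs. \<alpha> c t y u \<rho> S vs - \<alpha>' c t y u \<rho> S vs)"
    if "c \<in> A" "y \<in> chart_image c" "\<rho> > 0" for c t u \<rho> S y
    by (intro alt_form_diff kinematic_alt[OF \<alpha>(1)] kinematic_alt[OF \<alpha>(2)] that)
  show "smooth_on (UNIV \<times> chart_image c \<times> UNIV \<times> {0<..} \<times> UNIV)
      (\<lambda>(t, y, u, \<rho>, S). \<alpha> c t y u \<rho> S vs - \<alpha>' c t y u \<rho> S vs)" if c: "c \<in> A" for c vs
  proof -
    have "open (UNIV \<times> chart_image c \<times> UNIV \<times> {0<..} \<times> UNIV :: 'n phase set)"
      by (intro open_Times chart_homeomorphism(2)[OF A c]) auto
    from smooth_on_diff[OF this kinematic_smooth[OF \<alpha>(1) c] kinematic_smooth[OF \<alpha>(2) c]]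
    show ?thesis by (simp add: case_prod_unfold)
  qed
  show "\<alpha> c t (snd c x) u \<rho> S vs - \<alpha>' c t (snd c x) u \<rho> S vs =
      \<alpha> c' t (snd c' x) (jacobian c c' (snd c x) u) \<rho> S (map (jacobian c c' (snd c x)) vs)
      - \<alpha>' c' t (snd c' x) (jacobian c c' (snd c x) u) \<rho> S (map (jacobian c c' (snd c x)) vs)"
    if "c \<in> A" "c' \<in> A" "x \<in> fst c \<inter> fst c'" "\<rho> > 0" for c c' x t u \<rho> S vs
    using kinematic_overlap[OF \<alpha>(1) that] kinematic_overlap[OF \<alpha>(2) that] by simp
qed

lemma jet_form_diff:
  fixes \<beta> \<beta>' :: "('m::{t2_space, second_countable_topology}, 'n::finite) chart \<Rightarrow> 'n jet \<Rightarrow> 'n form"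
  assumes A: "smooth_atlas A" and \<beta>: "jet_form A q \<beta>" "jet_form A q \<beta>'"
  shows "jet_form A q (\<lambda>c z vs. \<beta> c z vs - \<beta>' c z vs)"
  unfolding jet_form_def
proof (intro conjI ballI allI impI)
  show "alt_form q (\<lambda>vs. \<beta> c z vs - \<beta>' c z vs)" if "c \<in> A" "z \<in> jet_domain c" for c z
    by (intro alt_form_diff jet_form_alt[OF \<beta>(1)] jet_form_alt[OF \<beta>(2)] that)
  obtain k where k: "\<forall>c\<in>A. \<forall>z\<in>jet_domain c. \<forall>z'\<in>jet_domain c.
        (\<forall>a. jet_order a \<le> k \<longrightarrow> z a = z' a) \<longrightarrow> \<beta> c z = \<beta> c z'"
    by (rule exE[OF jet_form_finite_order[OF \<beta>(1)]])
  obtain k' where k': "\<forall>c\<in>A. \<forall>z\<in>jet_domain c. \<forall>z'\<in>jet_domain c.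
        (\<forall>a. jet_order a \<le> k' \<longrightarrow> z a = z' a) \<longrightarrow> \<beta>' c z = \<beta>' c z'"
    by (rule exE[OF jet_form_finite_order[OF \<beta>(2)]])
  show "\<exists>k. \<forall>c\<in>A. \<forall>z\<in>jet_domain c. \<forall>z'\<in>jet_domain c. (\<forall>a. jet_order a \<le> k \<longrightarrow> z a = z' a) \<longrightarrow>
      (\<lambda>vs. \<beta> c z vs - \<beta>' c z vs) = (\<lambda>vs. \<beta> c z' vs - \<beta>' c z' vs)"
  proof (intro exI[of _ "max k k'"] ballI impI)
    fix c and z z' :: "'n jet"
    assume c: "c \<in> A" "z \<in> jet_domain c" "z' \<in> jet_domain c" and eq: "\<forall>a. jet_order a \<le> max k k' \<longrightarrow> z a = z' a"
    have "\<beta> c z = \<beta> c z'" by (rule k[rule_format, OF c]) (simp add: eq[rule_format])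
    moreover have "\<beta>' c z = \<beta>' c z'" by (rule k'[rule_format, OF c]) (simp add: eq[rule_format])
    ultimately show "(\<lambda>vs. \<beta> c z vs - \<beta>' c z vs) = (\<lambda>vs. \<beta> c z' vs - \<beta>' c z' vs)" by (simp only:)
  qed
  show "jet_Ck i (jet_domain c) (\<lambda>z. \<beta> c z vs - \<beta>' c z vs)" if c: "c \<in> A" for c vs i
    by (rule jet_Ck_diff[OF open_jet_domain[OF chart_homeomorphism(2)[OF A c]] jet_form_Ck[OF \<beta>(1) c] jet_form_Ck[OF \<beta>(2) c]])
  fix c c' W t vs y and u u' :: "real^'n \<Rightarrow> real^'n" and \<rho> S \<rho>' S' :: "real^'n \<Rightarrow> real"
  assume h: "c \<in> A" "c' \<in> A" "open W \<and> W \<subseteq> snd c ` (fst c \<inter> fst c') \<and>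
        smooth_on W u \<and> smooth_on W \<rho> \<and> smooth_on W S \<and>
        smooth_on (transition c c' ` W) u' \<and> smooth_on (transition c c' ` W) \<rho>' \<and>
        smooth_on (transition c c' ` W) S' \<and>
        (\<forall>y\<in>W. \<rho> y > 0 \<and> u' (transition c c' y) = jacobian c c' y (u y) \<and>
           \<rho>' (transition c c' y) = \<rho> y \<and> S' (transition c c' y) = S y)" "y \<in> W"
  show "\<beta> c (jet_of t y u \<rho> S) vs - \<beta>' c (jet_of t y u \<rho> S) vs =
      \<beta> c' (jet_of t (transition c c' y) u' \<rho>' S') (map (jacobian c c' y) vs)
      - \<beta>' c' (jet_of t (transition c c' y) u' \<rho>' S') (map (jacobian c c' y) vs)"
    using jet_form_overlap[OF \<beta>(1) h] jet_form_overlap[OF \<beta>(2) h] by simp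
qed

lemma fluid_rate_diff:
  assumes "(\<lambda>(t, y, u, \<rho>, S). a t y u \<rho> S ws) differentiable (at (t, x, u x, \<rho> x, S x))"
    "(\<lambda>(t, y, u, \<rho>, S). a' t y u \<rho> S ws) differentiable (at (t, x, u x, \<rho> x, S x))"
  shows "fluid_rate P G (\<lambda>t y u \<rho> S vs. a t y u \<rho> S vs - a' t y u \<rho> S vs) t u \<rho> S x ws
    = fluid_rate P G a t u \<rho> S x ws - fluid_rate P G a' t u \<rho> S x ws"
proof -
  have "((\<lambda>(t, y, u, \<rho>, S). a t y u \<rho> S ws - a' t y u \<rho> S ws) has_derivative
      (\<lambda>v. frechet_derivative (\<lambda>(t, y, u, \<rho>, S). a t y u \<rho> S ws) (at (t, x, u x, \<rho> x, S x)) v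
        - frechet_derivative (\<lambda>(t, y, u, \<rho>, S). a' t y u \<rho> S ws) (at (t, x, u x, \<rho> x, S x)) v)) (at (t, x, u x, \<rho> x, S x))"
    using has_derivative_diff[OF assms[unfolded frechet_derivative_works]] by (simp add: case_prod_unfold)
  from frechet_derivative_eq[OF this] show ?thesis
    unfolding fluid_rate_def by (simp add: right_diff_distrib sum_subtractf)
qed

text \<open>The difference of the fluxes is a flux for the difference, since both are smooth on
  fields. This makes the remainder conserved when the circulation part is split off.\<close>

lemma conserved_diff:
  fixes \<alpha> \<alpha>' :: "('m::{t2_space, second_countable_topology}, 'n::finite) kinematic"
  assumes A: "smooth_atlas A" and cons: "conserved A g P p \<alpha>" "conserved A g P p \<alpha>'"
  shows "conserved A g P p (\<lambda>c t y u \<rho> S vs. \<alpha> c t y u \<rho> S vs - \<alpha>' c t y u \<rho> S vs)"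
proof -
  note kin = cons[unfolded conserved_def, THEN conjunct1]
  obtain \<beta> where \<beta>: "jet_form A (p - 1) \<beta>"
    and flux: "\<forall>c\<in>A. \<forall>t W u \<rho> S. formal_solution g P c t W u \<rho> S \<longrightarrow>
           (\<forall>y\<in>W. \<forall>vs. advective_deriv \<alpha> c t u \<rho> S y vs =
              - ext_deriv (\<lambda>x. \<beta> c (jet_of t x (u t) (\<rho> t) (S t))) y vs)"
    using cons(1) unfolding conserved_def by (elim conjE exE)
  obtain \<beta>' where \<beta>': "jet_form A (p - 1) \<beta>'"
    and flux': "\<forall>c\<in>A. \<forall>t W u \<rho> S. formal_solution g P c t W u \<rho> S \<longrightarrow>
           (\<forall>y\<in>W. \<forall>vs. advective_deriv \<alpha>' c t u \<rho> S y vs =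
              - ext_deriv (\<lambda>x. \<beta>' c (jet_of t x (u t) (\<rho> t) (S t))) y vs)"
    using cons(2) unfolding conserved_def by (elim conjE exE)
  note kin' = kinematic_form_diff[OF A kin]
  let ?\<alpha> = "\<lambda>c t y u \<rho> S vs. \<alpha> c t y u \<rho> S vs - \<alpha>' c t y u \<rho> S vs"
  let ?\<beta> = "\<lambda>c z vs. \<beta> c z vs - \<beta>' c z vs"
  have "advective_deriv ?\<alpha> c t u \<rho> S y vs = - ext_deriv (\<lambda>x. ?\<beta> c (jet_of t x (u t) (\<rho> t) (S t))) y vs"
    if c: "c \<in> A" and sol: "formal_solution g P c t W u \<rho> S" and y: "y \<in> W" for c t W u \<rho> S y vs
  proof -
    note oc = chart_homeomorphism(2)[OF A c]
    have W: "open W" "W \<subseteq> chart_image c" "smooth_on W (u t)" "smooth_on W (\<rho> t)" "smooth_on W (S t)"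
      "\<And>y. y \<in> W \<Longrightarrow> \<rho> t y > 0" using sol unfolding formal_solution_def by auto
    have Z: "(t, y, u t y, \<rho> t y, S t y) \<in> UNIV \<times> chart_image c \<times> UNIV \<times> {0<..} \<times> UNIV" using W y by auto
    have "advective_deriv ?\<alpha> c t u \<rho> S y vs = advective_deriv \<alpha> c t u \<rho> S y vs - advective_deriv \<alpha>' c t u \<rho> S y vs"
      unfolding advective_deriv_eq_fluid_rate[OF kin' c oc sol y]
        advective_deriv_eq_fluid_rate[OF kin(1) c oc sol y] advective_deriv_eq_fluid_rate[OF kin(2) c oc sol y]
      by (rule fluid_rate_diff; rule smooth_on_differentiable[OF _ Z])
         (rule kinematic_smooth[OF kin(1) c], rule kinematic_smooth[OF kin(2) c])
    moreover have "ext_deriv (\<lambda>x. ?\<beta> c (jet_of t x (u t) (\<rho> t) (S t))) y vs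
        = ext_deriv (\<lambda>x. \<beta> c (jet_of t x (u t) (\<rho> t) (S t))) y vs - ext_deriv (\<lambda>x. \<beta>' c (jet_of t x (u t) (\<rho> t) (S t))) y vs"
    proof -
      have d: "(\<lambda>x. \<beta> c (jet_of t x (u t) (\<rho> t) (S t)) ws) differentiable (at y)"
        "(\<lambda>x. \<beta>' c (jet_of t x (u t) (\<rho> t) (S t)) ws) differentiable (at y)" for ws
        by (rule smooth_on_differentiable[OF smooth_on_jet_form[OF \<beta> c oc W] y]
            smooth_on_differentiable[OF smooth_on_jet_form[OF \<beta>' c oc W] y], assumption)+
      show ?thesis unfolding ext_deriv_def
        by (simp add: frechet_derivative_eq[OF has_derivative_diff[OF d[unfolded frechet_derivative_works]]]
            right_diff_distrib sum_subtractf)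
    qed
    ultimately show ?thesis using flux[rule_format, OF c sol y] flux'[rule_format, OF c sol y] by simp
  qed
  then show ?thesis unfolding conserved_def
    by (intro conjI kin' exI[of _ ?\<beta>] jet_form_diff[OF A \<beta> \<beta>'] ballI allI impI)
qed

section \<open>States at which the pressure has nonzero derivatives\<close>

context closed_rate begin

lemma DP_partial:
  assumes "r > 0"
  shows "((\<lambda>r. P r s) has_real_derivative DP r s (1, 0)) (at r)"
    and "((\<lambda>s. P r s) has_real_derivative DP r s (0, 1)) (at s)"
proof -
  have D: "((\<lambda>(\<rho>, S). P \<rho> S) has_derivative DP r s) (at (r, s))"
    unfolding DP_def by (rule smooth_on_has_derivative[OF smooth_P]) (use assms in auto)
  then have L: "linear (DP r s)" by (rule has_derivative_linear)
  have "((\<lambda>r. (r, s)) has_derivative (\<lambda>h. h *\<^sub>R (1, 0))) (at r)" "((\<lambda>s. (r, s)) has_derivative (\<lambda>h. h *\<^sub>R (0, 1))) (at s)"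
    by (auto intro!: derivative_eq_intros)
  from this[THEN has_derivative_compose, OF D] show
    "((\<lambda>r. P r s) has_real_derivative DP r s (1, 0)) (at r)" "((\<lambda>s. P r s) has_real_derivative DP r s (0, 1)) (at s)"
    unfolding linear_scale[OF L] by (simp_all add: has_real_derivative_iff_has_vector_derivative has_vector_derivative_def)
qed

lemma DP_nonzero:
  assumes "equation_of_state P"
  obtains r s where "r > 0" "DP r s (1, 0) \<noteq> 0 \<or> DP r s (0, 1) \<noteq> 0"
  using assms DP_partial[THEN DERIV_imp_deriv] unfolding equation_of_state_def by metis

text \<open>If P_S vanished at every state, P would be constant in S at each fixed density.\<close>

lemma DP_entropy_nonzero:
  assumes "\<not> barotropic P"
  obtains r s where "r > 0" "DP r s (0, 1) \<noteq> 0"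
proof -
  have "barotropic P" if "\<And>r s. r > 0 \<Longrightarrow> DP r s (0, 1) = 0"
    unfolding barotropic_def
  proof (intro exI allI impI)
    fix r s :: real assume r: "r > 0"
    have "((\<lambda>s. P r s) has_real_derivative 0) (at s)" for s using DP_partial(2)[OF r, of s] that[OF r, of s] by simp
    then show "P r s = (\<lambda>r. P r 0) r" using DERIV_isconst_all[of "P r" s 0] by auto
  qed
  then show thesis using that assms by blast
qed

lemma DP_density_nonzero:
  assumes "equation_of_state P" "barotropic P"
  obtains r s where "r > 0" "DP r s (1, 0) \<noteq> 0"
proof -
  obtain r s where r: "r > 0" "DP r s (1, 0) \<noteq> 0 \<or> DP r s (0, 1) \<noteq> 0" using DP_nonzero[OF assms(1)] .
  obtain f where "P r = (\<lambda>s. f r)" using assms(2) r(1) unfolding barotropic_def by blast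
  then have "((\<lambda>s. P r s) has_real_derivative 0) (at s)" by simp
  then have "DP r s (0, 1) = 0" by (rule DERIV_unique[OF DP_partial(2)[OF r(1)]])
  then show thesis using that[OF r(1), of s] r(2) by simp
qed

end

section \<open>From one chart to the manifold\<close>

lemma closed_rate_dim:
  fixes \<alpha> :: "('m::{t2_space, second_countable_topology}, 'n::finite) kinematic"
  assumes R: "riemannian_manifold A g" and p: "1 \<le> p" "p < CARD('n)"
    and eos: "equation_of_state P" and cons: "conserved A g P p \<alpha>" and c: "c \<in> A"
  shows "closed_rate_dim (chart_image c) (g c) P p (\<alpha> c)"
proof -
  interpret metric_chart "chart_image c" "g c" by (rule metric_chart[OF R c])
  have kin: "kinematic_form A p \<alpha>" using cons unfolding conserved_def by (elim conjE)
  show ?thesis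
  proof
    show "alt_form p (\<alpha> c t y u \<rho> S)" if "y \<in> chart_image c" "\<rho> > 0" for t y u \<rho> S
      by (rule kinematic_alt[OF kin c that])
    show "smooth_on (UNIV \<times> chart_image c \<times> UNIV \<times> {0<..} \<times> UNIV) (\<lambda>(t, y, u, \<rho>, S). \<alpha> c t y u \<rho> S ws)" for ws
      by (rule kinematic_smooth[OF kin c])
    show "smooth_on ({0<..} \<times> UNIV) (\<lambda>(\<rho>, S). P \<rho> S)" using eos unfolding equation_of_state_def by blast
    show "smooth_on W (\<lambda>x. fluid_rate P (g c) (\<alpha> c) t u \<rho> S x ws)"
      if "open W" "W \<subseteq> chart_image c" "smooth_on W u" "smooth_on W \<rho>" "smooth_on W S" "\<And>y. y \<in> W \<Longrightarrow> \<rho> y > 0"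
      for t W u \<rho> S ws by (rule conserved_closed(1)[OF cons c open_Y that])
    show "ext_deriv (fluid_rate P (g c) (\<alpha> c) t u \<rho> S) y vs = 0"
      if "open W" "W \<subseteq> chart_image c" "smooth_on W u" "smooth_on W \<rho>" "smooth_on W S" "\<And>y. y \<in> W \<Longrightarrow> \<rho> y > 0" "y \<in> W"
      for t W u \<rho> S y vs by (rule conserved_closed(2)[OF cons c open_Y that])
  qed (use p in auto)
qed

lemma depends_only_on_tx_of_chart:
  assumes "\<And>c t y u \<rho> S vs. c \<in> A \<Longrightarrow> y \<in> chart_image c \<Longrightarrow> \<rho> > 0 \<Longrightarrow> \<alpha> c t y u \<rho> S vs = \<alpha> c t y 0 1 0 vs"
  shows "depends_only_on_tx A \<alpha>"
  unfolding depends_only_on_tx_def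
proof (intro ballI allI impI ext)
  fix c t y u u' vs and \<rho> S \<rho>' S' :: real assume "c \<in> A" "y \<in> chart_image c" "0 < \<rho> \<and> 0 < \<rho>'"
  then show "\<alpha> c t y u \<rho> S vs = \<alpha> c t y u' \<rho>' S' vs"
    using assms[of c y \<rho> t u S vs] assms[of c y \<rho>' t u' S' vs] by simp
qed

text \<open>For p = 1 a single state with nonzero P_S forces K = 0 at every time and position,
  because K is independent of the state; then \<open>af_affine\<close> has no velocity term
  left.\<close>

lemma conserved_depends_only_on_tx:
  fixes \<alpha> :: "('m::{t2_space, second_countable_topology}, 'n::finite) kinematic"
  assumes R: "riemannian_manifold A g" and p: "1 \<le> p" "p < CARD('n)"
    and eos: "equation_of_state P" and cons: "conserved A g P p \<alpha>" and nb: "p \<ge> 2 \<or> \<not> barotropic P"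
  shows "depends_only_on_tx A \<alpha>"
proof (rule depends_only_on_tx_of_chart)
  fix c t y u \<rho> S vs assume c: "c \<in> A" and y: "y \<in> chart_image c" "(\<rho> :: real) > 0"
  interpret closed_rate_dim "chart_image c" "g c" P p "\<alpha> c" by (rule closed_rate_dim[OF R p eos cons c])
  show "\<alpha> c t y u \<rho> S vs = \<alpha> c t y 0 1 0 vs"
  proof (cases "p \<ge> 2")
    case True
    then show ?thesis using af_position_only[OF True y, of vs t u S] by (simp add: af_def)
  next
    case False
    then have p1: "p = 1" using p by simp
    interpret closed_rate_circulation "chart_image c" "g c" P p "\<alpha> c"
      by unfold_locales (use p1 DP_nonzero[OF eos] in metis)+
    obtain r s where r: "r > 0" "DP r s (0, 1) \<noteq> 0" using DP_entropy_nonzero nb False by blast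
    have "Kf (t, y, 0, 1, 0) = 0"
      using Kf_entropy_pressure[OF y(1) r(1), of t 0 s] r(2) Kf(2)[OF y(1) r(1), of t 0 s] by simp
    then have "\<alpha> c t y u \<rho> S [v] = \<alpha> c t y 0 1 0 [v]" for v
      using af_affine[OF y, of v t u S] by (simp add: af_def)
    moreover have "\<alpha> c t y u \<rho> S vs = 0" "\<alpha> c t y 0 1 0 vs = 0" if "length vs \<noteq> 1"
      using alt_form_length[OF alt_a[OF y(1)]] that p1 y(2) by auto
    ultimately show ?thesis using length_1_cases[of vs] by metis
  qed
qed

lemma circulation_coefficient:
  fixes \<alpha> :: "('m::{t2_space, second_countable_topology}, 'n::finite) kinematic"
  assumes R: "riemannian_manifold A g" and n: "1 < CARD('n)"
    and eos: "equation_of_state P" "barotropic P" and cons: "conserved A g P 1 \<alpha>" and c: "c \<in> A"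
  obtains \<kappa> where "\<And>t y u \<rho> S v. y \<in> chart_image c \<Longrightarrow> \<rho> > 0 \<Longrightarrow>
      \<alpha> c t y u \<rho> S [v] = \<alpha> c t y 0 1 0 [v] + \<kappa> y * (v \<bullet> (g c y *v u))"
    "\<And>y. y \<in> chart_image c \<Longrightarrow> (\<kappa> has_derivative (\<lambda>v. 0)) (at y)"
proof -
  interpret closed_rate_dim "chart_image c" "g c" P 1 "\<alpha> c" by (rule closed_rate_dim[OF R _ n eos(1) cons c]) simp
  interpret closed_rate_circulation "chart_image c" "g c" P 1 "\<alpha> c"
    by unfold_locales (use DP_nonzero[OF eos(1)] in metis)+
  obtain r s where r: "r > 0" "DP r s (1, 0) \<noteq> 0" using DP_density_nonzero[OF eos] .
  show thesis
  proof (rule that[of kappa])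
    show "\<alpha> c t y u \<rho> S [v] = \<alpha> c t y 0 1 0 [v] + kappa y * (v \<bullet> (g c y *v u))"
      if "y \<in> chart_image c" "\<rho> > 0" for t y u \<rho> S v
      using af_affine[OF that, of v t u S] Kf_kappa[OF that(1), of t] G_inner_commute[OF that(1), of u v] by (simp add: af_def)
    show "(kappa has_derivative (\<lambda>v. 0)) (at y)" if "y \<in> chart_image c" for y
      by (rule kappa_derivative[OF r that])
  qed
qed

text \<open>The coefficients found in the charts glue to one function on the manifold: each is
  determined by how \<alpha> depends on u, and both \<alpha> and the metric obey their
  transformation laws.\<close>

lemma circulation_decomposition:
  fixes \<alpha> :: "('m::{t2_space, second_countable_topology}, 'n::finite) kinematic"
  assumes R: "riemannian_manifold A g" and n: "1 < CARD('n)"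
    and eos: "equation_of_state P" "barotropic P" and cons: "conserved A g P 1 \<alpha>"
  obtains k where "locally_const k"
    "\<And>c t y u \<rho> S v. c \<in> A \<Longrightarrow> y \<in> chart_image c \<Longrightarrow> \<rho> > 0 \<Longrightarrow>
      \<alpha> c t y u \<rho> S [v] = \<alpha> c t y 0 1 0 [v] + circulation g k c t y u \<rho> S [v]"
proof -
  have A: "smooth_atlas A" using R unfolding riemannian_manifold_def by blast
  have kin: "kinematic_form A 1 \<alpha>" using cons unfolding conserved_def by (elim conjE)
  have "\<forall>c\<in>A. \<exists>\<kappa>. (\<forall>t y u \<rho> S v. y \<in> chart_image c \<longrightarrow> \<rho> > 0 \<longrightarrow>
      \<alpha> c t y u \<rho> S [v] = \<alpha> c t y 0 1 0 [v] + \<kappa> y * (v \<bullet> (g c y *v u))) \<and>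
      (\<forall>y\<in>chart_image c. (\<kappa> has_derivative (\<lambda>v. 0)) (at y))"
  proof
    fix c assume "c \<in> A"
    from circulation_coefficient[OF R n eos cons this]
    show "\<exists>\<kappa>. (\<forall>t y u \<rho> S v. y \<in> chart_image c \<longrightarrow> \<rho> > 0 \<longrightarrow>
      \<alpha> c t y u \<rho> S [v] = \<alpha> c t y 0 1 0 [v] + \<kappa> y * (v \<bullet> (g c y *v u))) \<and>
      (\<forall>y\<in>chart_image c. (\<kappa> has_derivative (\<lambda>v. 0)) (at y))" by metis
  qed
  from bchoice[OF this] obtain \<kappa> where \<kappa>:
    "\<And>c t y u \<rho> S v. c \<in> A \<Longrightarrow> y \<in> chart_image c \<Longrightarrow> \<rho> > 0 \<Longrightarrow>
      \<alpha> c t y u \<rho> S [v] = \<alpha> c t y 0 1 0 [v] + \<kappa> c y * (v \<bullet> (g c y *v u))"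
    "\<And>c y. c \<in> A \<Longrightarrow> y \<in> chart_image c \<Longrightarrow> (\<kappa> c has_derivative (\<lambda>v. 0)) (at y)" by blast
  have agree: "\<kappa> c (snd c x) = \<kappa> c' (snd c' x)" if c: "c \<in> A" "c' \<in> A" and x: "x \<in> fst c \<inter> fst c'" for c c' x
  proof -
    let ?J = "jacobian c c' (snd c x)" and ?e = "axis undefined 1 :: real^'n"
    have y: "snd c x \<in> chart_image c" "snd c' x \<in> chart_image c'" using x by (auto simp: chart_image_def)
    have "smooth_on (snd c ` (fst c \<inter> fst c')) (transition c c')" using A c unfolding smooth_atlas_def by blast
    then have "transition c c' differentiable (at (snd c x))" by (rule smooth_on_differentiable) (use x in blast)
    then have "linear ?J" unfolding jacobian_def by (rule linear_frechet_derivative)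
    then have J0: "?J 0 = 0" by (rule linear_0)
    have overlap: "\<alpha> c 0 (snd c x) u 1 0 [?e] = \<alpha> c' 0 (snd c' x) (?J u) 1 0 [?J ?e]" for u
      using kinematic_overlap[OF kin c x, of 1 0 u 0 "[?e]"] by simp
    \<comment> \<open>Comparing the overlap law at \<open>?e\<close> and at 0 cancels the part of
      \<alpha> that does not depend on u.\<close>
    have "\<kappa> c (snd c x) * (?e \<bullet> (g c (snd c x) *v ?e)) = \<kappa> c' (snd c' x) * (?J ?e \<bullet> (g c' (snd c' x) *v ?J ?e))"
      using \<kappa>(1)[OF c(1) y(1), of 1 0 ?e 0 ?e] \<kappa>(1)[OF c(2) y(2), of 1 0 "?J ?e" 0 "?J ?e"] overlap[of ?e] overlap[of 0] J0
      by simp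
    moreover have "?e \<bullet> (g c (snd c x) *v ?e) = ?J ?e \<bullet> (g c' (snd c' x) *v ?J ?e)"
      using R c x unfolding riemannian_manifold_def by blast
    moreover have "?e \<bullet> (g c (snd c x) *v ?e) > 0"
      by (rule metric_chart.G_pos[OF metric_chart[OF R c(1)] y(1)]) (simp add: axis_eq_0_iff)
    ultimately show ?thesis by simp
  qed
  \<comment> \<open>Some chart around each point is selected; by \<open>agree\<close> every other
    chart gives the same value.\<close>
  define ch where "ch x = (SOME c. c \<in> A \<and> x \<in> fst c)" for x
  have ch: "ch x \<in> A" "x \<in> fst (ch x)" for x
  proof -
    have "\<exists>c. c \<in> A \<and> x \<in> fst c" using A unfolding smooth_atlas_def by blast
    from someI_ex[OF this] show "ch x \<in> A" "x \<in> fst (ch x)" unfolding ch_def by blast+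
  qed
  define k where "k x = \<kappa> (ch x) (snd (ch x) x)" for x
  have k: "k x = \<kappa> c (snd c x)" if "c \<in> A" "x \<in> fst c" for c x
    unfolding k_def using agree[OF ch(1)[of x] that(1), of x] ch(2)[of x] that(2) by simp
  have "locally_const k"
    unfolding locally_const_def
  proof
    fix x
    let ?c = "ch x"
    note c = chart_homeomorphism[OF A ch(1)[of x]]
    have y: "snd ?c x \<in> chart_image ?c" using ch(2) by (auto simp: chart_image_def)
    obtain d where d: "d > 0" "ball (snd ?c x) d \<subseteq> chart_image ?c" using c(2) y by (meson openE)
    \<comment> \<open>A zero derivative gives constancy on convex sets, so a ball inside the chart
      is used.\<close>
    have const: "\<kappa> ?c z = \<kappa> ?c (snd ?c x)" if "z \<in> ball (snd ?c x) d" for z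
    proof -
      have "(\<kappa> ?c has_derivative (\<lambda>v. 0)) (at w within ball (snd ?c x) d)" if "w \<in> ball (snd ?c x) d" for w
        using \<kappa>(2)[OF ch(1)] d(2) that by (blast intro: has_derivative_at_withinI)
      from has_derivative_zero_constant[OF convex_ball this] obtain C where "\<And>w. w \<in> ball (snd ?c x) d \<Longrightarrow> \<kappa> ?c w = C" by blast
      then show ?thesis using that d(1) by simp
    qed
    have "continuous_on (fst ?c) (snd ?c)" using c(3) by (simp add: homeomorphism_def)
    then have U: "open (fst ?c \<inter> snd ?c -` ball (snd ?c x) d)" using continuous_on_open_vimage c(1) by (metis inf_commute open_ball)
    show "\<forall>\<^sub>F x' in nhds x. k x' = k x"
      unfolding eventually_nhds
    proof (intro exI[of _ "fst ?c \<inter> snd ?c -` ball (snd ?c x) d"] conjI ballI U)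
      show "x \<in> fst ?c \<inter> snd ?c -` ball (snd ?c x) d" using ch(2) d(1) by simp
      fix x' assume x': "x' \<in> fst ?c \<inter> snd ?c -` ball (snd ?c x) d"
      then have "k x' = \<kappa> ?c (snd ?c x')" by (intro k ch(1)) simp
      also have "\<dots> = \<kappa> ?c (snd ?c x)" using x' by (intro const) simp
      finally show "k x' = k x" by (simp add: k_def)
    qed
  qed
  then show thesis
  proof (rule that)
    fix c t y u \<rho> S v assume c: "c \<in> A" and y: "y \<in> chart_image c" and \<rho>: "(\<rho> :: real) > 0"
    obtain x where x: "x \<in> fst c" "y = snd c x" using y by (auto simp: chart_image_def)
    have "chart_fun k c y = \<kappa> c y"
      unfolding chart_fun_def x(2) chart_inv[OF A c x(1)] by (rule k[OF c x(1)])
    then show "\<alpha> c t y u \<rho> S [v] = \<alpha> c t y 0 1 0 [v] + circulation g k c t y u \<rho> S [v]"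
      using \<kappa>(1)[OF c y \<rho>] by (simp add: circulation_single)
  qed
qed

lemma velocity_form_eq_circulation: "velocity_form g = circulation g (\<lambda>_. 1)"
  by (simp add: fun_eq_iff circulation_def chart_fun_def)

text \<open>Linear fields with a prescribed value at one point show that \<open>\<Theta>\<close> does not depend on \<open>u\<close>, whereas
  \<open>d \<Theta> = g(u, \<cdot>)\<close> does.\<close>

lemma velocity_form_not_exact:
  fixes g :: "('m::{t2_space, second_countable_topology}, 'n::finite) chart \<Rightarrow> real^'n \<Rightarrow> real^'n^'n"
  assumes R: "riemannian_manifold A g" and \<Theta>: "kinematic_form A 0 \<Theta>"
    and c: "c \<in> A" and y0: "y0 \<in> chart_image c"
    and exact: "\<And>t W u \<rho> S y. formal_solution g P c t W u \<rho> S \<Longrightarrow> y \<in> W \<Longrightarrow>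
      on_fields (velocity_form g) c t u \<rho> S y = ext_deriv (on_fields \<Theta> c t u \<rho> S) y"
  shows False
proof -
  interpret metric_chart "chart_image c" "g c" by (rule metric_chart[OF R c])
  let ?Om = "UNIV \<times> chart_image c \<times> UNIV \<times> {0<..} \<times> UNIV :: 'n phase set"
  let ?\<Theta> = "\<lambda>(t, y, u, \<rho>, S). \<Theta> c t y u \<rho> S []"
  have sm: "smooth_on ?Om ?\<Theta>" by (rule kinematic_smooth[OF \<Theta> c])
  define D where "D y a = frechet_derivative ?\<Theta> (at (0, y, a, 1, 0))" for y a
  have D: "(?\<Theta> has_derivative D y a) (at (0, y, a, 1, 0))" if "y \<in> chart_image c" for y a
    unfolding D_def by (rule smooth_on_has_derivative[OF sm]) (use that in auto)
  have lin: "linear (D y a)" if "y \<in> chart_image c" for y a using D[OF that] has_derivative_linear by blast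
  \<comment> \<open>Exactness at \<open>y\<close> for a field with value \<open>a\<close> there and
    a gradient of rank one. The left side does not see the amplitude \<open>w\<close>.\<close>
  have key: "\<zeta> \<bullet> (g c y *v a) = D y a (0, \<zeta>, (\<xi> \<bullet> \<zeta>) *\<^sub>R w, 0, 0)"
    if y: "y \<in> chart_image c" for y \<zeta> a \<xi> w
  proof -
    let ?u = "\<lambda>x. a + (\<xi> \<bullet> (x - y)) *\<^sub>R w"
    have su: "smooth_on (chart_image c) ?u"
      by (intro smooth_on_add smooth_on_scaleR smooth_on_const smooth_on_inner_offset open_Y)
    obtain U Q \<Sigma> where sol: "formal_solution g P c 0 (chart_image c) U Q \<Sigma>" "U 0 = ?u" "Q 0 = (\<lambda>_. 1)" "\<Sigma> 0 = (\<lambda>_. 0)"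
      by (rule formal_solution_extension[OF open_Y order_refl su smooth_on_const[OF open_Y, of 1] smooth_on_const[OF open_Y, of 0]])
         auto
    have "((\<lambda>x. (0, x, ?u x, 1, 0) :: 'n phase) has_derivative (\<lambda>v. (0, v, (\<xi> \<bullet> v) *\<^sub>R w, 0, 0))) (at y)"
      by (auto intro!: derivative_eq_intros simp: zero_prod_def)
    moreover have "(?\<Theta> has_derivative D y a) (at (0, y, ?u y, 1, 0))" using D[OF y, of a] by simp
    ultimately have "((\<lambda>x. ?\<Theta> (0, x, ?u x, 1, 0)) has_derivative (\<lambda>v. D y a (0, v, (\<xi> \<bullet> v) *\<^sub>R w, 0, 0))) (at y)"
      by (rule has_derivative_compose)
    then have "((\<lambda>x. on_fields \<Theta> c 0 U Q \<Sigma> x []) has_derivative (\<lambda>v. D y a (0, v, (\<xi> \<bullet> v) *\<^sub>R w, 0, 0))) (at y)"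
      by (simp add: on_fields_def sol)
    from frechet_derivative_eq[OF this]
    have "ext_deriv (on_fields \<Theta> c 0 U Q \<Sigma>) y [\<zeta>] = D y a (0, \<zeta>, (\<xi> \<bullet> \<zeta>) *\<^sub>R w, 0, 0)"
      by (simp add: ext_deriv_def)
    moreover have "on_fields (velocity_form g) c 0 U Q \<Sigma> y [\<zeta>] = \<zeta> \<bullet> (g c y *v a)"
      by (simp add: on_fields_def velocity_form_def sol)
    ultimately show ?thesis using exact[OF sol(1) y] by simp
  qed
  let ?e = "axis undefined 1 :: real^'n"
  \<comment> \<open>With \<open>\<xi>\<close> and \<open>\<zeta>\<close> both equal to
    \<open>?e\<close>, the amplitudes \<open>w\<close> and 0 give the same left side in
    \<open>key\<close>.\<close>
  have Du: "D y a (0, 0, w, 0, 0) = 0" if y: "y \<in> chart_image c" for y a w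
    using key[OF y, of ?e a ?e w] key[OF y, of ?e a ?e 0] linear_diff[OF lin[OF y], of a "(0, ?e, w, 0, 0)" "(0, ?e, 0, 0, 0)"]
    by (simp add: inner_axis_axis zero_prod_def)
  have "?\<Theta> (0, y, ?e, 1, 0) = ?\<Theta> (0, y, 0, 1, 0)" if y: "y \<in> chart_image c" for y
  proof -
    have "((\<lambda>\<theta>. ?\<Theta> (0, y, \<theta> *\<^sub>R ?e, 1, 0)) has_real_derivative 0) (at \<theta>)" for \<theta>
    proof -
      have "((\<lambda>\<theta>. (0, y, \<theta> *\<^sub>R ?e, 1, 0) :: 'n phase) has_derivative (\<lambda>h. (0, 0, h *\<^sub>R ?e, 0, 0))) (at \<theta>)"
        by (auto intro!: derivative_eq_intros simp: zero_prod_def)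
      from has_derivative_compose[OF this D[OF y]] show ?thesis
        by (simp add: Du[OF y] has_field_derivative_def lambda_zero)
    qed
    then show ?thesis using DERIV_isconst_all[of "\<lambda>\<theta>. ?\<Theta> (0, y, \<theta> *\<^sub>R ?e, 1, 0)" 1 0] by simp
  qed
  then have eq: "?\<Theta> (0, y, 0, 1, 0) = ?\<Theta> (0, y, ?e, 1, 0)" if "y \<in> chart_image c" for y using that by simp
  have Dy: "((\<lambda>y. ?\<Theta> (0, y, a, 1, 0)) has_derivative (\<lambda>v. D y0 a (0, v, 0, 0, 0))) (at y0)" for a
  proof -
    have "((\<lambda>y. (0, y, a, 1, 0) :: 'n phase) has_derivative (\<lambda>v. (0, v, 0, 0, 0))) (at y0)"
      by (auto intro!: derivative_eq_intros simp: zero_prod_def)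
    from has_derivative_compose[OF this D[OF y0]] show ?thesis .
  qed
  have "((\<lambda>y. ?\<Theta> (0, y, ?e, 1, 0)) has_derivative (\<lambda>v. D y0 0 (0, v, 0, 0, 0))) (at y0)"
    by (rule has_derivative_transform_within_open[OF Dy[of 0] open_Y y0]) (rule eq)
  then have "(\<lambda>v. D y0 ?e (0, v, 0, 0, 0)) = (\<lambda>v. D y0 0 (0, v, 0, 0, 0))" using Dy[of ?e] has_derivative_unique by blast
  \<comment> \<open>The position derivatives of \<Theta> at the velocities \<open>?e\<close> and 0
    coincide, although by \<open>key\<close> one is g(?e, ?e) and the other is 0.\<close>
  then have "D y0 ?e (0, ?e, 0, 0, 0) = D y0 0 (0, ?e, 0, 0, 0)" by (rule fun_cong)
  then have "?e \<bullet> (g c y0 *v ?e) = 0"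
    using key[OF y0, of ?e ?e 0 0] key[OF y0, of ?e 0 0 0] by simp
  then show False using G_pos[OF y0, of ?e] by (simp add: axis_eq_0_iff)
qed

text \<open>A nonzero vector at one point reveals the dependence on u; the other alternative
  contradicts \<open>velocity_form_not_exact\<close>.\<close>

lemma velocity_form_nontrivial:
  fixes g :: "('m::{t2_space, second_countable_topology}, 'n::finite) chart \<Rightarrow> real^'n \<Rightarrow> real^'n^'n"
  assumes R: "riemannian_manifold A g"
  shows "\<not> trivial_density A g P 1 (velocity_form g)"
proof
  have A: "smooth_atlas A" using R unfolding riemannian_manifold_def by blast
  then obtain c x where c: "c \<in> A" "x \<in> fst c" unfolding smooth_atlas_def by blast
  then have y: "snd c x \<in> chart_image c" by (auto simp: chart_image_def)
  let ?e = "axis undefined 1 :: real^'n"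
  have pos: "?e \<bullet> (g c (snd c x) *v ?e) > 0"
    by (rule metric_chart.G_pos[OF metric_chart[OF R c(1)] y]) (simp add: axis_eq_0_iff)
  assume "trivial_density A g P 1 (velocity_form g)"
  then consider "depends_only_on_tx A (velocity_form g)"
    | \<Theta> where "kinematic_form A 0 \<Theta>" "\<forall>c\<in>A. \<forall>t W u \<rho> S. formal_solution g P c t W u \<rho> S \<longrightarrow>
           (\<forall>y\<in>W. on_fields (velocity_form g) c t u \<rho> S y = ext_deriv (on_fields \<Theta> c t u \<rho> S) y)"
    unfolding trivial_density_def by (elim disjE exE conjE) auto
  then show False
  proof cases
    case 1
    then have "velocity_form g c 0 (snd c x) ?e 1 0 = velocity_form g c 0 (snd c x) 0 1 0"
      using c(1) y unfolding depends_only_on_tx_def by simp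
    from fun_cong[OF this, of "[?e]"] pos show False by (simp add: velocity_form_def)
  next
    case 2
    show False by (rule velocity_form_not_exact[OF R 2(1) c(1) y 2(2)[rule_format, OF c(1)]])
  qed
qed

text \<open>The remainder is the difference of \<alpha> and the circulation part: conserved by
  linearity, and free of the fluid variables because \<alpha> is affine in u with exactly this
  linear part.\<close>

lemma conserved_barotropic_decomposition:
  fixes \<alpha> :: "('m::{t2_space, second_countable_topology}, 'n::finite) kinematic"
  assumes R: "riemannian_manifold A g" and n: "1 < CARD('n)"
    and eos: "equation_of_state P" "barotropic P" and cons: "conserved A g P 1 \<alpha>"
  shows "\<exists>k \<alpha>\<^sub>0. locally_const k \<and> conserved A g P 1 \<alpha>\<^sub>0 \<and> depends_only_on_tx A \<alpha>\<^sub>0 \<and>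
    (\<forall>c\<in>A. \<forall>t. \<forall>x\<in>fst c. \<forall>u \<rho> S vs. \<alpha> c t (snd c x) u \<rho> S vs
      = k x * velocity_form g c t (snd c x) u \<rho> S vs + \<alpha>\<^sub>0 c t (snd c x) u \<rho> S vs)"
proof -
  have A: "smooth_atlas A" using R unfolding riemannian_manifold_def by blast
  have kin: "kinematic_form A 1 \<alpha>" using cons unfolding conserved_def by (elim conjE)
  obtain k where k: "locally_const k" and dec: "\<And>c t y u \<rho> S v. c \<in> A \<Longrightarrow> y \<in> chart_image c \<Longrightarrow> \<rho> > 0 \<Longrightarrow>
      \<alpha> c t y u \<rho> S [v] = \<alpha> c t y 0 1 0 [v] + circulation g k c t y u \<rho> S [v]"
    using circulation_decomposition[OF R n eos cons] by metis
  let ?\<alpha>\<^sub>0 = "\<lambda>c t y u \<rho> S vs. \<alpha> c t y u \<rho> S vs - circulation g k c t y u \<rho> S vs"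
  show ?thesis
  proof (intro exI[of _ k] exI[of _ ?\<alpha>\<^sub>0] conjI k conserved_diff[OF A cons conserved_circulation[OF R eos k]] ballI allI)
    show "depends_only_on_tx A ?\<alpha>\<^sub>0"
    proof (rule depends_only_on_tx_of_chart)
      fix c t y u \<rho> S vs assume c: "c \<in> A" and y: "y \<in> chart_image c" and \<rho>: "(\<rho> :: real) > 0"
      show "?\<alpha>\<^sub>0 c t y u \<rho> S vs = ?\<alpha>\<^sub>0 c t y 0 1 0 vs"
      proof (cases "length vs = 1")
        case True
        then obtain v where "vs = [v]" by (rule length_1_cases)
        then show ?thesis using dec[OF c y \<rho>, of t u S v] by (simp add: circulation_single)
      next
        case False
        then show ?thesis
          using alt_form_length[OF kinematic_alt[OF kin c y \<rho>]] alt_form_length[OF kinematic_alt[OF kin c y zero_less_one]]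
          by (simp add: circulation_other)
      qed
    qed
    show "\<alpha> c t (snd c x) u \<rho> S vs = k x * velocity_form g c t (snd c x) u \<rho> S vs + ?\<alpha>\<^sub>0 c t (snd c x) u \<rho> S vs"
      if "c \<in> A" "x \<in> fst c" for c t x u \<rho> S vs
      by (simp add: circulation_def chart_fun_def chart_inv[OF A that])
  qed
qed

text \<open>The circulation is singled out only modulo trivial conserved densities, whence
  \<open>\<alpha>\<^sub>0\<close>, and up to a factor that may differ between the components of the
  manifold, whence a locally constant k.\<close>

theorem theorem3p2:
  fixes A :: "('m::{t2_space, second_countable_topology}, 'n::finite) chart set"
    and g :: "('m, 'n) chart \<Rightarrow> real^'n \<Rightarrow> real^'n^'n"
    and p :: nat
  assumes "riemannian_manifold A g"
    and "CARD('n) > 1"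
    and "1 \<le> p" and "p \<le> CARD('n) - 1"
  shows
    "(\<forall>\<alpha>. (\<forall>P. equation_of_state P \<longrightarrow> conserved A g P p \<alpha>) \<longrightarrow>
        (\<forall>P. equation_of_state P \<longrightarrow> trivial_density A g P p \<alpha>)) \<and>
     (\<forall>P. equation_of_state P \<longrightarrow>
        (\<not> barotropic P \<longrightarrow> \<not> (\<exists>\<alpha>. nontrivial_conserved A g P p \<alpha>)) \<and>
        (barotropic P \<longrightarrow>
           (p = 1 \<longrightarrow> nontrivial_conserved A g P p (velocity_form g)) \<and>
           (\<forall>\<alpha>. nontrivial_conserved A g P p \<alpha> \<longrightarrow> p = 1 \<and>
              (\<exists>k \<alpha>\<^sub>0. (\<forall>x::'m. eventually (\<lambda>x'. k x' = k x) (nhds x)) \<and>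
                 conserved A g P p \<alpha>\<^sub>0 \<and> trivial_density A g P p \<alpha>\<^sub>0 \<and>
                 (\<forall>c\<in>A. \<forall>t. \<forall>x\<in>fst c. \<forall>u \<rho> S vs. \<rho> > 0 \<longrightarrow>
                    \<alpha> c t (snd c x) u \<rho> S vs =
                      k x * velocity_form g c t (snd c x) u \<rho> S vs
                      + \<alpha>\<^sub>0 c t (snd c x) u \<rho> S vs)))))"
proof -
  note R = assms(1)
  have p: "p < CARD('n)" using assms(2,4) by simp
  note tx = conserved_depends_only_on_tx[OF R assms(3) p]
  have general: "trivial_density A g P p \<alpha>"
    if "\<forall>P. equation_of_state P \<longrightarrow> conserved A g P p \<alpha>" for \<alpha> P
  proof -
    \<comment> \<open>A density conserved for every equation of state is conserved for P = S, which
      is not barotropic. The conclusion obtained there, dependence on (t, x) alone, does not mention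
      the pressure and so gives triviality for every P.\<close>
    let ?P = "\<lambda>\<rho> S :: real. S"
    have "open ({0::real<..} \<times> (UNIV :: real set))" by (intro open_Times) auto
    from smooth_on_linear[OF bounded_linear_snd this]
    have "smooth_on ({0::real<..} \<times> (UNIV :: real set)) (\<lambda>(\<rho>, S). S)" by (simp add: case_prod_unfold)
    then have eos: "equation_of_state ?P"
      unfolding equation_of_state_def by (auto intro!: exI[of _ 1])
    have "\<not> barotropic ?P"
    proof
      assume "barotropic ?P"
      then obtain f :: "real \<Rightarrow> real" where "\<forall>\<rho> S. \<rho> > 0 \<longrightarrow> S = f \<rho>" unfolding barotropic_def by blast
      from this[rule_format, of 1 0] this[rule_format, of 1 1] show False by simp
    qed
    then have "depends_only_on_tx A \<alpha>" using tx[OF eos] that eos by blast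
    then show ?thesis unfolding trivial_density_def by (rule disjI1)
  qed
  have none: "\<not> nontrivial_conserved A g P p \<alpha>" if "equation_of_state P" "p \<ge> 2 \<or> \<not> barotropic P" for P \<alpha>
    unfolding nontrivial_conserved_def trivial_density_def using tx[OF that(1) _ that(2)] by blast
  have velocity: "nontrivial_conserved A g P p (velocity_form g)"
    if "equation_of_state P" "barotropic P" "p = 1" for P
    unfolding nontrivial_conserved_def that(3)
    using velocity_form_nontrivial[OF R] conserved_circulation[OF R that(1,2), of "\<lambda>_. 1"]
    by (simp add: velocity_form_eq_circulation locally_const_def)
  have unique: "p = 1 \<and> (\<exists>k \<alpha>\<^sub>0. (\<forall>x::'m. eventually (\<lambda>x'. k x' = k x) (nhds x)) \<and>
      conserved A g P p \<alpha>\<^sub>0 \<and> trivial_density A g P p \<alpha>\<^sub>0 \<and>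
      (\<forall>c\<in>A. \<forall>t. \<forall>x\<in>fst c. \<forall>u \<rho> S vs. \<rho> > 0 \<longrightarrow>
        \<alpha> c t (snd c x) u \<rho> S vs = k x * velocity_form g c t (snd c x) u \<rho> S vs + \<alpha>\<^sub>0 c t (snd c x) u \<rho> S vs))"
    if eos: "equation_of_state P" "barotropic P" and \<alpha>: "nontrivial_conserved A g P p \<alpha>" for P \<alpha>
  proof -
    have p1: "p = 1" using none[OF eos(1)] \<alpha> assms(3) by (metis le_neq_implies_less Suc_1 Suc_leI One_nat_def)
    have cons: "conserved A g P 1 \<alpha>" using \<alpha> p1 unfolding nontrivial_conserved_def by blast
    obtain k \<alpha>\<^sub>0 where k: "locally_const k" and \<alpha>\<^sub>0: "conserved A g P 1 \<alpha>\<^sub>0" "depends_only_on_tx A \<alpha>\<^sub>0"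
      and dec: "\<forall>c\<in>A. \<forall>t. \<forall>x\<in>fst c. \<forall>u \<rho> S vs. \<alpha> c t (snd c x) u \<rho> S vs
        = k x * velocity_form g c t (snd c x) u \<rho> S vs + \<alpha>\<^sub>0 c t (snd c x) u \<rho> S vs"
      using conserved_barotropic_decomposition[OF R assms(2) eos cons] by (elim exE conjE)
    have "trivial_density A g P 1 \<alpha>\<^sub>0" unfolding trivial_density_def using \<alpha>\<^sub>0(2) by (rule disjI1)
    then show ?thesis
      unfolding p1 using k[unfolded locally_const_def] \<alpha>\<^sub>0(1) dec
      by (intro conjI refl exI[of _ k] exI[of _ \<alpha>\<^sub>0] ballI allI impI) auto
  qed
  show ?thesis
    by (intro conjI allI impI general notI) (use none velocity unique in blast)+
qed

end
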